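(* Let $\xi_0,\xi_1,\dots$ be nondegenerate i.i.d. complex random variables with $\mathbb{P}(\xi_0=0)=0$ and $\mathbb{E}\log(1+|\xi_0|)<\infty$. Suppose there exist a function $p:[0,\infty)\to[0,\infty)$, a number $T_0\in(0,\infty)$, a sequence of positive integers $L_n\to\infty$, and a sequence of real numbers $\delta_n\in(-T_0,T_0)$ (not necessarily positive) with $\delta_n\to 0$, such that $(T_0-\delta_n)L_n$ is an integer for every $n$, and: (1) $p(t)>0$ for $t\in[0,T_0)$ and $p(t)=0$ for $t>T_0$; (2) $p$ is continuous on $[0,T_0]$; (3) $\lim_{n\to\infty}\sup_{0\le k\le (T_0-\delta_n)L_n}\big|\,|p_{k,n}|^{1/L_n}-p\big(\tfrac{k}{L_n}\wedge T_0\big)\big|=0$, where $p_{k,n}$ are deterministic complex coefficients. Consider the random polynomials $$F_n(z)=\sum_{k=0}^{(T_0-\delta_n)L_n}\xi_k\,p_{k,n}\,z^k .$$ Let $I(s)=\sup_{t\ge 0}\big(st+\log p(t)\big)$ (the Legendre–Fenchel transform of $-\log p$, with $\log 0=-\infty$). Then the random measure $\frac{1}{L_n}\mu_{F_n}$ converges in probability to the deterministic rotationally invariant measure $\mu$ on $\mathbb{C}$ determined by $$\mu(\mathbb{D}_r)=I'(\log r),\qquad r>0,$$ where $I'$ denotes the left derivative of $I$.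
   Context: For a polynomial $f$, $\mu_f=\sum_{z:\,f(z)=0}\delta_z$ is the counting measure of its zeros (with multiplicity). $\mathbb{D}_r$ is the open disk of radius $r$ centered at $0$. $a\wedge b=\min\{a,b\}$. A sequence of random measures $\nu_n$ converges in probability to a deterministic measure $\nu$ if $\int\phi\,d\nu_n\to\int\phi\,d\nu$ in probability for every smooth compactly supported test function $\phi$ on $\mathbb{C}$. *)

theory Defs
  imports "HOL-Probability.Probability" "HOL-Computational_Algebra.Polynomial"
begin

coinductive smooth_fun :: "('a::real_normed_vector \<Rightarrow> real) \<Rightarrow> bool" where
  "(\<And>x. (f has_derivative f' x) (at x)) \<Longrightarrow> (\<And>v. smooth_fun (\<lambda>x. f' x v))
     \<Longrightarrow> smooth_fun f"

definition test_fun :: "(complex \<Rightarrow> real) \<Rightarrow> bool" where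
  "test_fun \<phi> \<longleftrightarrow> smooth_fun \<phi> \<and> compact (closure {z. \<phi> z \<noteq> 0})"

text \<open>Integral of phi against the zero counting measure (with multiplicity) of q.
  For q = 0 the zero set is infinite and the sum is 0 by convention.\<close>
definition zero_measure_integral :: "complex poly \<Rightarrow> (complex \<Rightarrow> real) \<Rightarrow> real" where
  "zero_measure_integral q \<phi> = (\<Sum>z\<in>{z. poly q z = 0}. real (order z q) * \<phi> z)"

text \<open>I(s) = sup_{t \<ge> 0} (s t + log p t), with log 0 = -infinity (such t are dropped).\<close>
definition legendre_I :: "(real \<Rightarrow> real) \<Rightarrow> real \<Rightarrow> real" where
  "legendre_I p s = Sup {s * t + ln (p t) | t. 0 \<le> t \<and> p t > 0}"

end

theory Submission
  imports Defs "HOL-Complex_Analysis.Complex_Analysis" "HOL-Computational_Algebra.Fundamental_Theorem_Algebra"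
    "HOL-Real_Asymp.Real_Asymp"
begin

text \<open>
  Write A(s) for the mean of log |F| over the circle of radius exp s, that is, the logarithm of the modulus
  of the leading coefficient plus the sum of max(s, log |w|) over the zeros w. The key step is
  A(s) / L \<longrightarrow> I(s) in probability for every s.

  Upper bound: by the logarithmic moment no coefficient variable exceeds exp(e L), so |F| is at most
  exp(L (I(s) + e)) on the circle. Lower bound: A(s) is, up to degree * log 2 / N, at least the average of
  log |F| over N equally spaced points of the circle. To bound |F| from below at one point, pick a fixed
  number of well separated indices near the maximizer of s t + log p(t) and move s slightly so that the
  corresponding terms have very different sizes. Revealing the variables from the largest term down, each
  of them must hit a ball of probability at most q < 1, so F is exponentially small only with probability
  about q to the number of indices. Since A is Lipschitz in s with constant the degree, moving s is harmless.

  Second differences of A(s) in s determine the radial distribution of the zeros, and the limit is read off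
  from I. The gap between the maximum of log |F| on the circle and A(s) bounds all Fourier modes: for m > 0
  the sum over the zeros of min(|w|/r, r/|w|)^m exp(-i m arg w) is at most 2 m times that gap. Both families
  of functions together span a uniformly dense subset of the compactly supported continuous functions, and
  the total masses are bounded.
\<close>

subsection \<open>Zeros, means and maxima of a polynomial on a circle\<close>

text \<open>The variables are only nondegenerate and may be discrete, so one term keeps F away from
  0 merely with a probability bounded below. Making failure unlikely takes several terms, each
  outweighing the sum of all smaller chosen ones. Since s t + log p(t) may be flat near its maximum,
  nothing makes the terms there differ in size. The chosen indices are therefore spaced
  proportionally to L: a shift of s of order 1 / L already changes the ratio of two such terms by
  any prescribed factor, and it costs only O(1) in A, which is measured on the scale L. Replacing
  the circle by a fixed number of points, at a loss of order L / N, lets a union bound over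
  single-point estimates suffice, and the logarithmic singularities at the zeros are never
  integrated. The angular statement requires no further randomness. On a disk, log of the modulus of
  the zero-free reflected polynomial is a harmonic function below the maximum M of log |F|, with
  value A at the centre. A nonnegative harmonic function M - u has Fourier coefficients at most
  twice its value M - A at the centre, and M - A = o(L).\<close>

lemma prod_diff_roots_unity:
  fixes x y :: complex
  assumes "n > 0"
  shows "(\<Prod>k<n. x - cis (2 * pi * real k / real n) * y) = x ^ n - y ^ n"
proof (cases "y = 0")
  case True
  then show ?thesis using assms by simp
next
  case False
  define q :: "complex poly" where "q = monom 1 n - 1"
  have pq: "poly q z = z ^ n - 1" for z by (simp add: q_def poly_monom)
  have deg: "degree q = n"
    unfolding q_def diff_conv_add_uminus using assms
    by (subst degree_add_eq_left) (auto simp: degree_monom_eq)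
  have lead: "lead_coeff q = 1"
    using assms unfolding deg by (simp add: q_def)
  have "poly (pderiv q) z \<noteq> 0" if "poly q z = 0" for z
  proof -
    have "z ^ n = 1" using that pq by simp
    then have "z \<noteq> 0" using assms by (auto simp: zero_power)
    moreover have "pderiv q = monom (of_nat n) (n - 1)" by (simp add: q_def pderiv_diff pderiv_monom)
    ultimately show ?thesis using assms by (simp add: poly_monom)
  qed
  then have "rsquarefree q"
    by (auto simp: rsquarefree_roots)
  then have "(\<Prod>z | poly q z = 0. [:-z, 1:]) = q"
    using complex_poly_decompose_rsquarefree[of q] lead by simp
  from arg_cong[OF this[symmetric], of "\<lambda>q. poly q (x / y)"]
  have "poly q (x / y) = (\<Prod>z | z ^ n = 1. x / y - z)"
    by (simp add: poly_prod pq)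
  also have "\<dots> = (\<Prod>k<n. x / y - cis (2 * pi * real k / real n))"
    by (rule prod.reindex_bij_betw[OF Complex.bij_betw_roots_unity[OF assms], symmetric])
  finally have "y ^ n * poly q (x / y) = (\<Prod>k<n. y * (x / y - cis (2 * pi * real k / real n)))"
    by (simp add: prod.distrib)
  moreover have "y ^ n * poly q (x / y) = x ^ n - y ^ n"
    using False by (simp add: pq field_simps)
  moreover have "y * (x / y - u) = x - u * y" for u
    using False by (simp add: right_diff_distrib mult.commute)
  ultimately show ?thesis by simp
qed

section \<open>Sums over zeros and the logarithmic Mahler measure of a circle\<close>

lemma zero_measure_integral_bound:
  assumes "\<And>z. \<bar>\<phi> z\<bar> \<le> B"
  shows "\<bar>zero_measure_integral q \<phi>\<bar> \<le> real (degree q) * B"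
proof (cases "q = 0")
  case True
  \<comment> \<open>Every point is a zero of the zero polynomial, and a sum over an infinite set is
    0.\<close>
  have "infinite (UNIV :: complex set)" by (rule infinite_UNIV_char_0)
  with True show ?thesis by (simp add: zero_measure_integral_def)
next
  case False
  have B: "0 \<le> B" using assms[of 0] by linarith
  have "\<bar>zero_measure_integral q \<phi>\<bar> \<le> (\<Sum>z | poly q z = 0. real (order z q) * B)"
    unfolding zero_measure_integral_def
    by (rule order_trans[OF sum_abs], intro sum_mono) (simp add: abs_mult assms mult_left_mono)
  also have "\<dots> = real (\<Sum>z | poly q z = 0. order z q) * B" by (simp add: sum_distrib_right)
  also have "\<dots> \<le> real (degree q) * B"
    using sum_order_le_degree[OF False] B by (intro mult_right_mono of_nat_mono)
  finally show ?thesis .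
qed

lemma zero_measure_integral_add:
  "zero_measure_integral q (\<lambda>z. f z + g z) = zero_measure_integral q f + zero_measure_integral q g"
  by (simp add: zero_measure_integral_def ring_distribs sum.distrib)

lemma zero_measure_integral_cmult:
  "zero_measure_integral q (\<lambda>z. c * f z) = c * zero_measure_integral q f"
  by (simp add: zero_measure_integral_def sum_distrib_left mult_ac)

lemma zero_measure_integral_diff:
  "zero_measure_integral q (\<lambda>z. f z - g z) = zero_measure_integral q f - zero_measure_integral q g"
  by (simp add: zero_measure_integral_def ring_distribs sum_subtractf)

lemma zero_measure_integral_mono:
  assumes "\<And>z. poly q z = 0 \<Longrightarrow> f z \<le> g z"
  shows "zero_measure_integral q f \<le> zero_measure_integral q g"
  unfolding zero_measure_integral_def by (intro sum_mono mult_left_mono) (use assms in auto)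

lemma poly_eq_prod_roots:
  fixes q :: "complex poly"
  shows "poly q z = lead_coeff q * (\<Prod>w | poly q w = 0. (z - w) ^ order w q)"
  by (subst (1) complex_poly_decompose[symmetric]) (simp add: poly_prod)

text \<open>The right-hand side of Jensen's formula, taken as the definition: A(s) of the overview
  is the value at \<open>r = exp s\<close>, and every estimate becomes one about a finite sum over
  zeros.\<close>

definition log_mahler :: "complex poly \<Rightarrow> real \<Rightarrow> real" where
  "log_mahler q r = ln (cmod (lead_coeff q)) + zero_measure_integral q (\<lambda>w. ln (max r (cmod w)))"

text \<open>Replacing the factors (z - w) of a polynomial by multiples of (1 - z * reflect r w) keeps its modulus on
  the circle of radius r and leaves no zeros inside, so the logarithm of the result is holomorphic there.
  Its value at 0 has real part log_mahler and its higher Taylor coefficients are the power sums of the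
  reflected zeros; all of them are controlled by the maximum modulus through the Schwarz lemma.\<close>

definition reflect :: "real \<Rightarrow> complex \<Rightarrow> complex" where
  "reflect r w = (if cmod w \<le> r then cnj w / of_real (r\<^sup>2) else 1 / w)"

lemma cmod_reflect_le: "r > 0 \<Longrightarrow> cmod (reflect r w) \<le> 1 / r"
  by (cases "w = 0") (auto simp: reflect_def norm_divide divide_simps power2_eq_square norm_mult)

text \<open>For w in the disk this is the Blaschke reflection: \<open>z * cnj z\<close> is r^2 on
  the circle, so the factor is the conjugate of (z - w) / z. For w outside it is (w - z) /
  w.\<close>

lemma cmod_reflect_factor:
  assumes "r > 0" "cmod z = r"
  shows "max r (cmod w) * cmod (1 - z * reflect r w) = cmod (z - w)"
proof (cases "cmod w \<le> r")
  case True
  have r2: "of_real (r\<^sup>2) = z * cnj z"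
    using assms(2) complex_norm_square[of z] by simp
  have z0: "z \<noteq> 0" using assms by auto
  have "1 - z * reflect r w = cnj (z - w) / cnj z"
    using True z0 unfolding reflect_def r2 by (simp add: field_simps)
  then have "cmod (1 - z * reflect r w) = cmod (z - w) / r"
    using assms by (simp only: norm_divide complex_mod_cnj)
  then show ?thesis using True assms by (simp add: max_def)
next
  case False
  have w0: "w \<noteq> 0" using False assms by auto
  then have "1 - z * reflect r w = (w - z) / w"
    using False by (simp add: reflect_def field_simps)
  then have "cmod (1 - z * reflect r w) = cmod (z - w) / cmod w"
    by (simp only: norm_divide norm_minus_commute)
  then show ?thesis using False w0 by (simp add: max_def)
qed

lemma log_mahler_reflect_le:
  assumes q: "q \<noteq> 0" and r: "r > 0" and B: "\<And>z. cmod z = r \<Longrightarrow> cmod (poly q z) \<le> B" and z: "cmod z < r"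
  shows "log_mahler q r + zero_measure_integral q (\<lambda>w. ln (cmod (1 - z * reflect r w))) \<le> ln B"
proof -
  define G where "G z = lead_coeff q * (\<Prod>w | poly q w = 0.
      (of_real (max r (cmod w)) * (1 - z * reflect r w)) ^ order w q)" for z
  have fin: "finite {w. poly q w = 0}" using q poly_roots_finite by blast
  have norm_G: "cmod (G z) = cmod (lead_coeff q) * (\<Prod>w | poly q w = 0.
      (max r (cmod w) * cmod (1 - z * reflect r w)) ^ order w q)" for z
    using r by (simp add: G_def norm_mult prod_norm[symmetric] norm_power abs_of_pos max_def)
  have bdry: "cmod (G z) = cmod (poly q z)" if "cmod z = r" for z
    unfolding norm_G poly_eq_prod_roots[of q z] norm_mult prod_norm[symmetric] norm_power
    using cmod_reflect_factor[OF r that] by simp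
  have hol: "G holomorphic_on A" for A
    unfolding G_def by (intro holomorphic_intros)
  have "cmod (G z) \<le> B"
  proof (rule maximum_modulus_frontier[of G "cball 0 r"])
    show "continuous_on (closure (cball 0 r)) G"
      using hol holomorphic_on_imp_continuous_on by blast
  qed (use hol z B bdry r in \<open>auto simp: frontier_cball sphere_def\<close>)
  have pos: "cmod (1 - z * reflect r w) > 0" for w
  proof -
    have "cmod (z * reflect r w) \<le> cmod z * (1 / r)"
      unfolding norm_mult by (intro mult_left_mono cmod_reflect_le r) auto
    also have "\<dots> < 1" using z r by simp
    finally show ?thesis by (metis less_irrefl norm_one zero_less_norm_iff right_minus_eq)
  qed
  have mpos: "max r (cmod w) > 0" for w using r by (rule less_le_trans) simp
  have lpos: "cmod (lead_coeff q) > 0" using q by simp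
  have "ln (cmod (G z)) = ln (cmod (lead_coeff q)) +
      (\<Sum>w | poly q w = 0. ln ((max r (cmod w) * cmod (1 - z * reflect r w)) ^ order w q))"
    unfolding norm_G using lpos fin pos mpos
    by (subst ln_mult_pos) (auto intro!: prod_pos ln_prod simp: less_imp_neq[OF mpos, symmetric])
  also have "\<dots> = log_mahler q r + zero_measure_integral q (\<lambda>w. ln (cmod (1 - z * reflect r w)))"
    unfolding log_mahler_def zero_measure_integral_def add.assoc sum.distrib[symmetric]
    using pos mpos by (simp add: ln_realpow ln_mult_pos ring_distribs)
  moreover have "cmod (G z) > 0"
    unfolding norm_G using lpos pos mpos by (intro mult_pos_pos prod_pos zero_less_power) auto
  ultimately show ?thesis
    using \<open>cmod (G z) \<le> B\<close> ln_mono by metis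
qed

text \<open>The centre z = 0 of the reflection bound, where all factors are 1.\<close>

lemma log_mahler_le:
  assumes "q \<noteq> 0" "r > 0" "\<And>z. cmod z = r \<Longrightarrow> cmod (poly q z) \<le> B"
  shows "log_mahler q r \<le> ln B"
  using log_mahler_reflect_le[OF assms, of 0] assms(2) by (simp add: zero_measure_integral_def)

text \<open>As a function of ln r, each zero contributes slope 0 or 1.\<close>

lemma log_mahler_lipschitz:
  assumes "0 < r" "0 < r'"
  shows "\<bar>log_mahler q r - log_mahler q r'\<bar> \<le> real (degree q) * \<bar>ln r - ln r'\<bar>"
proof -
  have "\<bar>ln (max r (cmod w)) - ln (max r' (cmod w))\<bar> \<le> \<bar>ln r - ln r'\<bar>" for w
    using assms by (auto simp: max_def abs_le_iff)
       (smt (verit) ln_le_cancel_iff ln_mono)+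
  from zero_measure_integral_bound[OF this, of q]
  show ?thesis by (simp add: log_mahler_def zero_measure_integral_diff)
qed

text \<open>Over the n grid points the distances to a zero w multiply to |w^n - r^n|, at most 2
  max(r, |w|)^n. Each zero thus exceeds its share of \<open>log_mahler\<close> by at most ln 2 /
  n.\<close>

lemma log_mahler_ge_average:
  assumes q: "q \<noteq> 0" and r: "r > 0" and n: "n > 0"
    and nz: "\<And>k. k < n \<Longrightarrow> poly q (of_real r * cis (2 * pi * real k / real n)) \<noteq> 0"
  shows "(\<Sum>k<n. ln (cmod (poly q (of_real r * cis (2 * pi * real k / real n))))) / real n
           - real (degree q) * ln 2 / real n \<le> log_mahler q r"
proof -
  define z where "z k = of_real r * cis (2 * pi * real k / real n)" for k
  have fin: "finite {w. poly q w = 0}" using q poly_roots_finite by blast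
  have ln_poly: "ln (cmod (poly q (z k))) = ln (cmod (lead_coeff q)) +
      zero_measure_integral q (\<lambda>w. ln (cmod (z k - w)))" if "k < n" for k
  proof -
    have pos: "cmod (z k - w) > 0" if "poly q w = 0" for w
      using nz[OF \<open>k < n\<close>] that by (auto simp: z_def)
    have "cmod (poly q (z k)) = cmod (lead_coeff q) * (\<Prod>w | poly q w = 0. cmod (z k - w) ^ order w q)"
      by (subst poly_eq_prod_roots) (simp add: norm_mult prod_norm[symmetric] norm_power)
    then have "ln (cmod (poly q (z k))) = ln (cmod (lead_coeff q)) +
        ln (\<Prod>w | poly q w = 0. cmod (z k - w) ^ order w q)"
      using q pos by (subst ln_mult_pos[symmetric]) (auto intro!: prod_pos)
    also have "ln (\<Prod>w | poly q w = 0. cmod (z k - w) ^ order w q) =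
        (\<Sum>w | poly q w = 0. ln (cmod (z k - w) ^ order w q))"
      using pos fin by (intro ln_prod) auto
    finally show ?thesis
      unfolding zero_measure_integral_def using pos by (simp add: ln_realpow)
  qed
  have upper: "(\<Sum>k<n. ln (cmod (z k - w))) \<le> real n * ln (max r (cmod w)) + ln 2"
    if w: "poly q w = 0" for w
  proof -
    have m: "max r (cmod w) > 0" using r by (rule less_le_trans) simp
    have nzw: "cmod (z k - w) > 0" if "k < n" for k
      using nz[OF that] w by (auto simp: z_def)
    have "(\<Sum>k<n. ln (cmod (z k - w))) = ln (\<Prod>k<n. cmod (z k - w))"
      using nzw by (intro ln_prod[symmetric]) auto
    also have "(\<Prod>k<n. cmod (z k - w)) = cmod (\<Prod>k<n. w - cis (2 * pi * real k / real n) * of_real r)"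
      by (simp add: prod_norm z_def norm_minus_commute mult.commute)
    also have "\<dots> = cmod (w ^ n - of_real r ^ n)"
      by (subst prod_diff_roots_unity[OF n]) simp
    also have "ln \<dots> \<le> ln (2 * max r (cmod w) ^ n)"
    proof (rule ln_mono)
      show "0 < cmod (w ^ n - of_real r ^ n)"
        unfolding prod_diff_roots_unity[OF n, symmetric] prod_norm[symmetric]
        using nzw by (intro prod_pos) (auto simp: z_def mult.commute)
      have "cmod (w ^ n - of_real r ^ n) \<le> cmod w ^ n + r ^ n"
        using norm_triangle_ineq4[of "w ^ n" "of_real r ^ n"] r by (simp add: norm_power)
      also have "\<dots> \<le> max r (cmod w) ^ n + max r (cmod w) ^ n"
        using r by (intro add_mono power_mono) auto
      finally show "cmod (w ^ n - of_real r ^ n) \<le> 2 * max r (cmod w) ^ n" by simp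
    qed
    also have "\<dots> = real n * ln (max r (cmod w)) + ln 2"
      using m by (simp add: ln_mult_pos ln_realpow)
    finally show ?thesis .
  qed
  have "(\<Sum>k<n. ln (cmod (poly q (z k)))) =
      real n * ln (cmod (lead_coeff q)) + (\<Sum>k<n. zero_measure_integral q (\<lambda>w. ln (cmod (z k - w))))"
    by (simp add: ln_poly sum.distrib)
  also have "(\<Sum>k<n. zero_measure_integral q (\<lambda>w. ln (cmod (z k - w)))) =
      zero_measure_integral q (\<lambda>w. \<Sum>k<n. ln (cmod (z k - w)))"
    unfolding zero_measure_integral_def by (subst sum.swap) (simp add: sum_distrib_left)
  also have "\<dots> \<le> zero_measure_integral q (\<lambda>w. real n * ln (max r (cmod w)) + ln 2)"
    by (rule zero_measure_integral_mono) (rule upper)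
  also have "\<dots> = real n * zero_measure_integral q (\<lambda>w. ln (max r (cmod w))) +
      zero_measure_integral q (\<lambda>w. ln 2)"
    by (simp add: zero_measure_integral_add zero_measure_integral_cmult)
  also have "zero_measure_integral q (\<lambda>w. ln 2) \<le> real (degree q) * ln 2"
    using zero_measure_integral_bound[of "\<lambda>_. ln 2" "ln 2" q] by simp
  finally have "(\<Sum>k<n. ln (cmod (poly q (z k)))) \<le> real n * log_mahler q r + real (degree q) * ln 2"
    by (simp add: log_mahler_def ring_distribs)
  then show ?thesis using n by (simp add: z_def field_simps)
qed

text \<open>A Borel-Caratheodory estimate: u / (2 T - u) maps the half-plane Re u < T into the unit
  disk and fixes 0, so the Schwarz lemma bounds the derivative of the composition.\<close>

lemma half_plane_schwarz:
  assumes hol: "h holomorphic_on ball 0 \<rho>" and h0: "h 0 = 0" and \<rho>: "\<rho> > 0"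
    and Re: "\<And>z. cmod z < \<rho> \<Longrightarrow> Re (h z) < T"
  shows "cmod (deriv h 0) * \<rho> \<le> 2 * T"
proof -
  have T: "T > 0" using Re[of 0] h0 \<rho> by simp
  define f where "f z = h (of_real \<rho> * z) / (of_real (2 * T) - h (of_real \<rho> * z))" for z
  have in_ball: "cmod (of_real \<rho> * z) < \<rho>" if "cmod z < 1" for z
    using that \<rho> by (simp add: norm_mult)
  have den: "of_real (2 * T) - h (of_real \<rho> * z) \<noteq> 0" if "cmod z < 1" for z
    using Re[OF in_ball[OF that]] T by (auto simp: complex_eq_iff)
  have hol': "(\<lambda>z. h (of_real \<rho> * z)) holomorphic_on ball 0 1"
    using holomorphic_on_compose_gen[of "\<lambda>z. of_real \<rho> * z" "ball 0 1" h "ball 0 \<rho>"] hol in_ball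
    by (auto simp: o_def image_subset_iff intro!: holomorphic_intros)
  have holf: "f holomorphic_on ball 0 1"
    unfolding f_def using den by (intro holomorphic_intros hol') auto
  have lt: "cmod (f z) < 1" if "cmod z < 1" for z
  proof -
    define u where "u = h (of_real \<rho> * z)"
    have "(2 * T) * Re u < (2 * T) * T"
      using Re[OF in_ball[OF that]] T unfolding u_def[symmetric] by simp
    then have "(cmod u)\<^sup>2 < (cmod (of_real (2 * T) - u))\<^sup>2"
      unfolding cmod_power2 by (simp add: power2_eq_square algebra_simps)
    then have "cmod u < cmod (of_real (2 * T) - u)" using power2_less_imp_less norm_ge_zero by blast
    then show ?thesis using den[OF that] by (simp add: f_def u_def norm_divide)
  qed
  have "cmod (deriv f 0) \<le> 1"
    by (rule Schwarz_Lemma(2)[OF holf _ lt, of 0]) (auto simp: f_def h0)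
  moreover have "(f has_field_derivative deriv h 0 * of_real \<rho> / of_real (2 * T)) (at 0)"
  proof -
    have "(h has_field_derivative deriv h 0) (at (of_real \<rho> * 0))"
      using hol \<rho> holomorphic_derivI[OF hol] by simp
    from DERIV_chain2[where g = "\<lambda>z. of_real \<rho> * z" and Db = "of_real \<rho>" and s = UNIV and x = 0, OF this]
    have "((\<lambda>z. h (of_real \<rho> * z)) has_field_derivative deriv h 0 * of_real \<rho>) (at 0)"
      by (auto intro!: derivative_eq_intros)
    from DERIV_divide[OF this DERIV_diff[OF DERIV_const[of "of_real (2 * T)"] this]]
    show ?thesis using T unfolding f_def by (simp add: h0 field_simps)
  qed
  ultimately have "cmod (deriv h 0 * of_real \<rho> / of_real (2 * T)) \<le> 1"
    by (simp add: DERIV_imp_deriv)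
  then show ?thesis using T \<rho> by (simp add: norm_mult norm_divide)
qed

text \<open>Write z = u^m. Over the m rotations of u the factors 1 - u b, with b a reflected zero,
  multiply to 1 - z b^m. Adding the m reflection bounds gives Re h at most m times the gap D, and
  the power sum of order m is minus the derivative of h at 0.\<close>

lemma reflect_moment_bound:
  assumes q: "q \<noteq> 0" and r: "r > 0" and m: "m > 0"
    and B: "\<And>z. cmod z = r \<Longrightarrow> cmod (poly q z) \<le> B"
  shows "\<bar>zero_measure_integral q (\<lambda>w. Re (c * (of_real r * reflect r w) ^ m))\<bar>
           \<le> cmod c * (2 * real m * (ln B - log_mahler q r))"
proof -
  define b where "b = reflect r"
  define D where "D = ln B - log_mahler q r"
  define h where "h z = (\<Sum>w | poly q w = 0. of_nat (order w q) * Ln (1 - z * b w ^ m))" for z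
  have ble: "cmod (b w ^ m) \<le> 1 / r ^ m" for w
    using power_mono[OF cmod_reflect_le[OF r, of w], of m] by (simp add: b_def norm_power power_divide)
  have lt1: "cmod (z * b w ^ m) < 1" if "cmod z < r ^ m" for z w
  proof -
    have "cmod (z * b w ^ m) \<le> cmod z * (1 / r ^ m)"
      unfolding norm_mult by (intro mult_left_mono ble) auto
    also have "\<dots> < 1" using that r by simp
    finally show ?thesis .
  qed
  have Repos: "Re (1 - z * b w ^ m) > 0" if "cmod z < r ^ m" for z w
    using lt1[OF that, of w] complex_Re_le_cmod[of "z * b w ^ m"]
    unfolding minus_complex.sel one_complex.sel by linarith
  have nonpos: "1 - z * b w ^ m \<notin> \<real>\<^sub>\<le>\<^sub>0" if "cmod z < r ^ m" for z w
    using Repos[OF that, of w] unfolding complex_nonpos_Reals_iff by linarith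
  have hol: "h holomorphic_on ball 0 (r ^ m)"
    unfolding h_def by (intro holomorphic_intros nonpos) simp
  have Re_h: "Re (h z) \<le> real m * D" if z: "cmod z < r ^ m" for z
  proof -
    obtain u where u: "z = u ^ m"
      using m by (auto intro: exists_complex_root[of m z])
    have ur: "cmod u < r"
    proof (rule ccontr)
      assume "\<not> cmod u < r"
      then have "r ^ m \<le> cmod u ^ m" using r by (intro power_mono) auto
      then show False using z u by (simp add: norm_power[symmetric])
    qed
    define \<zeta> where "\<zeta> k = cis (2 * pi * real k / real m)" for k
    have split: "ln (cmod (1 - z * b w ^ m)) = (\<Sum>k<m. ln (cmod (1 - \<zeta> k * u * b w)))" for w
    proof -
      have pos: "0 < cmod (1 - \<zeta> k * u * b w)" for k
      proof -
        have "cmod (\<zeta> k * u * b w) \<le> cmod u * (1 / r)"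
          unfolding norm_mult \<zeta>_def b_def using cmod_reflect_le[OF r, of w]
          mult_left_mono[of "cmod (reflect r w)" "1 / r" "cmod u"] by simp
        also have "\<dots> < 1" using ur r by simp
        finally show ?thesis by (metis less_irrefl norm_one zero_less_norm_iff right_minus_eq)
      qed
      have "1 - z * b w ^ m = (\<Prod>k<m. 1 - \<zeta> k * (u * b w))"
        unfolding \<zeta>_def using prod_diff_roots_unity[OF m, of 1 "u * b w"] u
        by (simp add: power_mult_distrib)
      then have "cmod (1 - z * b w ^ m) = (\<Prod>k<m. cmod (1 - \<zeta> k * u * b w))"
        by (simp add: prod_norm mult.assoc)
      then show ?thesis using pos by (simp add: ln_prod)
    qed
    have "Re (h z) = (\<Sum>w | poly q w = 0. real (order w q) * ln (cmod (1 - z * b w ^ m)))"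
    proof -
      have "Re (Ln (1 - z * b w ^ m)) = ln (cmod (1 - z * b w ^ m))" for w
      proof (rule Re_Ln)
        show "1 - z * b w ^ m \<noteq> 0" using Repos[OF z, of w] by (metis less_irrefl zero_complex.sel(1))
      qed
      then show ?thesis unfolding h_def Re_sum by simp
    qed
    also have "\<dots> = (\<Sum>k<m. zero_measure_integral q (\<lambda>w. ln (cmod (1 - \<zeta> k * u * b w))))"
      unfolding split zero_measure_integral_def by (subst sum.swap) (simp add: sum_distrib_left)
    also have "\<dots> \<le> (\<Sum>k<m. D)"
    proof (rule sum_mono)
      fix k
      have "cmod (\<zeta> k * u) < r" using ur by (simp add: \<zeta>_def norm_mult)
      from log_mahler_reflect_le[OF q r B this]
      show "zero_measure_integral q (\<lambda>w. ln (cmod (1 - \<zeta> k * u * b w))) \<le> D"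
        by (simp add: D_def b_def)
    qed
    finally show ?thesis by simp
  qed
  have "(h has_field_derivative (\<Sum>w | poly q w = 0. of_nat (order w q) * (- (b w ^ m)))) (at 0)"
    unfolding h_def by (auto intro!: derivative_eq_intros sum.cong)
  then have dh: "deriv h 0 = - (\<Sum>w | poly q w = 0. of_nat (order w q) * b w ^ m)"
    by (simp add: DERIV_imp_deriv sum_negf)
  \<comment> \<open>The Schwarz estimate asks for a strict bound, while \<open>Re_h\<close> is not
    strict and D may be 0; hence the slack e / 2.\<close>
  have main: "cmod (deriv h 0) * r ^ m \<le> 2 * (real m * D)"
  proof (rule field_le_epsilon)
    fix e :: real assume "e > 0"
    then have "Re (h z) < real m * D + e / 2" if "cmod z < r ^ m" for z
      using Re_h[OF that] by linarith
    moreover have "h 0 = 0" by (simp add: h_def)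
    ultimately show "cmod (deriv h 0) * r ^ m \<le> 2 * (real m * D) + e"
      using half_plane_schwarz[OF hol, of "real m * D + e / 2"] r by simp
  qed
  have "zero_measure_integral q (\<lambda>w. Re (c * (of_real r * b w) ^ m)) =
      Re (c * (of_real r ^ m * (\<Sum>w | poly q w = 0. of_nat (order w q) * b w ^ m)))"
    unfolding zero_measure_integral_def sum_distrib_left Re_sum
  proof (intro sum.cong refl)
    fix w
    have "c * (of_real r ^ m * (of_nat (order w q) * b w ^ m)) =
        of_nat (order w q) * (c * (of_real r * b w) ^ m)"
      by (simp add: power_mult_distrib ac_simps)
    then show "real (order w q) * Re (c * (of_real r * b w) ^ m) =
        Re (c * (of_real r ^ m * (of_nat (order w q) * b w ^ m)))"
      by (simp only: times_complex.sel complex_Re_of_nat complex_Im_of_nat mult_zero_left diff_zero)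
  qed
  also have "\<bar>\<dots>\<bar> \<le> cmod (c * (of_real r ^ m * (\<Sum>w | poly q w = 0. of_nat (order w q) * b w ^ m)))"
    by (rule abs_Re_le_cmod)
  also have "\<dots> = cmod c * (cmod (deriv h 0) * r ^ m)"
    unfolding dh using r by (simp add: norm_mult norm_power)
  also have "\<dots> \<le> cmod c * (2 * real m * D)"
    using main by (intro mult_left_mono) auto
  finally show ?thesis by (simp add: b_def D_def)
qed

subsection \<open>Small ball probabilities\<close>

text \<open>Convergence in probability is convergence along this filter. The exceptional events only have to cover
  the bad set, whose own measurability is never needed.\<close>

definition whp :: "'a measure \<Rightarrow> (nat \<times> 'a) filter" where
  "whp M = Abs_filter (\<lambda>P. \<forall>e>0. \<forall>\<^sub>F n in sequentially.
     \<exists>B\<in>sets M. measure M B \<le> e \<and> (\<forall>\<omega>\<in>space M - B. P (n, \<omega>)))"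

context prob_space
begin

lemma eventually_whp:
  "eventually P (whp M) \<longleftrightarrow> (\<forall>e>0. \<forall>\<^sub>F n in sequentially.
     \<exists>B\<in>sets M. prob B \<le> e \<and> (\<forall>\<omega>\<in>space M - B. P (n, \<omega>)))"
  unfolding whp_def
proof (subst eventually_Abs_filter, unfold_locales)
  fix P Q
  assume P: "\<forall>e>0. \<forall>\<^sub>F n in sequentially. \<exists>B\<in>events. prob B \<le> e \<and> (\<forall>\<omega>\<in>space M - B. P (n, \<omega>))"
    and Q: "\<forall>e>0. \<forall>\<^sub>F n in sequentially. \<exists>B\<in>events. prob B \<le> e \<and> (\<forall>\<omega>\<in>space M - B. Q (n, \<omega>))"
  show "\<forall>e>0. \<forall>\<^sub>F n in sequentially. \<exists>B\<in>events. prob B \<le> e \<and> (\<forall>\<omega>\<in>space M - B. P (n, \<omega>) \<and> Q (n, \<omega>))"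
  proof (intro allI impI)
    fix e :: real assume "e > 0"
    then have "e / 2 > 0" by simp
    show "\<forall>\<^sub>F n in sequentially. \<exists>B\<in>events. prob B \<le> e \<and> (\<forall>\<omega>\<in>space M - B. P (n, \<omega>) \<and> Q (n, \<omega>))"
      using P[rule_format, OF \<open>e / 2 > 0\<close>] Q[rule_format, OF \<open>e / 2 > 0\<close>]
    proof eventually_elim
      case (elim n)
      then obtain B C where B: "B \<in> events" "prob B \<le> e / 2" "\<forall>\<omega>\<in>space M - B. P (n, \<omega>)"
        and C: "C \<in> events" "prob C \<le> e / 2" "\<forall>\<omega>\<in>space M - C. Q (n, \<omega>)" by blast
      have "prob (B \<union> C) \<le> e"
        using measure_Un_le[OF B(1) C(1)] B(2) C(2) by linarith
      then show ?case using B C by (intro bexI[of _ "B \<union> C"]) auto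
    qed
  qed
next
  fix P Q :: "nat \<times> 'a \<Rightarrow> bool"
  assume PQ: "\<forall>x. P x \<longrightarrow> Q x"
    and P: "\<forall>e>0. \<forall>\<^sub>F n in sequentially. \<exists>B\<in>events. prob B \<le> e \<and> (\<forall>\<omega>\<in>space M - B. P (n, \<omega>))"
  show "\<forall>e>0. \<forall>\<^sub>F n in sequentially. \<exists>B\<in>events. prob B \<le> e \<and> (\<forall>\<omega>\<in>space M - B. Q (n, \<omega>))"
  proof (intro allI impI)
    fix e :: real assume "e > 0"
    from P[rule_format, OF this]
    show "\<forall>\<^sub>F n in sequentially. \<exists>B\<in>events. prob B \<le> e \<and> (\<forall>\<omega>\<in>space M - B. Q (n, \<omega>))"
      by eventually_elim (use PQ in blast)
  qed
qed (auto intro!: bexI[of _ "{}"])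

lemma eventually_whp_sequentially:
  assumes "eventually Q sequentially"
  shows "eventually (\<lambda>x. Q (fst x)) (whp M)"
  unfolding eventually_whp
proof (intro allI impI)
  fix e :: real assume "e > 0"
  from assms show "\<forall>\<^sub>F n in sequentially. \<exists>B\<in>events. prob B \<le> e \<and> (\<forall>\<omega>\<in>space M - B. Q (fst (n, \<omega>)))"
    by eventually_elim (use \<open>e > 0\<close> in \<open>auto intro!: bexI[of _ "{}"]\<close>)
qed

lemma eventually_whp_tendsto_prob:
  assumes "eventually P (whp M)"
  shows "(\<lambda>n. prob {\<omega>\<in>space M. \<not> P (n, \<omega>)}) \<longlonglongrightarrow> 0"
proof (rule tendstoI)
  fix e :: real assume "e > 0"
  then have "e / 2 > 0" by simp
  from assms[unfolded eventually_whp, rule_format, OF this]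
  show "\<forall>\<^sub>F n in sequentially. dist (prob {\<omega>\<in>space M. \<not> P (n, \<omega>)}) 0 < e"
  proof eventually_elim
    case (elim n)
    then obtain B where B: "B \<in> events" "prob B \<le> e / 2" "\<forall>\<omega>\<in>space M - B. P (n, \<omega>)" by blast
    \<comment> \<open>A set that is not an event has \<open>measure\<close> 0, so no measurability
      of P is required.\<close>
    have "prob {\<omega>\<in>space M. \<not> P (n, \<omega>)} \<le> prob B"
      using B by (cases "{\<omega>\<in>space M. \<not> P (n, \<omega>)} \<in> events")
        (auto intro!: finite_measure_mono simp: measure_notin_sets)
    then show ?case using B \<open>e > 0\<close> by simp
  qed
qed

text \<open>Condition on X: for a value x in A the event puts Y into the ball of radius \<eta>
  around - g x. Fubini integrates the bound Q, uniform in the centre, over A.\<close>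

lemma conc_indep:
  fixes X Y :: "'a \<Rightarrow> complex"
  assumes ind: "indep_var borel X borel Y"
    and Y: "\<And>b. prob {\<omega>\<in>space M. cmod (Y \<omega> - b) \<le> \<eta>} \<le> Q"
    and A: "A \<in> sets borel" and g[measurable]: "g \<in> borel_measurable borel"
  shows "prob {\<omega>\<in>space M. X \<omega> \<in> A \<and> cmod (g (X \<omega>) + Y \<omega>) \<le> \<eta>} \<le> prob {\<omega>\<in>space M. X \<omega> \<in> A} * Q"
proof -
  note [measurable] = A
  have rv[measurable]: "random_variable borel X" "random_variable borel Y"
    and eq: "distr M borel X \<Otimes>\<^sub>M distr M borel Y = distr M (borel \<Otimes>\<^sub>M borel) (\<lambda>\<omega>. (X \<omega>, Y \<omega>))"
    using ind unfolding indep_var_distribution_eq by auto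
  have Q: "0 \<le> Q" using Y[of 0] measure_nonneg order_trans by blast
  define S where "S = {z \<in> space (borel \<Otimes>\<^sub>M borel :: (complex \<times> complex) measure).
      fst z \<in> A \<and> cmod (g (fst z) + snd z) \<le> \<eta>}"
  have S[measurable]: "S \<in> sets (borel \<Otimes>\<^sub>M borel)" unfolding S_def by measurable
  interpret Y: prob_space "distr M borel Y" by (rule prob_space_distr) simp
  have "(\<lambda>\<omega>. (X \<omega>, Y \<omega>)) -` S \<inter> space M =
      {\<omega>\<in>space M. X \<omega> \<in> A \<and> cmod (g (X \<omega>) + Y \<omega>) \<le> \<eta>}"
    by (auto simp: S_def space_pair_measure)
  then have "emeasure M {\<omega>\<in>space M. X \<omega> \<in> A \<and> cmod (g (X \<omega>) + Y \<omega>) \<le> \<eta>} =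
      emeasure (distr M (borel \<Otimes>\<^sub>M borel) (\<lambda>\<omega>. (X \<omega>, Y \<omega>))) S"
    by (subst emeasure_distr[OF _ S]) simp_all
  also have "\<dots> = (\<integral>\<^sup>+x. emeasure (distr M borel Y) (Pair x -` S) \<partial>distr M borel X)"
    unfolding eq[symmetric] by (rule Y.emeasure_pair_measure_alt) (use S in \<open>simp cong: sets_pair_measure_cong\<close>)
  also have "\<dots> \<le> (\<integral>\<^sup>+x. ennreal Q * indicator A x \<partial>distr M borel X)"
  proof (rule nn_integral_mono)
    fix x
    have "emeasure (distr M borel Y) (Pair x -` S) = emeasure M {\<omega>\<in>space M. (x, Y \<omega>) \<in> S}"
      by (subst emeasure_distr) (auto intro!: arg_cong[where f = "emeasure M"])
    also have "\<dots> \<le> ennreal Q * indicator A x"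
    proof (cases "x \<in> A")
      case True
      then have "{\<omega>\<in>space M. (x, Y \<omega>) \<in> S} = {\<omega>\<in>space M. cmod (Y \<omega> - (- g x)) \<le> \<eta>}"
        by (auto simp: S_def space_pair_measure add.commute)
      then show ?thesis using Y[of "- g x"] True Q by (simp add: emeasure_eq_measure ennreal_leI)
    next
      case False
      then have "{\<omega>\<in>space M. (x, Y \<omega>) \<in> S} = {}" by (auto simp: S_def)
      then show ?thesis by (simp only: emeasure_empty zero_le)
    qed
    finally show "emeasure (distr M borel Y) (Pair x -` S) \<le> ennreal Q * indicator A x" .
  qed
  also have "\<dots> = ennreal Q * emeasure (distr M borel X) A"
    by (rule nn_integral_cmult_indicator) simp
  also have "emeasure (distr M borel X) A = emeasure M {\<omega>\<in>space M. X \<omega> \<in> A}"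
    by (subst emeasure_distr) (auto intro!: arg_cong[where f = "emeasure M"])
  finally show ?thesis
    using Q by (simp add: emeasure_eq_measure ennreal_mult[symmetric] mult.commute)
qed

lemma indep_vars_sum_complex:
  fixes X :: "'i \<Rightarrow> 'a \<Rightarrow> complex"
  assumes I: "finite I" "i \<notin> I" and indep: "indep_vars (\<lambda>_. borel) X (insert i I)"
  shows "indep_var borel (X i) borel (\<lambda>\<omega>. \<Sum>j\<in>I. a j * X j \<omega>)"
proof -
  have "indep_var
    borel ((\<lambda>f. f i) \<circ> (\<lambda>\<omega>. restrict (\<lambda>i. X i \<omega>) {i}))
    borel ((\<lambda>f. \<Sum>j\<in>I. a j * f j) \<circ> (\<lambda>\<omega>. restrict (\<lambda>i. X i \<omega>) I))"
    using I by (intro indep_var_compose[OF indep_var_restrict[OF indep]]) auto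
  also have "((\<lambda>f. f i) \<circ> (\<lambda>\<omega>. restrict (\<lambda>i. X i \<omega>) {i})) = X i"
    by auto
  also have "((\<lambda>f. \<Sum>j\<in>I. a j * f j) \<circ> (\<lambda>\<omega>. restrict (\<lambda>i. X i \<omega>) I)) = (\<lambda>\<omega>. \<Sum>j\<in>I. a j * X j \<omega>)"
    by (auto cong: rev_conj_cong)
  finally show ?thesis .
qed

text \<open>The terms of a lacunary sum of bounded variables are determined one after the other, from the
  largest coefficient down, by the value of the sum.\<close>

lemma conc_lacunary_sum:
  fixes Z :: "nat \<Rightarrow> 'a \<Rightarrow> complex" and a :: "nat \<Rightarrow> complex"
  assumes ind: "indep_vars (\<lambda>_. borel) Z UNIV"
    and fin: "finite K" and N: "card K \<le> N"
    and Zb: "\<And>k \<omega>. k \<in> K \<Longrightarrow> cmod (Z k \<omega>) \<le> R"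
    and Zc: "\<And>k b. k \<in> K \<Longrightarrow> prob {\<omega>\<in>space M. cmod (Z k \<omega> - b) \<le> c} \<le> q"
    and \<eta>: "0 < \<eta>" and c: "0 < c"
    and a: "\<And>k. k \<in> K \<Longrightarrow> 2 * \<eta> \<le> c * cmod (a k)"
    and lac: "\<And>j k. j \<in> K \<Longrightarrow> k \<in> K \<Longrightarrow> j \<noteq> k \<Longrightarrow> B * cmod (a j) \<le> cmod (a k) \<or> B * cmod (a k) \<le> cmod (a j)"
    and B: "1 < B" "2 * R * real N \<le> c * B" and R: "0 \<le> R"
  shows "prob {\<omega>\<in>space M. cmod ((\<Sum>k\<in>K. a k * Z k \<omega>) - b) \<le> \<eta>} \<le> q ^ card K"
  using fin N Zb Zc a lac
proof (induction K arbitrary: b rule: finite_ranking_induct[where f = "\<lambda>k. cmod (a k)"])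
  case empty
  then show ?case by simp
next
  \<comment> \<open>The induction adds indices by increasing modulus, so k carries the largest
    coefficient. It does not promise that k is new, hence the case split.\<close>
  case (insert k S)
  show ?case
  proof (cases "k \<in> S")
    case True
    then have [simp]: "insert k S = S" by blast
    show ?thesis using insert.IH[of b] insert.prems by simp
  next
    case False
    have [measurable]: "\<And>j. Z j \<in> borel_measurable M" using ind unfolding indep_vars_def by auto
    have q: "0 \<le> q" using insert.prems(3)[of k b] measure_nonneg order_trans by blast
    have IH: "prob {\<omega>\<in>space M. cmod ((\<Sum>j\<in>S. a j * Z j \<omega>) - b) \<le> \<eta>} \<le> q ^ card S" for b
    proof (rule insert.IH)
      show "card S \<le> N" using insert.prems(1) insert.hyps False by simp
    qed (use insert.prems in auto)
    have ak: "cmod (a k) > 0" using insert.prems(4)[of k] \<eta> c by (auto simp: zero_less_mult_iff dest: order.strict_trans2)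
    \<comment> \<open>Lacunarity makes every other coefficient at most |a k| / B; there are at most
      N of them, with variables bounded by R, and 2 R N is at most c B.\<close>
    have rest: "cmod (\<Sum>j\<in>S. a j * Z j \<omega>) \<le> c * cmod (a k) / 2" for \<omega>
    proof -
      have "cmod (\<Sum>j\<in>S. a j * Z j \<omega>) \<le> (\<Sum>j\<in>S. cmod (a k) / B * R)"
      proof (rule sum_norm_le)
        fix j assume j: "j \<in> S"
        have "j \<noteq> k" using j False by auto
        then consider "B * cmod (a j) \<le> cmod (a k)" | "B * cmod (a k) \<le> cmod (a j)"
          using insert.prems(5)[of j k] j by auto
        then have "cmod (a j) \<le> cmod (a k) / B"
        proof cases
          case 1 then show ?thesis using B by (simp add: field_simps)
        next
          case 2
          have "1 * cmod (a k) < B * cmod (a k)" using B ak by (intro mult_strict_right_mono) auto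
          then show ?thesis using 2 insert.hyps(2)[OF j] by linarith
        qed
        then show "cmod (a j * Z j \<omega>) \<le> cmod (a k) / B * R"
          unfolding norm_mult using insert.prems(2)[of j \<omega>] j B by (intro mult_mono) auto
      qed
      also have "\<dots> = real (card S) * (cmod (a k) / B * R)" by simp
      also have "\<dots> \<le> real N * (cmod (a k) / B * R)"
        using insert.prems(1) insert.hyps False B R by (intro mult_right_mono) auto
      also have "\<dots> = (2 * R * real N) * (cmod (a k) / (2 * B))" using B by (simp add: field_simps)
      also have "\<dots> \<le> (c * B) * (cmod (a k) / (2 * B))"
        using B by (intro mult_right_mono) auto
      also have "\<dots> = c * cmod (a k) / 2" using B by (simp add: field_simps)
      finally show ?thesis .
    qed
    \<comment> \<open>Since \<eta> and the remaining sum are each at most half of c |a k|, a value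
      within \<eta> of b forces Z k into the ball of radius c around b / a k. Given Z k, the rest is
      a shorter sum with a shifted centre.\<close>
    have "{\<omega>\<in>space M. cmod ((\<Sum>j\<in>insert k S. a j * Z j \<omega>) - b) \<le> \<eta>} \<subseteq>
      {\<omega>\<in>space M. Z k \<omega> \<in> cball (b / a k) c \<and> cmod ((a k * Z k \<omega> - b) + (\<Sum>j\<in>S. a j * Z j \<omega>)) \<le> \<eta>}"
    proof safe
      fix \<omega> assume "cmod ((\<Sum>j\<in>insert k S. a j * Z j \<omega>) - b) \<le> \<eta>"
      then have le: "cmod ((a k * Z k \<omega> - b) + (\<Sum>j\<in>S. a j * Z j \<omega>)) \<le> \<eta>"
        using insert.hyps False by (simp add: algebra_simps)
      then show "cmod ((a k * Z k \<omega> - b) + (\<Sum>j\<in>S. a j * Z j \<omega>)) \<le> \<eta>" .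
      have "cmod (a k * Z k \<omega> - b) \<le> \<eta> + c * cmod (a k) / 2"
        using le rest[of \<omega>]
          norm_triangle_ineq4[of "(a k * Z k \<omega> - b) + (\<Sum>j\<in>S. a j * Z j \<omega>)" "\<Sum>j\<in>S. a j * Z j \<omega>"] by simp
      also have "\<dots> \<le> c * cmod (a k)" using insert.prems(4)[of k] by simp
      finally have "cmod (a k * (Z k \<omega> - b / a k)) \<le> c * cmod (a k)"
        using ak by (simp add: right_diff_distrib)
      then have "cmod (Z k \<omega> - b / a k) \<le> c"
        using ak by (simp add: norm_mult mult.commute)
      then show "Z k \<omega> \<in> cball (b / a k) c" by (simp add: dist_norm norm_minus_commute)
    qed
    then have "prob {\<omega>\<in>space M. cmod ((\<Sum>j\<in>insert k S. a j * Z j \<omega>) - b) \<le> \<eta>} \<le>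
      prob {\<omega>\<in>space M. Z k \<omega> \<in> cball (b / a k) c \<and> cmod ((a k * Z k \<omega> - b) + (\<Sum>j\<in>S. a j * Z j \<omega>)) \<le> \<eta>}"
    proof (rule finite_measure_mono)
      have [measurable]: "cball (b / a k) c \<in> sets borel" by simp
      show "{\<omega>\<in>space M. Z k \<omega> \<in> cball (b / a k) c \<and>
          cmod ((a k * Z k \<omega> - b) + (\<Sum>j\<in>S. a j * Z j \<omega>)) \<le> \<eta>} \<in> events" by measurable
    qed
    also have "\<dots> \<le> prob {\<omega>\<in>space M. Z k \<omega> \<in> cball (b / a k) c} * q ^ card S"
      by (rule conc_indep[OF indep_vars_sum_complex IH])
        (use insert.hyps False indep_vars_subset[OF ind] in auto)
    also have "\<dots> \<le> q * q ^ card S"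
      using insert.prems(3)[of k "b / a k"] q
      by (intro mult_right_mono) (auto simp: dist_norm norm_minus_commute)
    finally show ?thesis using insert.hyps False by simp
  qed
qed

text \<open>An independent summand only averages over centres, so it preserves a bound uniform in
  the centre.\<close>

lemma conc_sum_superset:
  fixes Z :: "nat \<Rightarrow> 'a \<Rightarrow> complex" and a :: "nat \<Rightarrow> complex"
  assumes ind: "indep_vars (\<lambda>_. borel) Z UNIV" and fin: "finite K" "finite D"
    and K: "\<And>b. prob {\<omega>\<in>space M. cmod ((\<Sum>k\<in>K. a k * Z k \<omega>) - b) \<le> \<eta>} \<le> Q"
    and disj: "K \<inter> D = {}"
  shows "prob {\<omega>\<in>space M. cmod ((\<Sum>k\<in>K \<union> D. a k * Z k \<omega>) - b) \<le> \<eta>} \<le> Q"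
  using fin(2) disj
proof (induction D arbitrary: b)
  case empty
  then show ?case using K by simp
next
  case (insert k D)
  have "{\<omega>\<in>space M. cmod ((\<Sum>k\<in>K \<union> insert k D. a k * Z k \<omega>) - b) \<le> \<eta>} =
     {\<omega>\<in>space M. Z k \<omega> \<in> UNIV \<and> cmod ((a k * Z k \<omega> - b) + (\<Sum>k\<in>K \<union> D. a k * Z k \<omega>)) \<le> \<eta>}"
    using insert.hyps insert.prems fin by (simp add: algebra_simps)
  also have "prob \<dots> \<le> prob {\<omega>\<in>space M. Z k \<omega> \<in> UNIV} * Q"
    by (rule conc_indep[OF indep_vars_sum_complex insert.IH])
      (use insert.hyps insert.prems fin indep_vars_subset[OF ind] in auto)
  finally show ?case using prob_space by simp
qed

text \<open>The variables in K are truncated at R. This costs \<tau> once in the concentration of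
  each variable, whence q' + \<tau> \<le> q, and card K times \<tau> for the event that some
  truncation changes a value.\<close>

lemma small_ball_lacunary:
  fixes \<xi> :: "nat \<Rightarrow> 'a \<Rightarrow> complex" and a :: "nat \<Rightarrow> complex"
  assumes ind: "indep_vars (\<lambda>_. borel) \<xi> UNIV"
    and D: "finite D" and K: "K \<subseteq> D"
    and conc: "\<And>k b. prob {\<omega>\<in>space M. cmod (\<xi> k \<omega> - b) \<le> c} \<le> q'"
    and tail: "\<And>k. prob {\<omega>\<in>space M. cmod (\<xi> k \<omega>) > R} \<le> \<tau>" and q: "q' + \<tau> \<le> q"
    and \<eta>: "0 < \<eta>" and c: "0 < c"
    and a: "\<And>k. k \<in> K \<Longrightarrow> 2 * \<eta> \<le> c * cmod (a k)"
    and lac: "\<And>j k. j \<in> K \<Longrightarrow> k \<in> K \<Longrightarrow> j \<noteq> k \<Longrightarrow> B * cmod (a j) \<le> cmod (a k) \<or> B * cmod (a k) \<le> cmod (a j)"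
    and B: "1 < B" "2 * R * real (card K) \<le> c * B" and R: "0 \<le> R"
  shows "prob {\<omega>\<in>space M. cmod (\<Sum>k\<in>D. a k * \<xi> k \<omega>) \<le> \<eta>} \<le> q ^ card K + real (card K) * \<tau>"
proof -
  have meas[measurable]: "\<And>j. \<xi> j \<in> borel_measurable M" using ind unfolding indep_vars_def by auto
  define f where "f k x = (if k \<in> K \<and> cmod x > R then 0 else x)" for k and x :: complex
  define Z where "Z k \<omega> = f k (\<xi> k \<omega>)" for k \<omega>
  have [measurable]: "f k \<in> borel_measurable borel" for k unfolding f_def by (cases "k \<in> K") auto
  have indZ: "indep_vars (\<lambda>_. borel) Z UNIV"
    unfolding Z_def by (rule indep_vars_compose2[OF ind]) auto
  have [measurable]: "Z k \<in> borel_measurable M" for k unfolding Z_def by measurable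
  have finK: "finite K" using D K finite_subset by blast
  have concZ: "prob {\<omega>\<in>space M. cmod (Z k \<omega> - b) \<le> c} \<le> q" for k b
  proof -
    have "prob {\<omega>\<in>space M. cmod (Z k \<omega> - b) \<le> c} \<le>
        prob ({\<omega>\<in>space M. cmod (\<xi> k \<omega> - b) \<le> c} \<union> {\<omega>\<in>space M. cmod (\<xi> k \<omega>) > R})"
      by (intro finite_measure_mono) (auto simp: Z_def f_def)
    also have "\<dots> \<le> prob {\<omega>\<in>space M. cmod (\<xi> k \<omega> - b) \<le> c} + prob {\<omega>\<in>space M. cmod (\<xi> k \<omega>) > R}"
      by (intro measure_Un_le) auto
    finally show ?thesis using conc[of k b] tail[of k] q by linarith
  qed
  have lacZ: "prob {\<omega>\<in>space M. cmod ((\<Sum>k\<in>K. a k * Z k \<omega>) - b) \<le> \<eta>} \<le> q ^ card K" for b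
    by (rule conc_lacunary_sum[OF indZ finK order_refl _ concZ \<eta> c a lac B R])
      (auto simp: Z_def f_def R)
  have "prob {\<omega>\<in>space M. cmod ((\<Sum>k\<in>K \<union> (D - K). a k * Z k \<omega>) - 0) \<le> \<eta>} \<le> q ^ card K"
    by (rule conc_sum_superset[OF indZ finK _ lacZ]) (use D in auto)
  moreover have "K \<union> (D - K) = D" using K by auto
  ultimately have Z_small: "prob {\<omega>\<in>space M. cmod (\<Sum>k\<in>D. a k * Z k \<omega>) \<le> \<eta>} \<le> q ^ card K"
    by simp
  have "prob {\<omega>\<in>space M. cmod (\<Sum>k\<in>D. a k * \<xi> k \<omega>) \<le> \<eta>} \<le>
      prob ({\<omega>\<in>space M. cmod (\<Sum>k\<in>D. a k * Z k \<omega>) \<le> \<eta>} \<union> (\<Union>k\<in>K. {\<omega>\<in>space M. cmod (\<xi> k \<omega>) > R}))"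
  proof (intro finite_measure_mono subsetI)
    fix \<omega> assume \<omega>: "\<omega> \<in> {\<omega>\<in>space M. cmod (\<Sum>k\<in>D. a k * \<xi> k \<omega>) \<le> \<eta>}"
    show "\<omega> \<in> {\<omega>\<in>space M. cmod (\<Sum>k\<in>D. a k * Z k \<omega>) \<le> \<eta>} \<union> (\<Union>k\<in>K. {\<omega>\<in>space M. cmod (\<xi> k \<omega>) > R})"
    proof (cases "\<exists>k\<in>K. cmod (\<xi> k \<omega>) > R")
      case False
      then have "Z k \<omega> = \<xi> k \<omega>" for k by (auto simp: Z_def f_def)
      then show ?thesis using \<omega> by simp
    qed (use \<omega> in auto)
  qed (use finK in auto)
  also have "\<dots> \<le> prob {\<omega>\<in>space M. cmod (\<Sum>k\<in>D. a k * Z k \<omega>) \<le> \<eta>} +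
      prob (\<Union>k\<in>K. {\<omega>\<in>space M. cmod (\<xi> k \<omega>) > R})"
    using finK by (intro measure_Un_le) auto
  also have "prob (\<Union>k\<in>K. {\<omega>\<in>space M. cmod (\<xi> k \<omega>) > R}) \<le> (\<Sum>k\<in>K. prob {\<omega>\<in>space M. cmod (\<xi> k \<omega>) > R})"
    using finK by (intro measure_UNION_le) auto
  also have "\<dots> \<le> (\<Sum>k\<in>K. \<tau>)" by (intro sum_mono tail)
  finally show ?thesis using Z_small by simp
qed

text \<open>The squared probability of a ball of radius c is the probability that X and an
  independent copy Y both lie in it, hence at most that of |X - Y| \<le> 2 c. For some c this is
  below 1, uniformly in the centre.\<close>

lemma nondegenerate_conc:
  fixes X Y :: "'a \<Rightarrow> complex"
  assumes ind: "indep_var borel X borel Y" and eqd: "distr M borel Y = distr M borel X"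
    and nondeg: "\<not> (\<exists>c. AE \<omega> in M. X \<omega> = c)"
  obtains c q where "0 < c" "0 \<le> q" "q < 1" "\<And>b. prob {\<omega>\<in>space M. cmod (X \<omega> - b) \<le> c} \<le> q"
proof -
  have rv[measurable]: "random_variable borel X" "random_variable borel Y"
    and eq: "distr M borel X \<Otimes>\<^sub>M distr M borel Y = distr M (borel \<Otimes>\<^sub>M borel) (\<lambda>\<omega>. (X \<omega>, Y \<omega>))"
    using ind unfolding indep_var_distribution_eq by auto
  interpret X: prob_space "distr M borel X" by (rule prob_space_distr) simp
  interpret XY: pair_sigma_finite "distr M borel X" "distr M borel X" ..
  \<comment> \<open>If X = Y almost surely, Fubini yields a fixed x that equals Y almost surely, so
    X would be constant by equality of the laws.\<close>
  have not_eq: "\<not> (AE \<omega> in M. X \<omega> = Y \<omega>)"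
  proof
    assume "AE \<omega> in M. X \<omega> = Y \<omega>"
    then have "AE z in distr M (borel \<Otimes>\<^sub>M borel) (\<lambda>\<omega>. (X \<omega>, Y \<omega>)). fst z = snd z"
      by (subst AE_distr_iff) auto
    then have "AE z in distr M borel X \<Otimes>\<^sub>M distr M borel X. fst z = snd z"
      unfolding eq[symmetric] eqd .
    then have "AE x in distr M borel X. AE y in distr M borel X. x = y"
      using XY.AE_pair by fastforce
    then obtain x where "AE y in distr M borel X. x = y"
      using X.AE_False X.ae_filter_bot eventually_happens by blast
    then have "AE \<omega> in M. x = X \<omega>" by (subst (asm) AE_distr_iff) auto
    then have "AE \<omega> in M. X \<omega> = x" by eventually_elim simp
    then show False using nondeg by blast
  qed
  define A where "A n = {\<omega>\<in>space M. cmod (X \<omega> - Y \<omega>) > 2 / real (Suc n)}" for n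
  have [measurable]: "A n \<in> events" for n unfolding A_def by measurable
  have "\<exists>n. prob (A n) \<noteq> 0"
  proof (rule ccontr)
    assume "\<not> ?thesis"
    then have "AE \<omega> in M. \<omega> \<notin> A n" for n
      by (simp add: AE_iff_measurable[OF _ refl] emeasure_eq_measure A_def)
    then have "AE \<omega> in M. \<forall>n. \<omega> \<notin> A n" by (simp add: AE_all_countable)
    then have "AE \<omega> in M. X \<omega> = Y \<omega>"
    proof (rule AE_mp, intro AE_I2 impI)
      fix \<omega> assume "\<omega> \<in> space M" "\<forall>n. \<omega> \<notin> A n"
      then have le: "cmod (X \<omega> - Y \<omega>) \<le> 2 * inverse (real (Suc n))" for n
        by (auto simp: A_def not_less divide_inverse)
      have "cmod (X \<omega> - Y \<omega>) \<le> 2 * 0"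
        by (rule LIMSEQ_le_const[OF tendsto_mult[OF tendsto_const LIMSEQ_inverse_real_of_nat]]) (use le in auto)
      then show "X \<omega> = Y \<omega>" by simp
    qed
    then show False using not_eq by simp
  qed
  then obtain n where n: "prob (A n) > 0" by (metis measure_nonneg less_eq_real_def)
  define c where "c = 1 / real (Suc n)"
  have c: "c > 0" by (simp add: c_def)
  have sq: "(prob {\<omega>\<in>space M. cmod (X \<omega> - b) \<le> c})\<^sup>2 \<le> 1 - prob (A n)" for b
  proof -
    have "prob ((\<lambda>x. (X x, Y x)) -` (cball b c \<times> cball b c) \<inter> space M) =
      prob (X -` cball b c \<inter> space M) * prob (Y -` cball b c \<inter> space M)"
      by (rule indep_varD[OF ind]) auto
    moreover have "prob (Y -` cball b c \<inter> space M) = prob (X -` cball b c \<inter> space M)"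
      using eqd by (metis measure_distr rv borel_closed closed_cball)
    moreover have "X -` cball b c \<inter> space M = {\<omega>\<in>space M. cmod (X \<omega> - b) \<le> c}"
      by (auto simp: dist_norm norm_minus_commute)
    ultimately have "(prob {\<omega>\<in>space M. cmod (X \<omega> - b) \<le> c})\<^sup>2 =
      prob ((\<lambda>x. (X x, Y x)) -` (cball b c \<times> cball b c) \<inter> space M)"
      by (simp add: power2_eq_square)
    also have "\<dots> \<le> prob (space M - A n)"
    proof (intro finite_measure_mono subsetI)
      fix \<omega> assume "\<omega> \<in> (\<lambda>x. (X x, Y x)) -` (cball b c \<times> cball b c) \<inter> space M"
      then have \<omega>: "\<omega> \<in> space M" "dist b (X \<omega>) \<le> c" "dist b (Y \<omega>) \<le> c" by auto
      then have "dist (X \<omega>) (Y \<omega>) \<le> 2 * c"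
        using dist_triangle[of "X \<omega>" "Y \<omega>" b] by (simp add: dist_commute)
      then show "\<omega> \<in> space M - A n" using \<omega> by (auto simp: A_def c_def dist_norm)
    qed auto
    also have "\<dots> = 1 - prob (A n)" by (rule prob_compl) simp
    finally show ?thesis .
  qed
  show ?thesis
  proof (rule that[of c "sqrt (1 - prob (A n))"])
    show "prob {\<omega>\<in>space M. cmod (X \<omega> - b) \<le> c} \<le> sqrt (1 - prob (A n))" for b
      by (rule real_le_rsqrt[OF sq])
    have "1 - prob (A n) < 1" using n by simp
    then show "sqrt (1 - prob (A n)) < 1" by (simp only: real_sqrt_lt_1_iff)
    show "0 \<le> sqrt (1 - prob (A n))" by simp
  qed (rule c)
qed

text \<open>Markov's inequality restricted to the tail event: the bound is the integral of X over
  that event divided by e, which vanishes by dominated convergence. The full expectation would give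
  only boundedness.\<close>

lemma integrable_tail_tendsto_0:
  fixes X :: "'a \<Rightarrow> real" and L :: "nat \<Rightarrow> nat"
  assumes X: "integrable M X" "\<And>\<omega>. 0 \<le> X \<omega>" and L: "filterlim L at_top sequentially" and e: "e > 0"
  shows "(\<lambda>n. real (L n) * prob {\<omega>\<in>space M. X \<omega> > e * real (L n)}) \<longlonglongrightarrow> 0"
proof -
  have [measurable]: "X \<in> borel_measurable M" using X by auto
  have lim: "filterlim (\<lambda>n. e * real (L n)) at_top sequentially"
    using filterlim_tendsto_pos_mult_at_top[OF tendsto_const e
      filterlim_compose[OF filterlim_real_sequentially L]] .
  define A where "A n = {\<omega>\<in>space M. X \<omega> > e * real (L n)}" for n
  have [measurable]: "A n \<in> events" for n unfolding A_def by measurable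
  have "(\<lambda>n. \<integral>\<omega>. X \<omega> * indicator (A n) \<omega> \<partial>M) \<longlonglongrightarrow> (\<integral>\<omega>. 0 \<partial>M)"
  proof (rule integral_dominated_convergence[where w = X])
    show "AE \<omega> in M. (\<lambda>n. X \<omega> * indicator (A n) \<omega>) \<longlonglongrightarrow> 0"
    proof (rule AE_I2)
      fix \<omega>
      have "\<forall>\<^sub>F n in sequentially. X \<omega> \<le> e * real (L n)"
        using lim unfolding filterlim_at_top by blast
      then have "\<forall>\<^sub>F n in sequentially. X \<omega> * indicator (A n) \<omega> = 0"
        by eventually_elim (auto simp: A_def indicator_def)
      then show "(\<lambda>n. X \<omega> * indicator (A n) \<omega>) \<longlonglongrightarrow> 0" by (rule tendsto_eventually)
    qed
  qed (use X in \<open>auto simp: indicator_def\<close>)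
  then have lim0: "(\<lambda>n. (\<integral>\<omega>. X \<omega> * indicator (A n) \<omega> \<partial>M) / e) \<longlonglongrightarrow> 0"
    using tendsto_divide[OF _ tendsto_const[of e], of _ 0] e by simp
  show ?thesis
  proof (rule tendsto_sandwich[OF _ _ tendsto_const lim0])
    show "\<forall>\<^sub>F n in sequentially. real (L n) * prob {\<omega>\<in>space M. X \<omega> > e * real (L n)} \<le>
        (\<integral>\<omega>. X \<omega> * indicator (A n) \<omega> \<partial>M) / e"
    proof (rule always_eventually, rule allI)
      fix n
      have "e * real (L n) * prob (A n) = (\<integral>\<omega>. e * real (L n) * indicator (A n) \<omega> \<partial>M)"
        by simp
      also have "\<dots> \<le> (\<integral>\<omega>. X \<omega> * indicator (A n) \<omega> \<partial>M)"
        using X by (intro integral_mono integrable_mult_indicator integrable_real_mult_indicator)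
          (auto simp: indicator_def A_def less_imp_le)
      finally show "real (L n) * prob {\<omega>\<in>space M. X \<omega> > e * real (L n)} \<le>
          (\<integral>\<omega>. X \<omega> * indicator (A n) \<omega> \<partial>M) / e"
        using e by (simp add: A_def field_simps)
    qed
  qed simp
qed

end

subsection \<open>The rotation invariant measure of a convex function\<close>

text \<open>The left derivative of a convex function, whose backward difference quotients increase
  as h decreases to 0 (see \<open>left_slope_tendsto\<close>).\<close>

definition left_slope :: "(real \<Rightarrow> real) \<Rightarrow> real \<Rightarrow> real" where
  "left_slope f s = (SUP h\<in>{0<..}. (f s - f (s - h)) / h)"

locale lipschitz_convex =
  fixes f :: "real \<Rightarrow> real" and T :: real
  assumes conv: "convex_on UNIV f"
    and mono: "x \<le> y \<Longrightarrow> f x \<le> f y"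
    and lip: "x \<le> y \<Longrightarrow> f y - f x \<le> T * (y - x)"
begin

lemma T_nonneg: "0 \<le> T"
  using mono[of 0 1] lip[of 0 1] by simp

lemma bdd_slopes: "bdd_above ((\<lambda>h. (f s - f (s - h)) / h) ` {0<..})"
proof (rule bdd_aboveI2)
  fix h :: real assume "h \<in> {0<..}"
  then show "(f s - f (s - h)) / h \<le> T" using lip[of "s - h" s] by (simp add: pos_divide_le_eq)
qed

lemma left_slope_ge: "h > 0 \<Longrightarrow> (f s - f (s - h)) / h \<le> left_slope f s"
  unfolding left_slope_def by (rule cSUP_upper[OF _ bdd_slopes]) simp

lemma left_slope_nonneg: "0 \<le> left_slope f s"
  using left_slope_ge[of 1 s] mono[of "s - 1" s] by simp

lemma left_slope_le: "left_slope f s \<le> T"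
  unfolding left_slope_def
proof (rule cSUP_least)
  fix h :: real assume "h \<in> {0<..}"
  then show "(f s - f (s - h)) / h \<le> T" using lip[of "s - h" s] by (simp add: pos_divide_le_eq)
qed auto

lemma less_left_slope_iff: "t < left_slope f s \<longleftrightarrow> (\<exists>h>0. t < (f s - f (s - h)) / h)"
  unfolding left_slope_def by (subst less_cSUP_iff[OF _ bdd_slopes]) auto

lemma slope_mono:
  assumes "x < y" "y < z"
  shows "(f y - f x) / (y - x) \<le> (f z - f x) / (z - x)" "(f z - f x) / (z - x) \<le> (f z - f y) / (z - y)"
proof -
  have "(f x - f y) / (x - y) \<le> (f x - f z) / (x - z)" "(f x - f z) / (x - z) \<le> (f y - f z) / (y - z)"
    using convex_on_slope_le[OF conv, of x z y] assms by auto
  then show "(f y - f x) / (y - x) \<le> (f z - f x) / (z - x)" "(f z - f x) / (z - x) \<le> (f z - f y) / (z - y)"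
    by (metis minus_diff_eq minus_divide_divide)+
qed

lemma left_slope_bounds:
  assumes "x < y"
  shows "left_slope f x * (y - x) \<le> f y - f x" "f y - f x \<le> left_slope f y * (y - x)"
proof -
  have "left_slope f x \<le> (f y - f x) / (y - x)"
    unfolding left_slope_def
  proof (rule cSUP_least)
    fix h :: real assume h: "h \<in> {0<..}"
    have "(f x - f (x - h)) / h \<le> (f y - f (x - h)) / (y - (x - h))"
      using slope_mono(1)[of "x - h" x y] h assms by simp
    also have "\<dots> \<le> (f y - f x) / (y - x)"
      using slope_mono(2)[of "x - h" x y] h assms by simp
    finally show "(f x - f (x - h)) / h \<le> (f y - f x) / (y - x)" .
  qed auto
  then show "left_slope f x * (y - x) \<le> f y - f x" using assms by (simp add: pos_le_divide_eq)
  show "f y - f x \<le> left_slope f y * (y - x)"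
    using left_slope_ge[of "y - x" y] assms by (simp add: pos_divide_le_eq)
qed

lemma left_slope_mono: "x \<le> y \<Longrightarrow> left_slope f x \<le> left_slope f y"
  using order_trans[OF left_slope_bounds(1)[of x y] left_slope_bounds(2)[of x y]]
  by (cases "x = y") (auto simp: mult_le_cancel_right)

lemma left_slope_tendsto:
  "((\<lambda>h. (f (s + h) - f s) / h) \<longlongrightarrow> left_slope f s) (at_left 0)"
proof (rule tendstoI)
  fix e :: real assume "e > 0"
  then obtain h where h: "h > 0" "left_slope f s - e < (f s - f (s - h)) / h"
    using less_left_slope_iff[of "left_slope f s - e" s] by auto
  have "\<forall>\<^sub>F k in at_left 0. k \<in> {-h<..<0}"
    using h eventually_at_left_real[of "-h" 0] by simp
  then show "\<forall>\<^sub>F k in at_left 0. dist ((f (s + k) - f s) / k) (left_slope f s) < e"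
  proof eventually_elim
    case (elim k)
    have eq: "(f (s + k) - f s) / k = (f s - f (s - (-k))) / (-k)"
      by (simp add: minus_divide_left[symmetric] minus_divide_right[symmetric] diff_divide_distrib)
    have "(f s - f (s - h)) / h \<le> (f s - f (s + k)) / (-k)"
      using slope_mono(2)[of "s - h" "s + k" s] elim by simp
    moreover have "(f s - f (s - (-k))) / (-k) \<le> left_slope f s"
      using left_slope_ge[of "-k" s] elim by simp
    ultimately show ?case using h(2) eq by (simp add: dist_real_def)
  qed
qed

lemma f_continuous: "isCont f s"
  using convex_on_continuous[OF open_UNIV conv] by (simp add: continuous_on_eq_continuous_at)

text \<open>A chord whose slope exceeds t still does so after its right end moves slightly to the
  left, because f is continuous. This left continuity is what matches slopes with the masses of open
  disks.\<close>

lemma left_slope_left_cont: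
  assumes "t < left_slope f s"
  obtains s' where "s' < s" "t < left_slope f s'"
proof -
  obtain h where h: "h > 0" "t < (f s - f (s - h)) / h" using assms less_left_slope_iff by auto
  have "((\<lambda>x. (f x - f (s - h)) / (x - (s - h))) \<longlongrightarrow> (f s - f (s - h)) / (s - (s - h))) (at_left s)"
    by (intro tendsto_intros tendsto_within_subset[OF isContD[OF f_continuous]]) (use h in auto)
  then have "\<forall>\<^sub>F x in at_left s. t < (f x - f (s - h)) / (x - (s - h))"
    by (rule order_tendstoD) (use h in simp)
  moreover have "\<forall>\<^sub>F x in at_left s. x \<in> {s - h<..<s}"
    using h by (intro eventually_at_left_real) simp
  ultimately have "\<forall>\<^sub>F x in at_left s. x < s \<and> t < left_slope f x"
  proof eventually_elim
    case (elim x)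
    then show ?case using left_slope_ge[of "x - (s - h)" x] by auto
  qed
  then obtain x where "x < s" "t < left_slope f x"
    using eventually_happens[of _ "at_left s"] by auto
  then show ?thesis using that by blast
qed

text \<open>The range of t for which the set in \<open>radius\<close> is nonempty, so that its
  infimum is meaningful.\<close>

definition levels :: "real set" where
  "levels = {t. 0 \<le> t \<and> (\<exists>r>0. t < left_slope f (ln r))}"

text \<open>The quantile function (generalized inverse) of the prospective distribution function
  sending r to the left slope of f at ln r.\<close>

definition radius :: "real \<Rightarrow> real" where
  "radius t = Inf {r. 0 < r \<and> t < left_slope f (ln r)}"

lemma radius_nonneg: "t \<in> levels \<Longrightarrow> 0 \<le> radius t"
  unfolding radius_def levels_def by (intro cInf_greatest) auto

text \<open>An infimum may be attained in the limit only; left continuity supplies a smaller radius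
  that still exceeds the level, which makes the inequality strict.\<close>

lemma radius_less_iff:
  assumes t: "t \<in> levels" and r: "r > 0"
  shows "radius t < r \<longleftrightarrow> t < left_slope f (ln r)"
proof
  have ne: "{r. 0 < r \<and> t < left_slope f (ln r)} \<noteq> {}" using t by (auto simp: levels_def)
  assume "radius t < r"
  then obtain r' where r': "0 < r'" "t < left_slope f (ln r')" "r' < r"
    unfolding radius_def using cInf_lessD[OF ne] by auto
  then have "left_slope f (ln r') \<le> left_slope f (ln r)" by (intro left_slope_mono) auto
  then show "t < left_slope f (ln r)" using r' by simp
next
  assume "t < left_slope f (ln r)"
  then obtain s where s: "s < ln r" "t < left_slope f s" by (rule left_slope_left_cont)
  have "radius t \<le> exp s"
    unfolding radius_def using s by (intro cInf_lower bdd_belowI[of _ 0]) auto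
  also have "exp s < r" using s r by (metis exp_less_cancel_iff exp_ln)
  finally show "radius t < r" .
qed

lemma levels_eq:
  assumes "r > 0"
  shows "{t\<in>levels. radius t < r} = {0..<left_slope f (ln r)}"
proof -
  have "t \<in> levels" if "0 \<le> t" "t < left_slope f (ln r)" for t
    using that assms by (auto simp: levels_def)
  moreover have "0 \<le> t" if "t \<in> levels" for t using that by (simp add: levels_def)
  ultimately show ?thesis using radius_less_iff[OF _ assms] by auto
qed

lemma levels_UN: "levels = (\<Union>n. {0..<left_slope f (ln (real (Suc n)))})"
proof safe
  fix t assume "t \<in> levels"
  then obtain r where r: "0 \<le> t" "0 < r" "t < left_slope f (ln r)" by (auto simp: levels_def)
  obtain n where "r \<le> real (Suc n)" by (metis le_SucI of_nat_le_iff order_trans real_arch_simple)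
  then have "left_slope f (ln r) \<le> left_slope f (ln (real (Suc n)))"
    using r by (intro left_slope_mono) auto
  then show "t \<in> (\<Union>n. {0..<left_slope f (ln (real (Suc n)))})" using r by (intro UN_I[of n]) auto
next
  fix t n assume "t \<in> {0..<left_slope f (ln (real (Suc n)))}"
  then show "t \<in> levels" unfolding levels_def
    by (intro CollectI conjI exI[of _ "real (Suc n)"]) auto
qed

lemma sets_levels[measurable]: "levels \<in> sets borel"
  unfolding levels_UN by measurable

lemma levels_subset: "levels \<subseteq> {0..T}"
proof
  fix t assume "t \<in> levels"
  then obtain r where "0 \<le> t" "t < left_slope f (ln r)" by (auto simp: levels_def)
  then show "t \<in> {0..T}" using left_slope_le[of "ln r"] by simp
qed

lemma radius_measurable[measurable]: "radius \<in> borel_measurable (restrict_space lborel levels)"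
proof (rule borel_measurable_iff_less[THEN iffD2], rule allI)
  fix a
  have "{t\<in>space (restrict_space lborel levels). radius t < a} = {t\<in>levels. radius t < a}"
    by (simp add: space_restrict_space)
  also have "\<dots> \<in> sets (restrict_space lborel levels)"
  proof (cases "a > 0")
    case True
    have "{0..<left_slope f (ln a)} \<subseteq> levels" using levels_eq[OF True] by blast
    then show ?thesis unfolding levels_eq[OF True]
      by (subst sets_restrict_space_iff) auto
  next
    case False
    then have "{t\<in>levels. radius t < a} = {}" using radius_nonneg by fastforce
    then show ?thesis by (simp only: sets.empty_sets)
  qed
  finally show "{t\<in>space (restrict_space lborel levels). radius t < a} \<in> sets (restrict_space lborel levels)" .
qed

text \<open>The radius is distributed by the quantile function, the angle uniformly and
  independently of it. Disk masses then depend on the first factor alone and rotation invariance on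
  the second.\<close>

definition zero_limit :: "complex measure" where
  "zero_limit = distr (restrict_space lborel levels \<Otimes>\<^sub>M restrict_space lborel {0..<1}) borel
     (\<lambda>(t, x). of_real (radius t) * cis (2 * pi * x))"

end

text \<open>Rotating shifts x modulo 1 by the fractional part c of b. The piece of the shifted
  interval that passes 1 is moved back by periodicity, and half-open intervals fit together
  exactly.\<close>

lemma emeasure_cis_rotate:
  fixes A :: "complex set"
  assumes A: "A \<in> sets borel"
  shows "emeasure lborel {x\<in>{0..<1}. cis (2 * pi * (x + b)) \<in> A} = emeasure lborel {x\<in>{0..<1}. cis (2 * pi * x) \<in> A}"
proof -
  note [measurable] = A
  define G where "G = {x. cis (2 * pi * x) \<in> A}"
  have cis_meas: "(\<lambda>x::real. cis (2 * pi * x)) \<in> borel_measurable borel"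
    by (intro borel_measurable_continuous_onI continuous_intros)
  have G[measurable]: "G \<in> sets borel"
    using measurable_sets[OF cis_meas A] by (simp add: G_def vimage_def)
  have shift: "emeasure lborel {x. x + c \<in> S} = emeasure lborel S" if [measurable]: "S \<in> sets borel" for c and S :: "real set"
  proof -
    have "emeasure lborel S = emeasure (distr lborel borel (\<lambda>x. c + x)) S"
      by (simp add: lborel_distr_plus)
    also have "\<dots> = emeasure lborel ((\<lambda>x. c + x) -` S \<inter> space lborel)"
      by (rule emeasure_distr) auto
    also have "(\<lambda>x. c + x) -` S \<inter> space lborel = {x. x + c \<in> S}" by (auto simp: add.commute)
    finally show ?thesis by simp
  qed
  have per: "x + of_int k \<in> G \<longleftrightarrow> x \<in> G" for x k
  proof -
    have "cis (2 * pi * (x + of_int k)) = cis (2 * pi * x) * cis (2 * pi * of_int k)"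
      by (simp only: cis_mult ring_distribs)
    also have "cis (2 * pi * of_int k) = 1" by (rule cis_multiple_2pi) simp
    finally show ?thesis by (simp add: G_def)
  qed
  define c where "c = frac b"
  have c: "0 \<le> c" "c < 1" by (auto simp: c_def frac_lt_1)
  have "cis (2 * pi * (x + b)) \<in> A \<longleftrightarrow> x + c \<in> G" for x
  proof -
    have "x + b = x + c + of_int \<lfloor>b\<rfloor>" by (simp add: c_def frac_def)
    then show ?thesis using per[of "x + c" "\<lfloor>b\<rfloor>"] by (simp only: G_def mem_Collect_eq)
  qed
  then have "{x\<in>{0..<1}. cis (2 * pi * (x + b)) \<in> A} = {x\<in>{0..<1}. x + c \<in> G}" by simp
  also have "\<dots> = {x. x + c \<in> G \<inter> {c..<1 + c}}" by auto
  also have "emeasure lborel \<dots> = emeasure lborel (G \<inter> {c..<1 + c})" by (rule shift) measurable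
  also have "G \<inter> {c..<1 + c} = (G \<inter> {c..<1}) \<union> (G \<inter> {1..<1 + c})" using c by auto
  also have "emeasure lborel \<dots> = emeasure lborel (G \<inter> {c..<1}) + emeasure lborel (G \<inter> {1..<1 + c})"
    by (rule plus_emeasure[symmetric]) auto
  also have "emeasure lborel (G \<inter> {1..<1 + c}) = emeasure lborel {x. x + 1 \<in> G \<inter> {1..<1 + c}}"
    by (rule shift[symmetric]) measurable
  also have "{x. x + 1 \<in> G \<inter> {1..<1 + c}} = G \<inter> {0..<c}" using per[of _ 1] by auto
  also have "emeasure lborel (G \<inter> {c..<1}) + emeasure lborel (G \<inter> {0..<c}) =
      emeasure lborel ((G \<inter> {c..<1}) \<union> (G \<inter> {0..<c}))"
    by (rule plus_emeasure) auto
  also have "(G \<inter> {c..<1}) \<union> (G \<inter> {0..<c}) = {x\<in>{0..<1}. cis (2 * pi * x) \<in> A}"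
    using c by (auto simp: G_def)
  finally show ?thesis .
qed

context lipschitz_convex
begin

lemma zero_limit_map_measurable[measurable]:
  "(\<lambda>(t, x). of_real (radius t) * cis (2 * pi * x)) \<in>
     borel_measurable (restrict_space lborel levels \<Otimes>\<^sub>M restrict_space lborel {0..<1})"
proof -
  have "(\<lambda>x::real. cis (2 * pi * x)) \<in> borel_measurable borel"
    by (intro borel_measurable_continuous_onI continuous_intros)
  then have [measurable]: "(\<lambda>x::real. cis (2 * pi * x)) \<in> borel_measurable (restrict_space lborel {0..<1})"
    by (intro measurable_restrict_space1) simp
  show ?thesis unfolding case_prod_beta by measurable
qed

lemma sets_zero_limit[simp, measurable_cong]: "sets zero_limit = sets borel"
  by (simp add: zero_limit_def)

lemma space_zero_limit[simp]: "space zero_limit = UNIV"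
  by (simp add: zero_limit_def)

lemma angle_prob: "prob_space (restrict_space lborel {0..<1::real})"
  by (rule prob_spaceI) (simp add: space_restrict_space emeasure_restrict_space)

lemma emeasure_zero_limit:
  assumes [measurable]: "A \<in> sets borel"
  shows "emeasure zero_limit A =
    (\<integral>\<^sup>+t. emeasure lborel {x\<in>{0..<1}. of_real (radius t) * cis (2 * pi * x) \<in> A} \<partial>restrict_space lborel levels)"
proof -
  interpret prob_space "restrict_space lborel {0..<1::real}" by (rule angle_prob)
  let ?P = "restrict_space lborel levels \<Otimes>\<^sub>M restrict_space lborel {0..<1::real}"
  let ?g = "\<lambda>(t, x). of_real (radius t) * cis (2 * pi * x)"
  have S: "?g -` A \<inter> space ?P \<in> sets ?P" by measurable
  have "emeasure zero_limit A = emeasure ?P (?g -` A \<inter> space ?P)"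
    unfolding zero_limit_def by (rule emeasure_distr) measurable
  also have "\<dots> = (\<integral>\<^sup>+t. emeasure (restrict_space lborel {0..<1})
      (Pair t -` (?g -` A \<inter> space ?P)) \<partial>restrict_space lborel levels)"
    by (rule emeasure_pair_measure_alt[OF S])
  also have "\<dots> = (\<integral>\<^sup>+t. emeasure lborel {x\<in>{0..<1}. of_real (radius t) * cis (2 * pi * x) \<in> A}
      \<partial>restrict_space lborel levels)"
  proof (rule nn_integral_cong)
    fix t assume "t \<in> space (restrict_space lborel levels)"
    then have "Pair t -` (?g -` A \<inter> space ?P) = {x\<in>{0..<1}. of_real (radius t) * cis (2 * pi * x) \<in> A}"
      by (auto simp: space_pair_measure space_restrict_space)
    then show "emeasure (restrict_space lborel {0..<1}) (Pair t -` (?g -` A \<inter> space ?P)) =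
        emeasure lborel {x\<in>{0..<1}. of_real (radius t) * cis (2 * pi * x) \<in> A}"
      by (simp only:) (rule emeasure_restrict_space, auto)
  qed
  finally show ?thesis .
qed

lemma rotate_measurable: "(\<lambda>z. cis \<theta> * z) \<in> borel_measurable borel"
  by (intro borel_measurable_continuous_onI continuous_intros)

lemma zero_limit_rotate: "distr zero_limit borel (\<lambda>z. cis \<theta> * z) = zero_limit"
proof (rule measure_eqI)
  fix A assume "A \<in> sets (distr zero_limit borel (\<lambda>z. cis \<theta> * z))"
  then have A[measurable]: "A \<in> sets borel" by simp
  have pre: "(\<lambda>z. cis \<theta> * z) -` A \<in> sets borel"
    using measurable_sets[OF rotate_measurable A, of \<theta>] by simp
  have "emeasure (distr zero_limit borel (\<lambda>z. cis \<theta> * z)) A = emeasure zero_limit ((\<lambda>z. cis \<theta> * z) -` A)"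
    using rotate_measurable by (subst emeasure_distr) (auto cong: measurable_cong_sets)
  also have "\<dots> = emeasure zero_limit A"
    unfolding emeasure_zero_limit[OF pre] emeasure_zero_limit[OF A]
  proof (rule nn_integral_cong)
    fix t
    have S: "(\<lambda>w. of_real (radius t) * w) -` A \<in> sets borel"
    proof -
      have "(\<lambda>w::complex. of_real (radius t) * w) \<in> borel_measurable borel"
        by (intro borel_measurable_continuous_onI continuous_intros)
      from measurable_sets[OF this A] show ?thesis by simp
    qed
    have "cis \<theta> * (of_real (radius t) * cis (2 * pi * x)) = of_real (radius t) * cis (2 * pi * (x + \<theta> / (2 * pi)))" for x
    proof -
      have "2 * pi * (x + \<theta> / (2 * pi)) = \<theta> + 2 * pi * x" by (simp add: ring_distribs)
      then show ?thesis by (metis cis_mult mult.left_commute)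
    qed
    then show "emeasure lborel {x\<in>{0..<1}. of_real (radius t) * cis (2 * pi * x) \<in> (\<lambda>z. cis \<theta> * z) -` A} =
        emeasure lborel {x\<in>{0..<1}. of_real (radius t) * cis (2 * pi * x) \<in> A}"
      using emeasure_cis_rotate[OF S, of "\<theta> / (2 * pi)"] by (simp only: vimage_eq)
  qed
  finally show "emeasure (distr zero_limit borel (\<lambda>z. cis \<theta> * z)) A = emeasure zero_limit A" .
qed simp

lemma emeasure_zero_limit_ball:
  assumes r: "r > 0"
  shows "emeasure zero_limit (ball 0 r) = ennreal (left_slope f (ln r))"
proof -
  have "emeasure zero_limit (ball 0 r) =
      (\<integral>\<^sup>+t. indicator {t\<in>levels. radius t < r} t \<partial>restrict_space lborel levels)"
    unfolding emeasure_zero_limit[OF borel_open[OF open_ball]]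
  proof (rule nn_integral_cong)
    fix t assume "t \<in> space (restrict_space lborel levels)"
    then have t: "t \<in> levels" by (simp add: space_restrict_space)
    have "{x\<in>{0..<1}. of_real (radius t) * cis (2 * pi * x) \<in> ball 0 r} = (if radius t < r then {0..<1} else {})"
      using radius_nonneg[OF t] by (auto simp: norm_mult)
    then show "emeasure lborel {x\<in>{0..<1}. of_real (radius t) * cis (2 * pi * x) \<in> ball 0 r} =
        indicator {t\<in>levels. radius t < r} t"
      using t by simp
  qed
  also have "\<dots> = emeasure (restrict_space lborel levels) {0..<left_slope f (ln r)}"
    unfolding levels_eq[OF r] using levels_eq[OF r]
    by (intro nn_integral_indicator) (auto simp: sets_restrict_space_iff)
  also have "\<dots> = emeasure lborel {0..<left_slope f (ln r)}"
    using levels_eq[OF r] by (intro emeasure_restrict_space) auto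
  finally show ?thesis using left_slope_nonneg by simp
qed

lemma measure_zero_limit_ball:
  "r > 0 \<Longrightarrow> measure zero_limit (ball 0 r) = left_slope f (ln r)"
  using emeasure_zero_limit_ball left_slope_nonneg by (simp add: measure_def)

lemma finite_zero_limit: "finite_measure zero_limit"
proof (rule finite_measureI)
  have all: "{x::real\<in>{0..<1}. of_real (radius t) * cis (2 * pi * x) \<in> UNIV} = {0..<1}" for t by auto
  have "emeasure zero_limit (space zero_limit) = emeasure (restrict_space lborel levels) levels"
    unfolding space_zero_limit emeasure_zero_limit[OF sets.top[of borel, unfolded space_borel]] all
    by (simp add: space_restrict_space)
  also have "\<dots> = emeasure lborel levels" by (rule emeasure_restrict_space) auto
  also have "\<dots> \<le> emeasure lborel {0..T}" by (rule emeasure_mono[OF levels_subset]) simp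
  also have "\<dots> < \<infinity>" using T_nonneg by simp
  finally show "emeasure zero_limit (space zero_limit) \<noteq> \<infinity>" by simp
qed

text \<open>Both the integral over [x, y] and f y - f x lie between (y - x) times the left slopes at
  x and at y. Their difference D is additive over adjacent intervals, so on a grid of mesh h the
  errors telescope to at most h times the total increase of the slope.\<close>

lemma integral_zero_limit_log:
  assumes ab: "a < b"
  shows "(\<integral>w. (ln (max (exp b) (cmod w)) - ln (max (exp a) (cmod w))) \<partial>zero_limit) = f b - f a"
proof -
  interpret finite_measure zero_limit by (rule finite_zero_limit)
  define \<psi> where "\<psi> x y w = ln (max (exp y) (cmod w)) - ln (max (exp x) (cmod w))" for x y and w :: complex
  have [measurable]: "\<psi> x y \<in> borel_measurable borel" for x y unfolding \<psi>_def by measurable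
  have \<psi>_bounds: "(y - x) * indicator (ball 0 (exp x)) w \<le> \<psi> x y w"
    "\<psi> x y w \<le> (y - x) * indicator (ball 0 (exp y)) w" "0 \<le> \<psi> x y w" if "x \<le> y" for x y w
  proof -
    consider "cmod w < exp x" | "exp x \<le> cmod w" "cmod w < exp y" | "exp y \<le> cmod w" by linarith
    then have "(y - x) * indicator (ball 0 (exp x)) w \<le> \<psi> x y w \<and>
      \<psi> x y w \<le> (y - x) * indicator (ball 0 (exp y)) w \<and> 0 \<le> \<psi> x y w"
    proof cases
      case 1
      moreover have "exp x \<le> exp y" using that by simp
      ultimately have "cmod w < exp y" by linarith
      with 1 that show ?thesis by (simp add: \<psi>_def max_def)
    next
      case 2
      moreover have "0 < cmod w" using 2 exp_gt_zero[of x] by linarith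
      then have "x \<le> ln (cmod w)" "ln (cmod w) \<le> y"
        using 2 ln_mono[of "cmod w" "exp y"] by (auto simp: ln_ge_iff)
      ultimately show ?thesis using that by (simp add: \<psi>_def max_def)
    next
      case 3
      moreover have "exp x \<le> exp y" using that by simp
      ultimately have "exp x \<le> cmod w" by linarith
      with 3 that show ?thesis by (simp add: \<psi>_def max_def)
    qed
    then show "(y - x) * indicator (ball 0 (exp x)) w \<le> \<psi> x y w"
      "\<psi> x y w \<le> (y - x) * indicator (ball 0 (exp y)) w" "0 \<le> \<psi> x y w" by auto
  qed
  have int\<psi>: "integrable zero_limit (\<psi> x y)" if "x \<le> y" for x y
  proof (rule integrable_const_bound[where B = "y - x"])
    show "AE w in zero_limit. norm (\<psi> x y w) \<le> y - x"
    proof (rule AE_I2)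
      fix w :: complex
      have "(y - x) * indicator (ball 0 (exp y)) w \<le> y - x" using that by (auto simp: indicator_def)
      then show "norm (\<psi> x y w) \<le> y - x" using \<psi>_bounds[OF that, of w] by simp
    qed
  qed simp
  define D where "D x y = (\<integral>w. \<psi> x y w \<partial>zero_limit) - (f y - f x)" for x y
  have D_small: "\<bar>D x y\<bar> \<le> (y - x) * (left_slope f y - left_slope f x)" if xy: "x < y" for x y
  proof -
    have intI: "integrable zero_limit (\<lambda>w. (y - x) * indicator (ball 0 (exp z)) w)" for z
      by (rule integrable_const_bound[where B = "\<bar>y - x\<bar>"]) (auto simp: indicator_def)
    have ball: "(\<integral>w. (y - x) * indicator (ball 0 (exp z)) w \<partial>zero_limit) = (y - x) * left_slope f z" for z
      by (simp add: measure_zero_limit_ball)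
    have "(y - x) * left_slope f x \<le> (\<integral>w. \<psi> x y w \<partial>zero_limit)"
      unfolding ball[symmetric] using \<psi>_bounds[of x y] xy int\<psi>[of x y]
      by (intro integral_mono intI) auto
    moreover have "(\<integral>w. \<psi> x y w \<partial>zero_limit) \<le> (y - x) * left_slope f y"
      unfolding ball[symmetric] using \<psi>_bounds[of x y] xy int\<psi>[of x y]
      by (intro integral_mono intI) auto
    ultimately show ?thesis
      using left_slope_bounds[OF xy] by (simp add: D_def abs_le_iff algebra_simps)
  qed
  have D_add: "D x z = D x y + D y z" if "x \<le> y" "y \<le> z" for x y z
  proof -
    have "(\<integral>w. \<psi> x z w \<partial>zero_limit) = (\<integral>w. \<psi> x y w + \<psi> y z w \<partial>zero_limit)"
      by (simp add: \<psi>_def)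
    also have "\<dots> = (\<integral>w. \<psi> x y w \<partial>zero_limit) + (\<integral>w. \<psi> y z w \<partial>zero_limit)"
      using int\<psi> that by (intro Bochner_Integration.integral_add) auto
    finally show ?thesis by (simp add: D_def)
  qed
  have D_grid: "\<bar>D a (a + real k * h)\<bar> \<le> h * (left_slope f (a + real k * h) - left_slope f a)" if h: "h > 0" for h k
  proof (induction k)
    case 0
    show ?case by (simp add: D_def \<psi>_def)
  next
    case (Suc k)
    have "D a (a + real (Suc k) * h) = D a (a + real k * h) + D (a + real k * h) (a + real (Suc k) * h)"
      by (rule D_add) (use h in \<open>auto simp: ring_distribs\<close>)
    moreover have "\<bar>D (a + real k * h) (a + real (Suc k) * h)\<bar> \<le>
        h * (left_slope f (a + real (Suc k) * h) - left_slope f (a + real k * h))"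
      using D_small[of "a + real k * h" "a + real (Suc k) * h"] h by (simp add: algebra_simps)
    ultimately show ?case using Suc.IH by (simp add: algebra_simps)
  qed
  have "\<bar>D a b\<bar> \<le> (b - a) * (left_slope f b - left_slope f a) * inverse (real (Suc n))" for n
  proof -
    have "a + real (Suc n) * ((b - a) / real (Suc n)) = b" by (simp del: of_nat_Suc)
    with D_grid[of "(b - a) / real (Suc n)" "Suc n"] ab show ?thesis
      by (simp add: divide_inverse mult_ac del: of_nat_Suc)
  qed
  then have "\<bar>D a b\<bar> \<le> (b - a) * (left_slope f b - left_slope f a) * 0"
    by (intro LIMSEQ_le_const[OF tendsto_mult[OF tendsto_const LIMSEQ_inverse_real_of_nat]]) auto
  then show ?thesis by (simp add: D_def \<psi>_def)
qed

end

subsection \<open>A dense class of test functions\<close>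

text \<open>The interpolant is written through ramps min(x, v) - min(x, u) because these are what
  the available test functions supply, with x = ln |w| in the radial case and x = |w|^(2 m) in the
  angular one.\<close>

lemma piecewise_linear_approx:
  fixes g :: "real \<Rightarrow> real"
  assumes h: "h > 0"
    and osc: "\<And>x y. x \<in> {a..a + real n * h} \<Longrightarrow> y \<in> {a..a + real n * h} \<Longrightarrow> \<bar>x - y\<bar> \<le> h \<Longrightarrow> \<bar>g x - g y\<bar> \<le> e"
  defines "P \<equiv> \<lambda>k x. g a + (\<Sum>i<k. (g (a + real (Suc i) * h) - g (a + real i * h)) / h *
      (min x (a + real (Suc i) * h) - min x (a + real i * h)))"
  shows "k \<le> n \<Longrightarrow> (\<forall>x\<in>{a..a + real k * h}. \<bar>g x - P k x\<bar> \<le> e) \<and> (\<forall>x\<ge>a + real k * h. P k x = g (a + real k * h))"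
    and "x \<le> a \<Longrightarrow> P k x = g a"
proof -
  have step: "a + real k * h \<le> a + real (Suc k) * h" for k using h by (simp add: ring_distribs)
  show "k \<le> n \<Longrightarrow> (\<forall>x\<in>{a..a + real k * h}. \<bar>g x - P k x\<bar> \<le> e) \<and> (\<forall>x\<ge>a + real k * h. P k x = g (a + real k * h))"
  proof (induction k)
    case 0
    have "\<bar>g a - g a\<bar> \<le> e" using h by (intro osc) auto
    then show ?case by (auto simp: P_def)
  next
    case (Suc k)
    let ?u = "a + real k * h" and ?v = "a + real (Suc k) * h"
    have IH: "\<And>x. x \<in> {a..?u} \<Longrightarrow> \<bar>g x - P k x\<bar> \<le> e" "\<And>x. x \<ge> ?u \<Longrightarrow> P k x = g ?u"
      using Suc by auto
    have uv: "?v = ?u + h" by (simp add: ring_distribs)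
    have P_Suc: "P (Suc k) x = P k x + (g ?v - g ?u) / h * (min x ?v - min x ?u)" for x
      by (simp add: P_def)
    have le_n: "?v \<le> a + real n * h" using Suc.prems h by simp
    have au: "a \<le> ?u" using h by simp
    have "\<bar>g x - P (Suc k) x\<bar> \<le> e" if x: "x \<in> {a..?v}" for x
    proof (cases "x \<le> ?u")
      case True
      then have "min x ?v - min x ?u = 0" using step[of k] by (simp add: min_def)
      then have "P (Suc k) x = P k x" by (simp add: P_Suc)
      then show ?thesis using IH(1)[of x] True x by simp
    next
      case False
      define l where "l = (x - ?u) / h"
      have l: "0 \<le> l" "l \<le> 1" using False x h uv by (auto simp: l_def)
      have "min x ?v - min x ?u = l * h" using False x h by (simp add: min_def l_def)
      then have "P (Suc k) x = g ?u + (g ?v - g ?u) * l"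
        using IH(2)[of x] False h by (simp add: P_Suc)
      then have "g x - P (Suc k) x = (1 - l) * (g x - g ?u) + l * (g x - g ?v)" by (simp add: algebra_simps)
      also have "\<bar>\<dots>\<bar> \<le> (1 - l) * \<bar>g x - g ?u\<bar> + l * \<bar>g x - g ?v\<bar>"
        using l by (intro order_trans[OF abs_triangle_ineq]) (simp add: abs_mult)
      also have "\<dots> \<le> (1 - l) * e + l * e"
      proof -
        have "x \<in> {a..a + real n * h}" "?u \<in> {a..a + real n * h}" "?v \<in> {a..a + real n * h}"
          "\<bar>x - ?u\<bar> \<le> h" "\<bar>x - ?v\<bar> \<le> h"
          using False x au uv le_n h unfolding atLeastAtMost_iff abs_le_iff by linarith+
        then show ?thesis using l by (intro add_mono mult_left_mono osc) auto
      qed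
      finally show ?thesis by (simp add: algebra_simps)
    qed
    moreover have "P (Suc k) x = g ?v" if x: "x \<ge> ?v" for x
    proof -
      have "min x ?v - min x ?u = h" using x step[of k] uv by (simp add: min_def)
      then show ?thesis using IH(2)[of x] x step[of k] h by (simp add: P_Suc)
    qed
    ultimately show ?case by blast
  qed
  show "P k x = g a" if "x \<le> a"
  proof -
    have "min x (a + real i * h) = x" for i
      using that mult_nonneg_nonneg[of "real i" h] h by (intro min_absorb1) linarith
    then show ?thesis unfolding P_def by (simp only: diff_self mult_zero_right sum.neutral_const add_0_right)
  qed
qed

lemma uniform_mesh:
  fixes g :: "real \<Rightarrow> real"
  assumes ab: "a < b" and g: "continuous_on {a..b} g" and e: "e > 0"
  obtains n :: nat and h where "h > 0" "a + real n * h = b"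
    "\<And>x y. x \<in> {a..a + real n * h} \<Longrightarrow> y \<in> {a..a + real n * h} \<Longrightarrow> \<bar>x - y\<bar> \<le> h \<Longrightarrow> \<bar>g x - g y\<bar> \<le> e"
proof -
  have "uniformly_continuous_on {a..b} g" using g compact_uniformly_continuous by blast
  then obtain d where d: "d > 0" "\<And>x y. x \<in> {a..b} \<Longrightarrow> y \<in> {a..b} \<Longrightarrow> dist y x < d \<Longrightarrow> dist (g y) (g x) < e"
    unfolding uniformly_continuous_on_def using e by metis
  obtain n where n: "(b - a) / d < real n" using reals_Archimedean2 by blast
  then have n0: "real n > 0" using ab d by (metis divide_pos_pos diff_gt_0_iff_gt less_trans)
  define h where "h = (b - a) / real n"
  have "h < d" using n n0 d by (simp add: h_def field_simps)
  moreover have "h > 0" using ab n0 by (simp add: h_def)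
  moreover have "a + real n * h = b" using n0 by (simp add: h_def)
  ultimately show ?thesis
    using d(2) by (intro that[of h n]) (force simp: dist_real_def abs_minus_commute intro!: less_imp_le)+
qed

text \<open>Real polynomials in Re w and Im w, sorted by angular Fourier mode: each generator is one
  mode times a radial factor. The even power of |w| is what products of modes produce.\<close>

inductive radial_poly :: "(complex \<Rightarrow> real) \<Rightarrow> bool" where
  base: "radial_poly (\<lambda>w. cmod w ^ (2 * j) * Re (c * w ^ m))"
| add: "radial_poly f \<Longrightarrow> radial_poly g \<Longrightarrow> radial_poly (\<lambda>w. f w + g w)"

text \<open>Re x Re y is half of Re(x y) + Re(cnj x y), and for m \<le> n the second product
  contains cnj(w^m) w^n = |w|^(2 m) w^(n - m).\<close>

lemma radial_poly_mult_base:
  "radial_poly (\<lambda>w. (cmod w ^ (2 * j) * Re (c * w ^ m)) * (cmod w ^ (2 * k) * Re (d * w ^ n)))"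
proof (induction m n arbitrary: c d j k rule: linorder_wlog)
  case (le m n)
  have "(cmod w ^ (2 * j) * Re (c * w ^ m)) * (cmod w ^ (2 * k) * Re (d * w ^ n)) =
     cmod w ^ (2 * (j + k)) * Re (c * d / 2 * w ^ (m + n)) +
     cmod w ^ (2 * (j + k + m)) * Re (cnj c * d / 2 * w ^ (n - m))" for w
  proof -
    have prod: "Re x * Re y = Re (x * y / 2) + Re (cnj x * y / 2)" for x y
      by (simp add: field_simps)
    have "cnj (w ^ m) * w ^ n = (cnj w * w) ^ m * w ^ (n - m)"
      using le by (simp add: power_mult_distrib power_add[symmetric] mult.assoc)
    also have "\<dots> = of_real (cmod w ^ (2 * m)) * w ^ (n - m)"
      using complex_norm_square[of w] by (simp add: power_mult mult.commute[of w])
    finally have "cnj (c * w ^ m) * (d * w ^ n) / 2 = of_real (cmod w ^ (2 * m)) * (cnj c * d / 2 * w ^ (n - m))"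
      by (simp add: mult_ac)
    then have "Re (cnj (c * w ^ m) * (d * w ^ n) / 2) = cmod w ^ (2 * m) * Re (cnj c * d / 2 * w ^ (n - m))"
      by (simp only: Re_complex_of_real times_complex.sel Im_complex_of_real mult_zero_left diff_zero)
    moreover have "c * w ^ m * (d * w ^ n) / 2 = c * d / 2 * w ^ (m + n)" by (simp add: power_add mult_ac)
    ultimately have eq: "Re (c * w ^ m) * Re (d * w ^ n) =
        Re (c * d / 2 * w ^ (m + n)) + cmod w ^ (2 * m) * Re (cnj c * d / 2 * w ^ (n - m))"
      using prod[of "c * w ^ m" "d * w ^ n"] by (simp only:)
    have gen: "(p * x) * (q * y) = (p * q) * u + (p * q * l) * v" if "x * y = u + l * v"
      for p q x y u v l :: real
    proof -
      have "(p * x) * (q * y) = (p * q) * (x * y)" by (simp add: mult_ac)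
      then show ?thesis by (simp only: that distrib_left mult.assoc)
    qed
    show ?thesis
      using gen[OF eq, of "cmod w ^ (2 * j)" "cmod w ^ (2 * k)"] by (simp only: power_add distrib_left)
  qed
  then show ?case by (simp only:) (intro radial_poly.intros)
next
  case (sym m n)
  then show ?case by (subst mult.commute)
qed

lemma radial_poly_mult:
  assumes "radial_poly f" "radial_poly g"
  shows "radial_poly (\<lambda>w. f w * g w)"
  using assms(1)
proof induction
  case (base j c m)
  show ?case
    using assms(2)
  proof induction
    case (base k d n)
    show ?case by (rule radial_poly_mult_base)
  next
    case (add f g)
    from radial_poly.add[OF add.IH] show ?case by (simp only: distrib_left)
  qed
next
  case (add f g)
  from radial_poly.add[OF add.IH] show ?case by (simp only: distrib_right)
qed

lemma real_polynomial_imp_radial_poly: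
  assumes "real_polynomial_function f"
  shows "radial_poly f"
  using assms
proof induction
  case (linear f)
  interpret bounded_linear f by fact
  \<comment> \<open>A real-linear functional on the plane has the form Re(a w) with a = f 1 - i
    f(i).\<close>
  have eq: "f w = cmod w ^ (2 * 0) * Re ((of_real (f 1) - \<i> * of_real (f \<i>)) * w ^ 1)" for w
  proof -
    have "f w = f (Re w *\<^sub>R 1 + Im w *\<^sub>R \<i>)" by (metis complex_eq scaleR_conv_of_real mult.commute mult.right_neutral)
    also have "\<dots> = Re w * f 1 + Im w * f \<i>" by (simp only: add scaleR) simp
    finally show ?thesis by simp
  qed
  show ?case
    using radial_poly.base[of 0 "of_real (f 1) - \<i> * of_real (f \<i>)" 1] unfolding eq[symmetric] .
next
  case (const c)
  show ?case using radial_poly.base[of 0 "of_real c" 0] by simp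
next
  case (add f g)
  then show ?case by (intro radial_poly.add)
next
  case (mult f g)
  then show ?case by (intro radial_poly_mult)
qed

text \<open>Closure properties that force a class to contain all compactly supported continuous
  functions. \<open>V_log\<close> is the difference of two logarithmic means, and the function
  raised to the power m in \<open>V_moment\<close> is r times \<open>reflect r w\<close>. To be
  instantiated with the functions whose normalized zero sums converge.\<close>

locale test_class =
  fixes V :: "(complex \<Rightarrow> real) \<Rightarrow> bool"
  assumes V_add: "V f \<Longrightarrow> V g \<Longrightarrow> V (\<lambda>w. f w + g w)"
    and V_scale: "V f \<Longrightarrow> V (\<lambda>w. c * f w)"
    and V_closed: "continuous_on UNIV f \<Longrightarrow> (\<And>e. e > 0 \<Longrightarrow> \<exists>g. V g \<and> (\<forall>w. \<bar>f w - g w\<bar> \<le> e)) \<Longrightarrow> V f"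
    and V_log: "0 < r \<Longrightarrow> r < R \<Longrightarrow> V (\<lambda>w. ln (max R (cmod w)) - ln (max r (cmod w)))"
    and V_moment: "0 < r \<Longrightarrow> 0 < m \<Longrightarrow>
      V (\<lambda>w. Re ((u::complex) * (if cmod w \<le> r then cnj w / of_real r else of_real r / w) ^ m))"
begin

lemma V_zero: "V (\<lambda>w. 0)"
  using V_scale[OF V_log[of 1 2], of 0] by simp

lemma V_sum: "finite I \<Longrightarrow> (\<And>i. i \<in> I \<Longrightarrow> V (f i)) \<Longrightarrow> V (\<lambda>w. \<Sum>i\<in>I. f i w)"
  by (induction I rule: finite_induct) (auto intro: V_zero V_add)

text \<open>In the variable ln |w| the functions of \<open>V_log\<close> are ramps up to a constant,
  so piecewise linear interpolation on [ln r, ln R] stays in V. Below r the interpolant has the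
  constant value G r, close to G by continuity at 0; beyond R both vanish.\<close>

lemma V_radial:
  assumes G: "continuous_on {0..} G" and R: "R > 0" and G0: "\<And>x. x \<ge> R \<Longrightarrow> G x = 0"
  shows "V (\<lambda>w. G (cmod w))"
proof (rule V_closed)
  show "continuous_on UNIV (\<lambda>w. G (cmod w))"
    by (intro continuous_on_compose2[OF G]) (auto intro: continuous_intros)
  fix e :: real assume e: "e > 0"
  have "\<exists>d>0. \<forall>x\<in>{0..}. dist x 0 < d \<longrightarrow> dist (G x) (G 0) < e / 2"
    using G e unfolding continuous_on_iff by (metis atLeast_iff order_refl half_gt_zero)
  then obtain d where d: "d > 0" "\<And>x. 0 \<le> x \<Longrightarrow> x < d \<Longrightarrow> \<bar>G x - G 0\<bar> < e / 2"
    by (auto simp: dist_real_def)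
  define r where "r = min d R / 2"
  have r: "0 < r" "r < d" "r < R" using d R by (auto simp: r_def min_def)
  define a where "a = ln r"
  define b where "b = ln R"
  have ab: "a < b" using r by (simp add: a_def b_def)
  define g where "g x = G (exp x)" for x
  have gc: "continuous_on {a..b} g"
    unfolding g_def by (intro continuous_on_compose2[OF G]) (auto intro: continuous_intros)
  have e2: "e / 2 > 0" using e by simp
  obtain n h where h: "h > 0" "a + real n * h = b"
    and osc: "\<And>x y. x \<in> {a..a + real n * h} \<Longrightarrow> y \<in> {a..a + real n * h} \<Longrightarrow> \<bar>x - y\<bar> \<le> h \<Longrightarrow> \<bar>g x - g y\<bar> \<le> e / 2"
    by (rule uniform_mesh[OF ab gc e2]) blast
  define X where "X i = a + real i * h" for i
  define s where "s i = (g (X (Suc i)) - g (X i)) / h" for i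
  define P where "P x = g a + (\<Sum>i<n. s i * (min x (X (Suc i)) - min x (X i)))" for x
  note pl = piecewise_linear_approx[of h a n g "e / 2", OF h(1) osc, folded X_def, folded s_def, where k = n, folded P_def]
  have P1: "\<bar>g x - P x\<bar> \<le> e / 2" if "x \<in> {a..b}" for x using pl(1) that h(2) by (simp add: X_def)
  have P2: "P x = g b" if "x \<ge> b" for x using pl(1) that h(2) by (simp add: X_def)
  have gb: "g b = 0" using G0[of R] R by (simp add: g_def b_def)
  have ga: "g a = G r" using r by (simp add: g_def a_def)
  define Q where "Q w = (\<Sum>i<n. (- s i) * (ln (max (exp (X (Suc i))) (cmod w)) - ln (max (exp (X i)) (cmod w))))" for w :: complex
  have "V Q"
    unfolding Q_def using h by (intro V_sum V_scale V_log) (auto simp: X_def ring_distribs)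
  \<comment> \<open>The increments cancel the initial value g a because g vanishes at b. This is why
    Q, which has no constant term, agrees with P: constants are not among the generators.\<close>
  have total: "g a + (\<Sum>i<n. s i * h) = 0"
  proof -
    have "P b = g a + (\<Sum>i<n. s i * h)"
      unfolding P_def
    proof (intro arg_cong2[where f = "(+)"] refl sum.cong)
      fix i assume "i \<in> {..<n}"
      then have "real (Suc i) * h \<le> real n * h" using h by (intro mult_right_mono) auto
      then have "X (Suc i) \<le> b" "X i \<le> X (Suc i)" "X (Suc i) - X i = h"
        using h by (auto simp: X_def ring_distribs)
      then show "s i * (min b (X (Suc i)) - min b (X i)) = s i * h" by (simp add: min_def)
    qed
    then show ?thesis using P2[of b] gb by simp
  qed
  have Q0: "Q w = G r" if "cmod w \<le> r" for w
  proof -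
    have "ln (max (exp (X i)) (cmod w)) = X i" for i
    proof -
      have "r \<le> exp (X i)" using h r by (metis X_def a_def exp_le_cancel_iff exp_ln le_add_same_cancel1 mult_nonneg_nonneg of_nat_0_le_iff less_imp_le)
      then have "max (exp (X i)) (cmod w) = exp (X i)" using that by (intro max_absorb1) linarith
      then show ?thesis by simp
    qed
    moreover have "X (Suc i) - X i = h" for i by (simp add: X_def ring_distribs)
    ultimately have "Q w = (\<Sum>i<n. - s i * h)" unfolding Q_def by (simp only:)
    then have "Q w = - (\<Sum>i<n. s i * h)" by (simp add: sum_negf)
    then show ?thesis using total ga by simp
  qed
  have Q1: "Q w = P (ln (cmod w))" if "w \<noteq> 0" for w
  proof -
    have l: "ln (max (exp (X i)) (cmod w)) = X i + ln (cmod w) - min (ln (cmod w)) (X i)" for i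
    proof (cases "exp (X i) \<le> cmod w")
      case True
      then have "X i \<le> ln (cmod w)" using that by (simp add: ln_ge_iff)
      then show ?thesis using True by (simp add: max_def min_def)
    next
      case False
      then have "ln (cmod w) \<le> X i" using that ln_mono[of "cmod w" "exp (X i)"] by simp
      then show ?thesis using False by (simp add: max_def min_def)
    qed
    have "Q w = (\<Sum>i<n. s i * (min (ln (cmod w)) (X (Suc i)) - min (ln (cmod w)) (X i)) - s i * h)"
      unfolding Q_def l by (intro sum.cong refl) (simp add: X_def algebra_simps)
    also have "\<dots> = P (ln (cmod w))"
      using total by (simp add: P_def sum_subtractf)
    finally show ?thesis .
  qed
  have "\<bar>G (cmod w) - Q w\<bar> \<le> e" for w
  proof -
    consider "cmod w \<le> r" | "r < cmod w" "cmod w \<le> R" | "R < cmod w" by linarith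
    then show ?thesis
    proof cases
      case 1
      then have "\<bar>G (cmod w) - G 0\<bar> < e / 2" "\<bar>G r - G 0\<bar> < e / 2" using d(2) r by auto
      then show ?thesis unfolding Q0[OF 1] by linarith
    next
      case 2
      then have w: "w \<noteq> 0" using r by auto
      have "ln (cmod w) \<in> {a..b}"
        unfolding a_def b_def using 2 r w by (simp add: ln_mono)
      from P1[OF this] show ?thesis using Q1[OF w] w e by (simp add: g_def)
    next
      case 3
      then have w: "w \<noteq> 0" using R by auto
      have "b \<le> ln (cmod w)" using 3 R by (simp add: b_def ln_mono)
      from P2[OF this] show ?thesis using Q1[OF w] gb G0[of "cmod w"] 3 e by simp
    qed
  qed
  then show "\<exists>g. V g \<and> (\<forall>w. \<bar>G (cmod w) - g w\<bar> \<le> e)" using \<open>V Q\<close> by blast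
qed

text \<open>With r^(2 m) = Y and 1 / w = cnj w / |w|^2, both branches of \<open>V_moment\<close>,
  multiplied by r^m, become cnj w^m times min(1, Y / |w|^(2 m)). At w = 0 both sides are 0.\<close>

lemma V_moment_min:
  assumes m: "m > 0" and Y: "Y > 0"
  shows "V (\<lambda>w. Re (c * cnj w ^ m) * (min (cmod w ^ (2 * m)) Y / cmod w ^ (2 * m)))"
proof -
  define r where "r = root (2 * m) Y"
  have r: "r > 0" "r ^ (2 * m) = Y" using m Y by (auto simp: r_def)
  have "r ^ m * Re (c * (if cmod w \<le> r then cnj w / of_real r else of_real r / w) ^ m) =
      Re (c * cnj w ^ m) * (min (cmod w ^ (2 * m)) Y / cmod w ^ (2 * m))" for w
  proof (cases "cmod w \<le> r")
    case True
    then have le: "cmod w ^ (2 * m) \<le> Y" unfolding r(2)[symmetric] by (intro power_mono) auto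
    have "c * (cnj w / of_real r) ^ m = of_real (1 / r ^ m) * (c * cnj w ^ m)"
      by (simp add: power_divide)
    then have "Re (c * (cnj w / of_real r) ^ m) = 1 / r ^ m * Re (c * cnj w ^ m)"
      by (simp only: Re_complex_of_real times_complex.sel Im_complex_of_real mult_zero_left diff_zero)
    then show ?thesis using True le r m by (cases "w = 0") (auto simp: min_def)
  next
    case False
    then have w: "w \<noteq> 0" using r by auto
    have le: "Y \<le> cmod w ^ (2 * m)" unfolding r(2)[symmetric] using False r by (intro power_mono) auto
    have "of_real (cmod w ^ (2 * m)) = w ^ m * cnj w ^ m"
      using complex_norm_square[of w] by (simp add: power_mult power_mult_distrib)
    then have "c * (of_real r / w) ^ m = of_real (r ^ m / cmod w ^ (2 * m)) * (c * cnj w ^ m)"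
      using w by (simp add: power_divide field_simps)
    then have "Re (c * (of_real r / w) ^ m) = r ^ m / cmod w ^ (2 * m) * Re (c * cnj w ^ m)"
      by (simp only: Re_complex_of_real times_complex.sel Im_complex_of_real mult_zero_left diff_zero)
    then have "r ^ m * Re (c * (of_real r / w) ^ m) = r ^ (2 * m) / cmod w ^ (2 * m) * Re (c * cnj w ^ m)"
      by (simp add: power_mult power2_eq_square mult_2 power_add)
    then show ?thesis using False le r by (simp add: min_def mult.commute)
  qed
  then show ?thesis using V_scale[OF V_moment[OF r(1) m, of c], of "r ^ m"] by simp
qed

text \<open>With y = |w|^(2 m), differences of the functions of \<open>V_moment_min\<close> are Re(c
  w^m) times a ramp in y divided by y. It remains to find a piecewise linear P with P(y) / y close
  to G; the factor 1 / y is dangerous only for small y, where |w|^m = sqrt y is small as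
  well.\<close>

lemma V_angular:
  assumes G: "continuous_on {0..} G" and R: "R > 0" and G0: "\<And>x. x \<ge> R \<Longrightarrow> G x = 0" and m: "m > 0"
  shows "V (\<lambda>w. G (cmod w) * Re (c * w ^ m))"
proof (rule V_closed)
  show "continuous_on UNIV (\<lambda>w. G (cmod w) * Re (c * w ^ m))"
    by (intro continuous_intros continuous_on_compose2[OF G]) auto
  fix e :: real assume e: "e > 0"
  have "compact (G ` {0..R})"
    by (intro compact_continuous_image continuous_on_subset[OF G]) auto
  then obtain K where K: "\<And>x. x \<in> {0..R} \<Longrightarrow> \<bar>G x\<bar> \<le> K"
    by (metis bounded_iff compact_imp_bounded image_eqI real_norm_def)
  have K0: "K \<ge> 0" using K[of 0] R by force
  have K: "\<bar>G x\<bar> \<le> K" if "x \<ge> 0" for x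
    using K[of x] G0[of x] that K0 by (cases "x \<le> R") auto
  define C where "C = (K + 1) * (cmod c + 1)"
  have C: "C > 0" using K0 by (auto simp: C_def intro!: mult_pos_pos add_nonneg_pos)
  define B where "B = R ^ (2 * m)"
  have B: "B > 0" using R by (simp add: B_def)
  \<comment> \<open>\<alpha> is sqrt A: the first bound makes the error C \<alpha> from small y at
    most e / 2, the second keeps A below B.\<close>
  define \<alpha> where "\<alpha> = min (e / (2 * C)) (sqrt B / 2)"
  define A where "A = \<alpha>\<^sup>2"
  have \<alpha>: "\<alpha> > 0" using e C B by (simp add: \<alpha>_def)
  have A: "A > 0" "sqrt A = \<alpha>" using \<alpha> by (auto simp: A_def)
  have "sqrt B / 2 < sqrt B" using B by simp
  then have "\<alpha> < sqrt B" unfolding \<alpha>_def by linarith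
  then have AB: "A < B" using A by (metis real_sqrt_less_iff)
  have C\<alpha>: "C * \<alpha> \<le> e / 2"
    using mult_left_mono[of \<alpha> "e / (2 * C)" C] C by (simp add: \<alpha>_def)
  \<comment> \<open>The interpolant has to vanish below A, since a sum of ramps has no constant
    term. Hence y - A instead of y; the change contributes G A / y, which is controlled by C
    \<alpha>.\<close>
  define H where "H y = G (root (2 * m) y) * (y - A)" for y
  have Hc: "continuous_on {A..B} H"
    unfolding H_def using A m
    by (intro continuous_intros continuous_on_compose2[OF G]) (auto intro: real_root_ge_zero)
  \<comment> \<open>An interpolation error e' gets multiplied by |Re(c w^m)| / y, at most (|c| + 1)
    / \<alpha> for y \<ge> A; the product is e / 2.\<close>
  define e' where "e' = e * \<alpha> / (2 * (cmod c + 1))"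
  have e': "e' > 0" using e \<alpha> by (auto simp: e'_def intro!: divide_pos_pos add_nonneg_pos)
  obtain n h where h: "h > 0" "A + real n * h = B"
    and osc: "\<And>x y. x \<in> {A..A + real n * h} \<Longrightarrow> y \<in> {A..A + real n * h} \<Longrightarrow> \<bar>x - y\<bar> \<le> h \<Longrightarrow> \<bar>H x - H y\<bar> \<le> e'"
    by (rule uniform_mesh[OF AB Hc e']) blast
  define X where "X i = A + real i * h" for i
  define s where "s i = (H (X (Suc i)) - H (X i)) / h" for i
  define P where "P x = H A + (\<Sum>i<n. s i * (min x (X (Suc i)) - min x (X i)))" for x
  note pl = piecewise_linear_approx[of h A n H e', OF h(1) osc, folded X_def, folded s_def, where k = n, folded P_def]
  have P1: "\<bar>H x - P x\<bar> \<le> e'" if "x \<in> {A..B}" for x using pl(1) that h(2) by (simp add: X_def)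
  have HB: "H B = 0" using G0[of R] R m by (simp add: H_def B_def real_root_power_cancel)
  have HA: "H A = 0" by (simp add: H_def)
  have P2: "P x = 0" if "x \<ge> B" for x using pl(1) that h(2) HB by (simp add: X_def)
  have P3: "P x = 0" if "x \<le> A" for x using pl(2) that HA by simp
  define Q where "Q w = Re (cnj c * cnj w ^ m) * (P (cmod w ^ (2 * m)) / cmod w ^ (2 * m))" for w
  have Xpos: "X i > 0" for i using A h by (simp add: X_def add_pos_nonneg)
  have "V (\<lambda>w. \<Sum>i<n. s i * (Re (cnj c * cnj w ^ m) * (min (cmod w ^ (2 * m)) (X (Suc i)) / cmod w ^ (2 * m)) +
      (- 1) * (Re (cnj c * cnj w ^ m) * (min (cmod w ^ (2 * m)) (X i) / cmod w ^ (2 * m)))))"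
    by (intro V_sum V_scale V_add V_moment_min m Xpos) auto
  also have "(\<lambda>w. \<Sum>i<n. s i * (Re (cnj c * cnj w ^ m) * (min (cmod w ^ (2 * m)) (X (Suc i)) / cmod w ^ (2 * m)) +
      (- 1) * (Re (cnj c * cnj w ^ m) * (min (cmod w ^ (2 * m)) (X i) / cmod w ^ (2 * m))))) = Q"
  proof -
    have "s' * (R' * (u / y) + (- 1) * (R' * (v / y))) = R' * (s' * (u - v) / y)" for s' R' u v y :: real
      by (simp add: algebra_simps diff_divide_distrib)
    then show ?thesis
      unfolding Q_def P_def HA by (simp only: sum_distrib_left[symmetric] sum_divide_distrib[symmetric] add_0_left)
  qed
  finally have "V Q" .
  have Re_c: "Re (cnj c * cnj w ^ m) = Re (c * w ^ m)" for w
    by (metis complex_cnj_mult complex_cnj_power complex.sel(1) cnj.sel(1))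
  have Re_le: "\<bar>Re (c * w ^ m)\<bar> \<le> (cmod c + 1) * sqrt (cmod w ^ (2 * m))" for w
  proof -
    have "sqrt (cmod w ^ (2 * m)) = cmod w ^ m" by (simp add: power_mult power_even_eq real_sqrt_power)
    moreover have "\<bar>Re (c * w ^ m)\<bar> \<le> cmod c * cmod w ^ m"
      using abs_Re_le_cmod[of "c * w ^ m"] by (simp add: norm_mult norm_power)
    moreover have "cmod c * cmod w ^ m \<le> (cmod c + 1) * cmod w ^ m" by (intro mult_right_mono) auto
    ultimately show ?thesis by simp
  qed
  have "\<bar>G (cmod w) * Re (c * w ^ m) - Q w\<bar> \<le> e" for w
  proof -
    define y where "y = cmod w ^ (2 * m)"
    have y0: "y \<ge> 0" by (simp add: y_def)
    have Gy: "G (root (2 * m) y) = G (cmod w)" using m by (simp add: y_def real_root_power_cancel)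
    have GK: "\<bar>G (cmod w)\<bar> * (cmod c + 1) \<le> C"
      unfolding C_def using K[of "cmod w"] by (intro mult_right_mono) auto
    consider "y < A" | "A \<le> y" "y \<le> B" | "B < y" by linarith
    then show ?thesis
    proof cases
      case 1
      then have "Q w = 0" using P3[of y] by (simp add: Q_def y_def)
      moreover have "\<bar>G (cmod w) * Re (c * w ^ m)\<bar> \<le> \<bar>G (cmod w)\<bar> * ((cmod c + 1) * sqrt y)"
        unfolding abs_mult y_def by (intro mult_left_mono Re_le) auto
      moreover have "\<dots> \<le> C * \<alpha>"
        unfolding mult.assoc[symmetric] using 1 A C y0 real_sqrt_le_mono[of y A]
        by (intro mult_mono GK) auto
      ultimately show ?thesis using C\<alpha> e by linarith
    next
      case 2
      then have y: "y > 0" using A by linarith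
      have sq: "sqrt y / y = 1 / sqrt y" using y by (simp add: field_simps)
      have "G (cmod w) * Re (c * w ^ m) - Q w =
          G (cmod w) * Re (c * w ^ m) * (A / y) + Re (c * w ^ m) / y * (H y - P y)"
        unfolding Q_def Re_c y_def[symmetric] H_def Gy using y by (simp add: field_simps)
      moreover have "\<bar>G (cmod w) * Re (c * w ^ m) * (A / y)\<bar> \<le> C * \<alpha>"
      proof -
        have "\<bar>G (cmod w) * Re (c * w ^ m) * (A / y)\<bar> \<le> \<bar>G (cmod w)\<bar> * ((cmod c + 1) * sqrt y) * (A / y)"
          unfolding abs_mult using y A Re_le[of w]
          by (intro mult_mono mult_left_mono) (auto simp: y_def)
        also have "\<dots> = \<bar>G (cmod w)\<bar> * (cmod c + 1) * A * (sqrt y / y)" by simp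
        also have "\<dots> = \<bar>G (cmod w)\<bar> * (cmod c + 1) * (A / sqrt y)" unfolding sq by simp
        also have "\<dots> \<le> C * \<alpha>"
        proof (intro mult_mono GK)
          have "A / sqrt y \<le> A / sqrt A" using 2 A y by (intro divide_left_mono) auto
          also have "\<dots> = \<alpha>" using A real_div_sqrt[of A] by simp
          finally show "A / sqrt y \<le> \<alpha>" .
        qed (use C A y in auto)
        finally show ?thesis .
      qed
      moreover have "\<bar>Re (c * w ^ m) / y * (H y - P y)\<bar> \<le> e / 2"
      proof -
        have "\<bar>Re (c * w ^ m) / y * (H y - P y)\<bar> \<le> ((cmod c + 1) * sqrt y / y) * e'"
          unfolding abs_mult abs_divide abs_of_pos[OF y]
          by (intro mult_mono divide_right_mono Re_le[of w, folded y_def] P1) (use y 2 in auto)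
        also have "(cmod c + 1) * sqrt y / y = (cmod c + 1) * (sqrt y / y)" by simp
        also have "\<dots> = (cmod c + 1) / sqrt y" unfolding sq by simp
        also have "\<dots> * e' \<le> (cmod c + 1) / \<alpha> * e'"
          using 2 A \<alpha> e' real_sqrt_le_mono[of A y] by (intro mult_right_mono divide_left_mono) auto
        also have "\<dots> = e / 2"
        proof -
          have "u / \<alpha> * (e * \<alpha> / (2 * u)) = e / 2" if "u \<noteq> 0" for u :: real
            using that \<alpha> by simp
          moreover have "cmod c + 1 \<noteq> 0" using norm_ge_zero[of c] by linarith
          ultimately show ?thesis unfolding e'_def by blast
        qed
        finally show ?thesis .
      qed
      moreover have "\<bar>x\<bar> \<le> u + v" if "x = y + z" "\<bar>y\<bar> \<le> u" "\<bar>z\<bar> \<le> v" for x y z u v :: real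
        using that by linarith
      ultimately have "\<bar>G (cmod w) * Re (c * w ^ m) - Q w\<bar> \<le> C * \<alpha> + e / 2" by blast
      then show ?thesis using C\<alpha> by linarith
    next
      case 3
      then have "Q w = 0" using P2[of y] by (simp add: Q_def y_def)
      moreover have "R \<le> cmod w"
      proof (rule ccontr)
        assume "\<not> R \<le> cmod w"
        then have "y \<le> B" unfolding B_def y_def by (intro power_mono) auto
        then show False using 3 by simp
      qed
      ultimately show ?thesis using G0 e by simp
    qed
  qed
  then show "\<exists>g. V g \<and> (\<forall>w. \<bar>G (cmod w) * Re (c * w ^ m) - g w\<bar> \<le> e)" using \<open>V Q\<close> by blast
qed

lemma V_radial_poly:
  assumes "radial_poly f" and G: "continuous_on {0..} G" and R: "R > 0" and G0: "\<And>x. x \<ge> R \<Longrightarrow> G x = 0"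
  shows "V (\<lambda>w. G (cmod w) * f w)"
  using assms(1)
proof induction
  case (base j c m)
  define G' where "G' x = G x * x ^ (2 * j)" for x
  have G': "continuous_on {0..} G'" "\<And>x. x \<ge> R \<Longrightarrow> G' x = 0"
    unfolding G'_def by (auto intro!: continuous_intros G simp: G0)
  show ?case
  proof (cases "m = 0")
    case True
    show ?thesis using V_scale[OF V_radial[OF G'(1) R G'(2)], of "Re c"] True
      by (simp add: G'_def mult_ac)
  next
    case False
    then show ?thesis using V_angular[OF G'(1) R G'(2), of m c] by (simp add: G'_def mult_ac)
  qed
next
  case (add f g)
  then show ?case by (simp add: distrib_left V_add)
qed

lemma V_compact_support:
  assumes \<phi>: "continuous_on UNIV \<phi>" and \<rho>: "\<rho> > 0" and supp: "\<And>w. cmod w \<ge> \<rho> \<Longrightarrow> \<phi> w = 0"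
  shows "V \<phi>"
proof (rule V_closed[OF \<phi>])
  fix e :: real assume e: "e > 0"
  obtain p where p: "real_polynomial_function p" "\<And>w. w \<in> cball 0 (\<rho> + 1) \<Longrightarrow> \<bar>\<phi> w - p w\<bar> < e"
    by (rule Stone_Weierstrass_real_polynomial_function[OF compact_cball[of 0 "\<rho> + 1"] continuous_on_subset[OF \<phi>] e]) auto
  \<comment> \<open>A cutoff equal to 1 on the disk of radius \<rho>, outside which \<phi> vanishes,
    and 0 from \<rho> + 1 on. Being radial, it preserves the decomposition of p into Fourier
    modes.\<close>
  define G where "G x = max 0 (min 1 (\<rho> + 1 - x))" for x :: real
  have "V (\<lambda>w. G (cmod w) * p w)"
    using \<rho> by (intro V_radial_poly[OF real_polynomial_imp_radial_poly[OF p(1)], where R = "\<rho> + 1"])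
      (auto simp: G_def intro!: continuous_intros)
  moreover have "\<bar>\<phi> w - G (cmod w) * p w\<bar> \<le> e" for w
  proof (cases "cmod w \<le> \<rho> + 1")
    case True
    have "\<phi> w = G (cmod w) * \<phi> w"
      using supp[of w] by (cases "cmod w \<ge> \<rho>") (auto simp: G_def)
    then have "\<bar>\<phi> w - G (cmod w) * p w\<bar> = G (cmod w) * \<bar>\<phi> w - p w\<bar>"
      by (metis G_def abs_mult abs_of_nonneg max.cobounded1 right_diff_distrib)
    also have "\<dots> \<le> 1 * e" using p(2)[of w] True by (intro mult_mono) (auto simp: G_def)
    finally show ?thesis by simp
  next
    case False
    then show ?thesis using supp[of w] e by (simp add: G_def)
  qed
  ultimately show "\<exists>g. V g \<and> (\<forall>w. \<bar>\<phi> w - g w\<bar> \<le> e)" by blast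
qed

end

subsection \<open>Asymptotics of the random polynomials\<close>

text \<open>A pigeonhole argument over the candidates s + l (2 b / g), for l up to (card K)^2.
  Between two candidates the difference attached to a pair moves by at least 2 b, so each pair
  spoils at most one of them, and there are more candidates than pairs.\<close>

lemma lacunary_perturbation:
  fixes K :: "nat set" and \<alpha> :: "nat \<Rightarrow> real"
  assumes fin: "finite K" and g: "g > 0" and b: "b > 0"
    and sep: "\<And>i j. i \<in> K \<Longrightarrow> j \<in> K \<Longrightarrow> i \<noteq> j \<Longrightarrow> g \<le> \<bar>real i - real j\<bar>"
  shows "\<exists>s'\<ge>s. s' \<le> s + real ((card K)\<^sup>2) * (2 * b / g) \<and>
    (\<forall>i\<in>K. \<forall>j\<in>K. i \<noteq> j \<longrightarrow> b \<le> \<bar>(\<alpha> i + s' * real i) - (\<alpha> j + s' * real j)\<bar>)"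
proof -
  define x where "x l = s + real l * (2 * b / g)" for l :: nat
  define bad where "bad l ij \<longleftrightarrow> ij \<in> K \<times> K \<and> fst ij \<noteq> snd ij \<and>
      \<bar>(\<alpha> (fst ij) + x l * real (fst ij)) - (\<alpha> (snd ij) + x l * real (snd ij))\<bar> < b" for l ij
  have "\<exists>l\<le>(card K)\<^sup>2. \<forall>ij. \<not> bad l ij"
  proof (rule ccontr)
    assume "\<not> ?thesis"
    then obtain f where f: "\<And>l. l \<le> (card K)\<^sup>2 \<Longrightarrow> bad l (f l)" by metis
    have "inj_on f {..(card K)\<^sup>2}"
    proof (rule linorder_inj_onI)
      fix l l' :: nat assume l: "l < l'" "l \<in> {..(card K)\<^sup>2}" "l' \<in> {..(card K)\<^sup>2}"
      show "f l \<noteq> f l'"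
      proof
        assume eq: "f l = f l'"
        obtain i j where ij: "f l = (i, j)" by fastforce
        have 1: "bad l (i, j)" "bad l' (i, j)" using f[of l] f[of l'] l eq ij by auto
        define m where "m = real i - real j"
        have m: "g \<le> \<bar>m\<bar>" using 1 sep by (auto simp: bad_def m_def)
        define y where "y l = (\<alpha> i + x l * real i) - (\<alpha> j + x l * real j)" for l
        have "\<bar>y l\<bar> < b" "\<bar>y l'\<bar> < b" using 1 by (auto simp: bad_def y_def)
        moreover have "(x l' - x l) * m = y l' - y l" by (simp add: y_def m_def algebra_simps)
        ultimately have "\<bar>(x l' - x l) * m\<bar> < 2 * b" by linarith
        moreover have "\<bar>(x l' - x l) * m\<bar> \<ge> (2 * b / g) * g"
          unfolding abs_mult
        proof (intro mult_mono m)
          have "1 * (2 * b / g) \<le> real (l' - l) * (2 * b / g)"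
            using l b g by (intro mult_right_mono) auto
          also have "\<dots> = x l' - x l" using l by (simp only: x_def of_nat_diff[OF less_imp_le] left_diff_distrib)
          finally show "2 * b / g \<le> \<bar>x l' - x l\<bar>" by simp
        qed (use g b in auto)
        ultimately show False using g by simp
      qed
    qed (rule linear)
    moreover have "f ` {..(card K)\<^sup>2} \<subseteq> K \<times> K" using f unfolding bad_def by blast
    ultimately have "card {..(card K)\<^sup>2} \<le> card (K \<times> K)"
      using fin by (intro card_inj_on_le[of f]) auto
    then show False by (simp add: card_cartesian_product power2_eq_square)
  qed
  then obtain l where l: "l \<le> (card K)\<^sup>2" "\<And>ij. \<not> bad l ij" by blast
  show ?thesis
  proof (intro exI[of _ "x l"] conjI ballI impI)
    show "s \<le> x l" using b g by (simp add: x_def)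
    show "x l \<le> s + real ((card K)\<^sup>2) * (2 * b / g)"
      unfolding x_def using l(1) b g by (intro add_left_mono mult_right_mono of_nat_mono) auto
    show "b \<le> \<bar>(\<alpha> i + x l * real i) - (\<alpha> j + x l * real j)\<bar>" if "i \<in> K" "j \<in> K" "i \<noteq> j" for i j
      using l(2)[of "(i, j)"] that by (auto simp: bad_def not_less)
  qed
qed

section \<open>The Legendre transform and its near maximizers\<close>

locale legendre_setup =
  fixes p :: "real \<Rightarrow> real" and T0 :: real
  assumes p_nonneg: "\<And>t. 0 \<le> t \<Longrightarrow> 0 \<le> p t"
    and T0: "0 < T0"
    and p_pos: "\<And>t. 0 \<le> t \<Longrightarrow> t < T0 \<Longrightarrow> p t > 0"
    and p_zero: "\<And>t. t > T0 \<Longrightarrow> p t = 0"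
    and p_cont: "continuous_on {0..T0} p"
begin

abbreviation "I \<equiv> legendre_I p"

lemma pos_imp_le: "p t > 0 \<Longrightarrow> t \<le> T0"
  using p_zero[of t] by (cases "t \<le> T0") auto

lemma legendre_bdd: "bdd_above {s * t + ln (p t) | t. 0 \<le> t \<and> p t > 0}"
proof -
  have "compact (p ` {0..T0})" by (intro compact_continuous_image p_cont) auto
  then obtain P where P: "\<And>t. t \<in> {0..T0} \<Longrightarrow> \<bar>p t\<bar> \<le> P"
    by (metis bounded_iff compact_imp_bounded image_eqI real_norm_def)
  have "s * t + ln (p t) \<le> \<bar>s\<bar> * T0 + ln P" if t: "0 \<le> t" "p t > 0" for t
  proof -
    have tT: "t \<le> T0" using pos_imp_le t by blast
    have "s * t \<le> \<bar>s\<bar> * T0" using t tT by (intro mult_mono) auto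
    moreover have "ln (p t) \<le> ln P" using P[of t] t tT by (intro ln_mono) auto
    ultimately show ?thesis by simp
  qed
  then show ?thesis by (intro bdd_aboveI[where M = "\<bar>s\<bar> * T0 + ln P"]) auto
qed

lemma legendre_ge: "0 \<le> t \<Longrightarrow> p t > 0 \<Longrightarrow> s * t + ln (p t) \<le> I s"
  unfolding legendre_I_def by (intro cSup_upper[OF _ legendre_bdd]) auto

lemma legendre_le:
  assumes "\<And>t. 0 \<le> t \<Longrightarrow> t \<le> T0 \<Longrightarrow> p t > 0 \<Longrightarrow> s * t + ln (p t) \<le> C"
  shows "I s \<le> C"
  unfolding legendre_I_def
proof (rule cSup_least)
  show "{s * t + ln (p t) | t. 0 \<le> t \<and> p t > 0} \<noteq> {}" using p_pos[of 0] T0 by auto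
qed (use assms pos_imp_le in auto)

lemma legendre_exp_ge:
  assumes "0 \<le> t"
  shows "p t * exp (s * t) \<le> exp (I s)"
proof (cases "p t > 0")
  case True
  then have "p t * exp (s * t) = exp (s * t + ln (p t))" by (simp add: exp_add)
  also have "\<dots> \<le> exp (I s)" using legendre_ge[OF assms True] by simp
  finally show ?thesis .
next
  case False
  then have "p t = 0" using p_nonneg[OF assms] by simp
  then show ?thesis by simp
qed

text \<open>I is a supremum of affine functions of s with slopes t in [0, T0].\<close>

sublocale lipschitz_convex I T0
proof
  show "convex_on UNIV I"
  proof (rule convex_onI)
    fix u x y :: real assume u: "0 < u" "u < 1"
    show "I ((1 - u) *\<^sub>R x + u *\<^sub>R y) \<le> (1 - u) * I x + u * I y"
    proof (rule legendre_le)
      fix t assume t: "0 \<le> t" "p t > 0"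
      have "((1 - u) *\<^sub>R x + u *\<^sub>R y) * t + ln (p t) =
          (1 - u) * (x * t + ln (p t)) + u * (y * t + ln (p t))" by (simp add: algebra_simps)
      also have "\<dots> \<le> (1 - u) * I x + u * I y"
        using u t by (intro add_mono mult_left_mono legendre_ge) auto
      finally show "((1 - u) *\<^sub>R x + u *\<^sub>R y) * t + ln (p t) \<le> (1 - u) * I x + u * I y" .
    qed
  qed simp
next
  fix x y :: real assume xy: "x \<le> y"
  show "I x \<le> I y"
  proof (rule legendre_le)
    fix t assume t: "0 \<le> t" "p t > 0"
    have "x * t \<le> y * t" using xy t by (intro mult_right_mono)
    then show "x * t + ln (p t) \<le> I y" using legendre_ge[of t y] t by simp
  qed
  have "I y \<le> I x + T0 * (y - x)"
  proof (rule legendre_le)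
    fix t assume t: "0 \<le> t" "t \<le> T0" "p t > 0"
    have "(y - x) * t \<le> (y - x) * T0" using xy t by (intro mult_left_mono) auto
    then show "y * t + ln (p t) \<le> I x + T0 * (y - x)"
      using legendre_ge[of t x] t by (simp add: algebra_simps)
  qed
  then show "I y - I x \<le> T0 * (y - x)" by simp
qed

text \<open>Continuity up to T0 widens a near maximizer to a whole window, which provides room for
  many indices. The window stays strictly left of T0 because the degree may fall short of T0 L when
  \<delta> is positive.\<close>

lemma near_maximizer:
  assumes e: "e > 0"
  obtains t0 \<kappa> where "0 \<le> t0" "0 < \<kappa>" "t0 + \<kappa> < T0"
    "\<And>t. t0 \<le> t \<Longrightarrow> t \<le> t0 + \<kappa> \<Longrightarrow> exp (I s - e) \<le> p t * exp (s * t)"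
proof -
  have "\<exists>x\<in>{s * t + ln (p t) | t. 0 \<le> t \<and> p t > 0}. I s - e < x"
    unfolding legendre_I_def
  proof (rule less_cSupD)
    show "{s * t + ln (p t) | t. 0 \<le> t \<and> p t > 0} \<noteq> {}" using p_pos[of 0] T0 by auto
  qed (use e in \<open>auto simp: legendre_I_def\<close>)
  then obtain t where t: "0 \<le> t" "p t > 0" "I s - e < s * t + ln (p t)" by auto
  have tT: "t \<le> T0" using pos_imp_le t by blast
  have gt: "exp (I s - e) < p t * exp (s * t)"
  proof -
    have "exp (I s - e) < exp (s * t + ln (p t))" using t by simp
    also have "\<dots> = p t * exp (s * t)" using t by (simp add: exp_add)
    finally show ?thesis .
  qed
  have "continuous_on {0..T0} (\<lambda>t. p t * exp (s * t))" by (intro continuous_intros p_cont)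
  then have "\<exists>d>0. \<forall>u\<in>{0..T0}. dist u t < d \<longrightarrow>
      dist (p u * exp (s * u)) (p t * exp (s * t)) < p t * exp (s * t) - exp (I s - e)"
    unfolding continuous_on_iff using t tT gt by simp
  then obtain d where d: "d > 0" "\<And>u. u \<in> {0..T0} \<Longrightarrow> \<bar>u - t\<bar> < d \<Longrightarrow> exp (I s - e) \<le> p u * exp (s * u)"
    by (fastforce simp: dist_real_def abs_if split: if_splits)
  define w where "w = min d T0"
  have w: "w > 0" "w \<le> d" "w \<le> T0" using d T0 by (auto simp: w_def)
  \<comment> \<open>If t is too close to T0, the window is pushed to the left; its points remain
    within w / 2 < d of t.\<close>
  define t0 where "t0 = min t (T0 - w / 2)"
  show ?thesis
  proof (rule that[of t0 "w / 4"])
    show "0 \<le> t0" using t w by (simp add: t0_def)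
    show "0 < w / 4" using w by simp
    show "t0 + w / 4 < T0" using w by (simp add: t0_def min_def)
    fix u assume "t0 \<le> u" "u \<le> t0 + w / 4"
    then show "exp (I s - e) \<le> p u * exp (s * u)"
      using w t tT \<open>0 \<le> t0\<close> \<open>t0 + w / 4 < T0\<close> by (intro d(2)) (auto simp: t0_def min_def split: if_splits)
  qed
qed

end

section \<open>Coefficient bounds, tails and circle means of the random polynomials\<close>

locale random_polynomials = prob_space M + legendre_setup p T0
  for M :: "'a measure" and p :: "real \<Rightarrow> real" and T0 :: real +
  fixes \<xi> :: "nat \<Rightarrow> 'a \<Rightarrow> complex" and L :: "nat \<Rightarrow> nat" and \<delta> :: "nat \<Rightarrow> real"
    and pc :: "nat \<Rightarrow> nat \<Rightarrow> complex"
  assumes meas[measurable]: "\<And>k. \<xi> k \<in> borel_measurable M"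
    and indep: "indep_vars (\<lambda>_. borel) \<xi> UNIV"
    and ident: "\<And>k. distr M borel (\<xi> k) = distr M borel (\<xi> 0)"
    and nondeg: "\<not> (\<exists>c. AE \<omega> in M. \<xi> 0 \<omega> = c)"
    and logmom: "integrable M (\<lambda>\<omega>. ln (1 + cmod (\<xi> 0 \<omega>)))"
    and L_pos: "\<And>n. 0 < L n"
    and L_lim: "filterlim L at_top sequentially"
    and \<delta>_range: "\<And>n. - T0 < \<delta> n \<and> \<delta> n < T0"
    and \<delta>_lim: "\<delta> \<longlonglongrightarrow> 0"
    and coef: "(\<lambda>n. Max ((\<lambda>k. \<bar>cmod (pc k n) powr (1 / real (L n))
                     - p (min (real k / real (L n)) T0)\<bar>)
                   ` {0..nat \<lfloor>(T0 - \<delta> n) * real (L n)\<rfloor>})) \<longlonglongrightarrow> 0"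
begin

definition d :: "nat \<Rightarrow> nat" where "d n = nat \<lfloor>(T0 - \<delta> n) * real (L n)\<rfloor>"

definition F :: "nat \<Rightarrow> 'a \<Rightarrow> complex poly" where
  "F n \<omega> = (\<Sum>k\<le>d n. monom (\<xi> k \<omega> * pc k n) k)"

definition err :: "nat \<Rightarrow> real" where
  "err n = Max ((\<lambda>k. \<bar>cmod (pc k n) powr (1 / real (L n)) - p (min (real k / real (L n)) T0)\<bar>) ` {0..d n})"

lemma err_lim: "err \<longlonglongrightarrow> 0"
  using coef unfolding err_def d_def .

lemma err_bound:
  "k \<le> d n \<Longrightarrow> \<bar>cmod (pc k n) powr (1 / real (L n)) - p (min (real k / real (L n)) T0)\<bar> \<le> err n"
  unfolding err_def by (intro Max_ge) auto

lemma err_nonneg: "0 \<le> err n"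
  using err_bound[of 0 n] by linarith

lemma L_real_pos: "real (L n) > 0" using L_pos by simp

lemma L_real_lim: "filterlim (\<lambda>n. real (L n)) at_top sequentially"
  using filterlim_compose[OF filterlim_real_sequentially L_lim] .

lemma eventually_L_ge: "\<forall>\<^sub>F n in sequentially. C \<le> real (L n)"
  using L_real_lim unfolding filterlim_at_top by blast

lemma le_d_iff: "k \<le> d n \<longleftrightarrow> real k / real (L n) \<le> T0 - \<delta> n"
proof -
  have "0 \<le> (T0 - \<delta> n) * real (L n)" using \<delta>_range[of n] by simp
  then have "k \<le> d n \<longleftrightarrow> real k \<le> (T0 - \<delta> n) * real (L n)"
    unfolding d_def by (simp add: le_nat_iff le_floor_iff)
  then show ?thesis using L_real_pos[of n] by (simp add: pos_divide_le_eq)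
qed

lemma d_le: "real (d n) \<le> 2 * T0 * real (L n)"
proof -
  have "real (d n) / real (L n) \<le> T0 - \<delta> n" using le_d_iff by blast
  also have "\<dots> \<le> 2 * T0" using \<delta>_range[of n] by simp
  finally show ?thesis using L_real_pos[of n] by (simp add: pos_divide_le_eq)
qed

lemma degree_F: "degree (F n \<omega>) \<le> d n"
  unfolding F_def
  by (intro degree_sum_le) (auto intro: order_trans[OF degree_monom_le])

lemma degree_F_le: "real (degree (F n \<omega>)) \<le> 2 * T0 * real (L n)"
  using degree_F[of n \<omega>] d_le[of n] by linarith

lemma poly_F: "poly (F n \<omega>) z = (\<Sum>k\<le>d n. (pc k n * z ^ k) * \<xi> k \<omega>)"
  unfolding F_def by (simp add: poly_sum poly_monom mult_ac)

lemma cmod_powr_inverse_power: "(cmod x powr (1 / real (L n))) ^ L n = cmod x"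
  using L_pos[of n] by (cases "x = 0") (auto simp: powr_realpow[symmetric] powr_powr)

lemma exp_div_power: "exp (s * (real k / real (L n))) ^ L n = exp (s * real k)"
  using L_real_pos[of n] by (simp add: exp_of_nat_mult[symmetric])

text \<open>For negative \<delta> the ratio t = k / L can exceed T0, where the coefficient is
  compared with p(T0). The excess t - u is at most |\<delta>| and costs a factor tending to 1 in the
  L-th root.\<close>

lemma coef_upper:
  assumes e: "e > 0"
  shows "\<forall>\<^sub>F n in sequentially. \<forall>k\<le>d n. cmod (pc k n) * exp (s * real k) \<le> exp (real (L n) * (I s + e))"
proof -
  have "(\<lambda>n. exp (I s + \<bar>s\<bar> * \<bar>\<delta> n\<bar>) + err n * exp (\<bar>s\<bar> * (2 * T0))) \<longlonglongrightarrow>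
      exp (I s + \<bar>s\<bar> * \<bar>0\<bar>) + 0 * exp (\<bar>s\<bar> * (2 * T0))"
    by (intro tendsto_intros \<delta>_lim err_lim)
  then have "\<forall>\<^sub>F n in sequentially. exp (I s + \<bar>s\<bar> * \<bar>\<delta> n\<bar>) + err n * exp (\<bar>s\<bar> * (2 * T0)) < exp (I s + e)"
    by (rule order_tendstoD) (use e in simp)
  then show ?thesis
  proof eventually_elim
    case (elim n)
    show ?case
    proof (intro allI impI)
      fix k assume k: "k \<le> d n"
      define t where "t = real k / real (L n)"
      define u where "u = min t T0"
      have t: "0 \<le> t" "t \<le> T0 - \<delta> n" "t \<le> 2 * T0"
        using k le_d_iff[of k n] \<delta>_range[of n] by (auto simp: t_def)
      have u: "0 \<le> u" "t - u \<ge> 0" "t - u \<le> \<bar>\<delta> n\<bar>" using t T0 by (auto simp: u_def min_def)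
      have "cmod (pc k n) powr (1 / real (L n)) * exp (s * t) \<le> (p u + err n) * exp (s * t)"
        using err_bound[OF k] by (intro mult_right_mono) (auto simp: u_def t_def)
      also have "\<dots> = p u * exp (s * u) * exp (s * (t - u)) + err n * exp (s * t)"
        by (simp add: algebra_simps exp_diff)
      also have "\<dots> \<le> exp (I s) * exp (\<bar>s\<bar> * \<bar>\<delta> n\<bar>) + err n * exp (\<bar>s\<bar> * (2 * T0))"
      proof (intro add_mono mult_mono legendre_exp_ge u err_nonneg order_refl)
        have "s * (t - u) \<le> \<bar>s\<bar> * \<bar>\<delta> n\<bar>" using u by (intro mult_mono) auto
        then show "exp (s * (t - u)) \<le> exp (\<bar>s\<bar> * \<bar>\<delta> n\<bar>)" by simp
        have "s * t \<le> \<bar>s\<bar> * (2 * T0)" using t by (intro mult_mono) auto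
        then show "exp (s * t) \<le> exp (\<bar>s\<bar> * (2 * T0))" by simp
      qed auto
      also have "\<dots> < exp (I s + e)" using elim by (simp add: exp_add)
      finally have le: "cmod (pc k n) powr (1 / real (L n)) * exp (s * t) \<le> exp (I s + e)" by simp
      have "(cmod (pc k n) powr (1 / real (L n)) * exp (s * t)) ^ L n \<le> exp (I s + e) ^ L n"
        by (intro power_mono le) auto
      then show "cmod (pc k n) * exp (s * real k) \<le> exp (real (L n) * (I s + e))"
        unfolding power_mult_distrib cmod_powr_inverse_power t_def exp_div_power
        by (simp add: exp_of_nat_mult)
    qed
  qed
qed

text \<open>The window ends before T0, so \<delta> \<longlonglongrightarrow> 0 puts its indices
  within the degree. One e is lost to the near maximizer, the other to the error of the L-th
  roots.\<close>

lemma coef_lower: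
  assumes e: "e > 0" and t0: "0 \<le> t0" "0 < \<kappa>" "t0 + \<kappa> < T0"
    and near: "\<And>t. t0 \<le> t \<Longrightarrow> t \<le> t0 + \<kappa> \<Longrightarrow> exp (I s - e) \<le> p t * exp (s * t)"
  shows "\<forall>\<^sub>F n in sequentially. \<forall>k. t0 \<le> real k / real (L n) \<and> real k / real (L n) \<le> t0 + \<kappa> \<longrightarrow>
    k \<le> d n \<and> exp (real (L n) * (I s - 2 * e)) \<le> cmod (pc k n) * exp (s * real k)"
proof -
  have "(\<lambda>n. exp (I s - e) - err n * exp (\<bar>s\<bar> * T0)) \<longlonglongrightarrow> exp (I s - e) - 0 * exp (\<bar>s\<bar> * T0)"
    by (intro tendsto_intros err_lim)
  then have ev1: "\<forall>\<^sub>F n in sequentially. exp (I s - 2 * e) < exp (I s - e) - err n * exp (\<bar>s\<bar> * T0)"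
    by (rule order_tendstoD) (use e in simp)
  have ev2: "\<forall>\<^sub>F n in sequentially. \<delta> n < T0 - (t0 + \<kappa>)"
    by (rule order_tendstoD(2)[OF \<delta>_lim]) (use t0 in simp)
  from ev1 ev2 show ?thesis
  proof eventually_elim
    case (elim n)
    show ?case
    proof (intro allI impI)
      fix k assume "t0 \<le> real k / real (L n) \<and> real k / real (L n) \<le> t0 + \<kappa>"
      moreover define t where "t = real k / real (L n)"
      ultimately have t: "t0 \<le> t" "t \<le> t0 + \<kappa>" by auto
      have k: "k \<le> d n" using t elim by (simp add: le_d_iff t_def)
      have tT: "min t T0 = t" "0 \<le> t" "t \<le> T0" using t t0 by auto
      have "exp (I s - 2 * e) \<le> exp (I s - e) - err n * exp (\<bar>s\<bar> * T0)" using elim by simp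
      also have "\<dots> \<le> p t * exp (s * t) - err n * exp (s * t)"
      proof (intro diff_mono near t mult_left_mono err_nonneg)
        have "s * t \<le> \<bar>s\<bar> * T0" using tT by (intro mult_mono) auto
        then show "exp (s * t) \<le> exp (\<bar>s\<bar> * T0)" by simp
      qed
      also have "\<dots> = (p t - err n) * exp (s * t)" by (simp add: algebra_simps)
      also have "\<dots> \<le> cmod (pc k n) powr (1 / real (L n)) * exp (s * t)"
        using err_bound[OF k] tT by (intro mult_right_mono) (auto simp: t_def)
      finally have "exp (I s - 2 * e) ^ L n \<le> (cmod (pc k n) powr (1 / real (L n)) * exp (s * t)) ^ L n"
        by (intro power_mono) auto
      then show "k \<le> d n \<and> exp (real (L n) * (I s - 2 * e)) \<le> cmod (pc k n) * exp (s * real k)"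
        unfolding power_mult_distrib cmod_powr_inverse_power t_def exp_div_power
        using k by (simp add: exp_of_nat_mult)
    qed
  qed
qed

lemma prob_ident:
  assumes "A \<in> sets borel"
  shows "prob {\<omega>\<in>space M. \<xi> k \<omega> \<in> A} = prob {\<omega>\<in>space M. \<xi> 0 \<omega> \<in> A}"
proof -
  have "prob {\<omega>\<in>space M. \<xi> j \<omega> \<in> A} = measure (distr M borel (\<xi> j)) A" for j
    using assms by (subst measure_distr) (auto intro!: arg_cong[where f = prob])
  then show ?thesis using ident by metis
qed

lemma prob_ident_pred:
  assumes "Measurable.pred borel P"
  shows "prob {\<omega>\<in>space M. P (\<xi> k \<omega>)} = prob {\<omega>\<in>space M. P (\<xi> 0 \<omega>)}"
  using prob_ident[of "Collect P" k] assms by (simp add: pred_def)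

text \<open>A union bound over at most (2 T0 + 1) L variables, each exceeding exp(e L) with
  probability o(1 / L).\<close>

lemma xi_tail: "\<forall>\<^sub>F x in whp M. \<forall>k\<le>d (fst x). cmod (\<xi> k (snd x)) \<le> exp (e * real (L (fst x)))"
  if e: "e > 0"
  unfolding eventually_whp
proof (intro allI impI)
  fix \<theta> :: real assume \<theta>: "\<theta> > 0"
  define X where "X \<omega> = ln (1 + cmod (\<xi> 0 \<omega>))" for \<omega>
  have "(\<lambda>n. (2 * T0 + 1) * (real (L n) * prob {\<omega>\<in>space M. X \<omega> > e * real (L n)})) \<longlonglongrightarrow> (2 * T0 + 1) * 0"
    by (intro tendsto_intros integrable_tail_tendsto_0 L_lim e) (use logmom in \<open>auto simp: X_def\<close>)
  then have "\<forall>\<^sub>F n in sequentially. (2 * T0 + 1) * (real (L n) * prob {\<omega>\<in>space M. X \<omega> > e * real (L n)}) < \<theta>"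
    by (rule order_tendstoD) (use \<theta> in simp)
  then show "\<forall>\<^sub>F n in sequentially. \<exists>B\<in>events. prob B \<le> \<theta> \<and> (\<forall>\<omega>\<in>space M - B.
      \<forall>k\<le>d (fst (n, \<omega>)). cmod (\<xi> k (snd (n, \<omega>))) \<le> exp (e * real (L (fst (n, \<omega>)))))"
  proof eventually_elim
    case (elim n)
    define B where "B k = {\<omega>\<in>space M. ln (1 + cmod (\<xi> k \<omega>)) > e * real (L n)}" for k
    have [measurable]: "B k \<in> events" for k unfolding B_def by measurable
    have probB: "prob (B k) = prob {\<omega>\<in>space M. X \<omega> > e * real (L n)}" for k
      unfolding B_def X_def by (rule prob_ident_pred[where P = "\<lambda>x. ln (1 + cmod x) > e * real (L n)"]) measurable
    have "prob (\<Union>k\<in>{..d n}. B k) \<le> (\<Sum>k\<in>{..d n}. prob (B k))"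
      by (intro measure_UNION_le) auto
    also have "\<dots> = (real (d n) + 1) * prob {\<omega>\<in>space M. X \<omega> > e * real (L n)}"
      by (simp add: probB)
    also have "\<dots> \<le> ((2 * T0 + 1) * real (L n)) * prob {\<omega>\<in>space M. X \<omega> > e * real (L n)}"
    proof (intro mult_right_mono)
      have "1 \<le> real (L n)" using L_pos[of n] by (simp add: Suc_le_eq)
      then show "real (d n) + 1 \<le> (2 * T0 + 1) * real (L n)" using d_le[of n] by (simp add: ring_distribs)
    qed simp
    finally have "prob (\<Union>k\<in>{..d n}. B k) \<le> \<theta>" using elim by (simp add: mult.assoc)
    moreover have "cmod (\<xi> k \<omega>) \<le> exp (e * real (L n))"
      if "\<omega> \<in> space M - (\<Union>k\<in>{..d n}. B k)" "k \<le> d n" for \<omega> k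
    proof -
      have "ln (1 + cmod (\<xi> k \<omega>)) \<le> e * real (L n)" using that by (auto simp: B_def not_less)
      then have "1 + cmod (\<xi> k \<omega>) \<le> exp (e * real (L n))"
        by (metis add_pos_nonneg exp_le_cancel_iff exp_ln norm_ge_zero zero_less_one)
      then show ?thesis by simp
    qed
    ultimately show ?case by (intro bexI[of _ "\<Union>k\<in>{..d n}. B k"]) auto
  qed
qed

text \<open>The triangle inequality, uniformly on the circle. The exponent e is shared equally by
  the coefficients, the variables and the number of terms.\<close>

lemma F_upper:
  assumes e: "e > 0"
  shows "\<forall>\<^sub>F x in whp M. \<forall>z. cmod z = exp s \<longrightarrow>
    cmod (poly (F (fst x) (snd x)) z) \<le> exp (real (L (fst x)) * (I s + e))"
proof -
  have e3: "e / 3 > 0" using e by simp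
  have "\<forall>\<^sub>F x in at_top. (2 * T0 + 1) * x \<le> exp (e / 3 * x)"
    using e by real_asymp
  then have "\<forall>\<^sub>F n in sequentially. (2 * T0 + 1) * real (L n) \<le> exp (e / 3 * real (L n))"
    by (rule eventually_compose_filterlim[OF _ L_real_lim])
  from eventually_whp_sequentially[OF this] eventually_whp_sequentially[OF coef_upper[OF e3, of s]] xi_tail[OF e3]
  show ?thesis
  proof eventually_elim
    case (elim x)
    obtain n \<omega> where x: "x = (n, \<omega>)" by fastforce
    show ?case
      unfolding x fst_conv snd_conv
    proof (intro allI impI)
      fix z :: complex assume z: "cmod z = exp s"
      have "cmod (poly (F n \<omega>) z) \<le> (\<Sum>k\<le>d n. exp (real (L n) * (I s + e / 3)) * exp (e / 3 * real (L n)))"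
        unfolding poly_F
      proof (rule sum_norm_le)
        fix k assume "k \<in> {..d n}"
        then have k: "k \<le> d n" by simp
        have "cmod (pc k n * z ^ k * \<xi> k \<omega>) = (cmod (pc k n) * exp (s * real k)) * cmod (\<xi> k \<omega>)"
          using z by (simp add: norm_mult norm_power exp_of_nat_mult[symmetric] mult.commute)
        also have "\<dots> \<le> exp (real (L n) * (I s + e / 3)) * exp (e / 3 * real (L n))"
          using elim k by (intro mult_mono) (auto simp: x)
        finally show "cmod (pc k n * z ^ k * \<xi> k \<omega>) \<le> exp (real (L n) * (I s + e / 3)) * exp (e / 3 * real (L n))" .
      qed
      also have "\<dots> = (real (d n) + 1) * exp (real (L n) * (I s + 2 * e / 3))"
        by (simp add: exp_add[symmetric] algebra_simps)
      also have "\<dots> \<le> exp (e / 3 * real (L n)) * exp (real (L n) * (I s + 2 * e / 3))"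
      proof (intro mult_right_mono)
        have "1 \<le> real (L n)" using L_pos[of n] by (simp add: Suc_le_eq)
        then have "real (d n) + 1 \<le> (2 * T0 + 1) * real (L n)" using d_le[of n] by (simp add: ring_distribs)
        also have "\<dots> \<le> exp (e / 3 * real (L n))" using elim by (simp add: x)
        finally show "real (d n) + 1 \<le> exp (e / 3 * real (L n))" .
      qed simp
      also have "\<dots> = exp (real (L n) * (I s + e))"
        by (simp add: exp_add[symmetric] algebra_simps)
      finally show "cmod (poly (F n \<omega>) z) \<le> exp (real (L n) * (I s + e))" .
    qed
  qed
qed

lemma xi_conc:
  obtains c q where "0 < c" "0 \<le> q" "q < 1" "\<And>k b. prob {\<omega>\<in>space M. cmod (\<xi> k \<omega> - b) \<le> c} \<le> q"
proof -
  have ind: "indep_var borel (\<xi> 0) borel (\<xi> 1)"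
  proof -
    have "indep_vars (\<lambda>_. borel) \<xi> (insert 0 {1})" by (rule indep_vars_subset[OF indep]) auto
    from indep_vars_sum_complex[OF _ _ this, of "\<lambda>_. 1"] show ?thesis by simp
  qed
  obtain c q where cq: "0 < c" "0 \<le> q" "q < 1" "\<And>b. prob {\<omega>\<in>space M. cmod (\<xi> 0 \<omega> - b) \<le> c} \<le> q"
    by (rule nondegenerate_conc[OF ind ident nondeg]) blast
  have eq: "prob {\<omega>\<in>space M. cmod (\<xi> k \<omega> - b) \<le> c} = prob {\<omega>\<in>space M. cmod (\<xi> 0 \<omega> - b) \<le> c}" for k b
    by (rule prob_ident_pred[where P = "\<lambda>x. cmod (x - b) \<le> c"]) measurable
  show ?thesis by (rule that[OF cq(1-3)]) (rule ord_eq_le_trans[OF eq cq(4)])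
qed

lemma xi_tight:
  assumes "\<tau> > 0"
  obtains R where "1 \<le> R" "\<And>k. prob {\<omega>\<in>space M. cmod (\<xi> k \<omega>) > R} \<le> \<tau>"
proof -
  define X where "X \<omega> = ln (1 + cmod (\<xi> 0 \<omega>))" for \<omega>
  have [measurable]: "X \<in> borel_measurable M" unfolding X_def by measurable
  have "(\<lambda>n. real n * prob {\<omega>\<in>space M. X \<omega> > 1 * real n}) \<longlonglongrightarrow> 0"
    by (rule integrable_tail_tendsto_0[where L = "\<lambda>n. n"]) (use logmom filterlim_ident in \<open>auto simp: X_def\<close>)
  then have "\<forall>\<^sub>F n in sequentially. real n * prob {\<omega>\<in>space M. X \<omega> > 1 * real n} < \<tau>"
    by (rule order_tendstoD) (use assms in simp)
  then have "\<forall>\<^sub>F n in sequentially. real n * prob {\<omega>\<in>space M. X \<omega> > 1 * real n} < \<tau> \<and> n \<ge> 1"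
    using eventually_ge_at_top[of 1] by eventually_elim simp
  then obtain n where n: "real n * prob {\<omega>\<in>space M. X \<omega> > 1 * real n} < \<tau>" "n \<ge> 1"
    using eventually_happens sequentially_bot by blast
  show ?thesis
  proof (rule that[of "exp (real n)"])
    show "1 \<le> exp (real n)" by simp
    fix k
    have "prob {\<omega>\<in>space M. cmod (\<xi> k \<omega>) > exp (real n)} = prob {\<omega>\<in>space M. cmod (\<xi> 0 \<omega>) > exp (real n)}"
      by (rule prob_ident_pred[where P = "\<lambda>x. cmod x > exp (real n)"]) measurable
    also have "\<dots> \<le> prob {\<omega>\<in>space M. X \<omega> > 1 * real n}"
    proof (intro finite_measure_mono subsetI)
      fix \<omega> assume \<omega>: "\<omega> \<in> {\<omega>\<in>space M. cmod (\<xi> 0 \<omega>) > exp (real n)}"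
      then have "exp (real n) < 1 + cmod (\<xi> 0 \<omega>)" by simp
      then have "ln (exp (real n)) < X \<omega>" unfolding X_def by (intro ln_strict_mono) auto
      then show "\<omega> \<in> {\<omega>\<in>space M. X \<omega> > 1 * real n}" using \<omega> by simp
    qed measurable
    also have "\<dots> \<le> real n * prob {\<omega>\<in>space M. X \<omega> > 1 * real n}"
      using mult_right_mono[of 1 "real n" "prob {\<omega>\<in>space M. X \<omega> > 1 * real n}"] n(2) by simp
    finally show "prob {\<omega>\<in>space M. cmod (\<xi> k \<omega>) > exp (real n)} \<le> \<tau>" using n by simp
  qed
qed

text \<open>The order of choices matters: Nr depends on e; then N and \<tau> on \<theta> and Nr;
  then R and B. All are fixed before n, and only the indices in K and the shifted s' vary with n.
  Both are deterministic, so the small ball bound applies at each of the Nr points.\<close>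

lemma log_mahler_lower:
  assumes e: "e > 0"
  shows "\<forall>\<^sub>F x in whp M. F (fst x) (snd x) \<noteq> 0 \<and>
    real (L (fst x)) * (I s - e) \<le> log_mahler (F (fst x) (snd x)) (exp s)"
  unfolding eventually_whp
proof (intro allI impI)
  fix \<theta> :: real assume \<theta>: "\<theta> > 0"
  \<comment> \<open>Five losses of e1: two in the coefficients, one in the level \<eta>, one for the
    grid of Nr points, one for moving s to s'.\<close>
  define e1 where "e1 = e / 5"
  have e1: "e1 > 0" using e by (simp add: e1_def)
  obtain Nr :: nat where Nr': "2 * T0 * ln 2 / e1 < real Nr" using reals_Archimedean2 by blast
  have "0 < 2 * T0 * ln 2 / e1" using T0 e1 by simp
  then have Nr0: "real Nr > 0" using Nr' by linarith
  then have Nr_pos: "Nr > 0" by simp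
  have Nr: "2 * T0 * ln 2 / real Nr \<le> e1" using Nr' Nr0 e1 by (simp add: field_simps)
  \<comment> \<open>The permitted shift of s: with degree at most 2 T0 L, the Lipschitz bound
    charges L e1 for it.\<close>
  define e2 where "e2 = e1 / (2 * T0)"
  have e2: "e2 > 0" using e1 T0 by (simp add: e2_def)
  obtain t0 \<kappa> where t0: "0 \<le> t0" "0 < \<kappa>" "t0 + \<kappa> < T0"
    and near: "\<And>t. t0 \<le> t \<Longrightarrow> t \<le> t0 + \<kappa> \<Longrightarrow> exp (I s - e1) \<le> p t * exp (s * t)"
    by (rule near_maximizer[OF e1, of s]) blast
  obtain c q' where c: "0 < c" and q': "0 \<le> q'" "q' < 1"
    and conc: "\<And>k b. prob {\<omega>\<in>space M. cmod (\<xi> k \<omega> - b) \<le> c} \<le> q'"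
    by (rule xi_conc) blast
  define q where "q = (q' + 1) / 2"
  have q: "0 < q" "q < 1" "q' < q" using q' by (auto simp: q_def)
  \<comment> \<open>Each of the Nr points may fail with probability \<theta> / Nr: half of it covers
    q^N, the other half N \<tau>. The successor in \<open>N\<close> only ensures N > 0.\<close>
  obtain N0 where N0: "q ^ N0 < \<theta> / (2 * real Nr)"
    using real_arch_pow_inv[of "\<theta> / (2 * real Nr)" q] q \<theta> Nr0 by auto
  define N where "N = Suc N0"
  have N: "N > 0" by (simp add: N_def)
  have "q ^ N \<le> q ^ N0" unfolding N_def using q by (intro power_decreasing) auto
  then have qN: "q ^ N \<le> \<theta> / (2 * real Nr)" using N0 by linarith
  define \<tau> where "\<tau> = min (q - q') (\<theta> / (2 * real Nr * real N))"
  have \<tau>: "\<tau> > 0" "q' + \<tau> \<le> q" "\<tau> \<le> \<theta> / (2 * real Nr * real N)"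
    using q \<theta> Nr0 N by (auto simp: \<tau>_def)
  have \<tau>N: "real N * \<tau> \<le> \<theta> / (2 * real Nr)"
    using mult_left_mono[OF \<tau>(3), of "real N"] N by simp
  obtain R where R: "1 \<le> R" and tail: "\<And>k. prob {\<omega>\<in>space M. cmod (\<xi> k \<omega>) > R} \<le> \<tau>"
    by (rule xi_tight[OF \<tau>(1)]) blast
  define B where "B = max 2 (2 * R * real N / c)"
  have B: "1 < B" "2 * R * real N \<le> c * B"
  proof -
    show "1 < B" by (simp add: B_def)
    have "2 * R * real N = c * (2 * R * real N / c)" using c by simp
    also have "\<dots> \<le> c * B" unfolding B_def using c by (intro mult_left_mono) auto
    finally show "2 * R * real N \<le> c * B" .
  qed
  have lnB: "ln B > 0" using B by simp
  have low: "\<forall>\<^sub>F n in sequentially. \<forall>k. t0 \<le> real k / real (L n) \<and> real k / real (L n) \<le> t0 + \<kappa> \<longrightarrow>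
      k \<le> d n \<and> exp (real (L n) * (I s - 2 * e1)) \<le> cmod (pc k n) * exp (s * real k)"
    by (rule coef_lower[OF e1 t0 near])
  \<comment> \<open>With g = \<kappa> L / (2 N) the shift N^2 (2 ln B / g) equals C1 e2 / L, hence
    is at most e2 as soon as L \<ge> C1.\<close>
  define C1 where "C1 = 4 * real N ^ 3 * ln B / (\<kappa> * e2)"
  have "((\<lambda>n. exp (- (e1 * real (L n)))) \<longlonglongrightarrow> 0)"
    by (intro filterlim_compose[OF exp_at_bot] filterlim_compose[OF filterlim_uminus_at_bot_at_top]
        filterlim_tendsto_pos_mult_at_top[OF tendsto_const e1 L_real_lim])
  then have small: "\<forall>\<^sub>F n in sequentially. exp (- (e1 * real (L n))) < c / 2"
    by (rule order_tendstoD) (use c in simp)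
  show "\<forall>\<^sub>F n in sequentially. \<exists>B\<in>events. prob B \<le> \<theta> \<and> (\<forall>\<omega>\<in>space M - B.
      F (fst (n, \<omega>)) (snd (n, \<omega>)) \<noteq> 0 \<and>
      real (L (fst (n, \<omega>))) * (I s - e) \<le> log_mahler (F (fst (n, \<omega>)) (snd (n, \<omega>))) (exp s))"
    using low small eventually_L_ge[of "2 * real N / \<kappa>"] eventually_L_ge[of C1]
  proof eventually_elim
    case (elim n)
    define l where "l = real (L n)"
    have l: "l > 0" using L_real_pos by (simp add: l_def)
    \<comment> \<open>The grid spacing is \<kappa> L / N = 2 g, and rounding up moves a point by
      less than 1 \<le> g, so distinct indices remain at least g apart.\<close>
    define kk where "kk j = nat \<lceil>(t0 + real j * \<kappa> / real N) * l\<rceil>" for j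
    have kk: "(t0 + real j * \<kappa> / real N) * l \<le> real (kk j)"
      "real (kk j) < (t0 + real j * \<kappa> / real N) * l + 1" for j
    proof -
      have "0 \<le> (t0 + real j * \<kappa> / real N) * l" using t0 l by simp
      then have "real (kk j) = of_int \<lceil>(t0 + real j * \<kappa> / real N) * l\<rceil>" unfolding kk_def by simp
      then show "(t0 + real j * \<kappa> / real N) * l \<le> real (kk j)"
        "real (kk j) < (t0 + real j * \<kappa> / real N) * l + 1" by linarith+
    qed
    define g where "g = \<kappa> * l / (2 * real N)"
    have g1: "g \<ge> 1" using elim(3) t0 N by (simp add: g_def l_def field_simps)
    have gN: "\<kappa> / real N * l = 2 * g" using N by (simp add: g_def)
    have grid: "(t0 + real j * \<kappa> / real N) * l = t0 * l + real j * (2 * g)" for j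
      unfolding gN[symmetric] by (simp add: algebra_simps)
    have step: "real (kk i) + g \<le> real (kk j)" if "i < j" for i j
    proof -
      have "(t0 + real i * \<kappa> / real N) * l + 2 * g \<le> (t0 + real j * \<kappa> / real N) * l"
      proof -
        have "1 * (2 * g) \<le> (real j - real i) * (2 * g)"
          using that g1 by (intro mult_right_mono) auto
        then show ?thesis unfolding grid by (simp add: algebra_simps)
      qed
      then show ?thesis using kk(2)[of i] kk(1)[of j] g1 by linarith
    qed
    define K where "K = kk ` {..<N}"
    have inj: "inj_on kk {..<N}"
    proof (rule linorder_inj_onI)
      fix i j :: nat assume "i < j"
      then show "kk i \<noteq> kk j" using step[of i j] g1 by auto
    qed (rule linear)
    have cardK: "card K = N" and finK: "finite K" using inj by (auto simp: K_def card_image)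
    have sep: "g \<le> \<bar>real i - real j\<bar>" if ij: "i \<in> K" "j \<in> K" "i \<noteq> j" for i j
    proof -
      obtain a b where ab: "i = kk a" "j = kk b" using ij by (auto simp: K_def)
      then have "a \<noteq> b" using ij by auto
      then consider "a < b" | "b < a" by linarith
      then show ?thesis using step[of a b] step[of b a] ab by cases auto
    qed
    have K_range: "t0 \<le> real k / l \<and> real k / l \<le> t0 + \<kappa>" if k: "k \<in> K" for k
    proof -
      obtain j where j: "j < N" "k = kk j" using k by (auto simp: K_def)
      have "t0 * l \<le> (t0 + real j * \<kappa> / real N) * l" using t0 l by (intro mult_right_mono) auto
      then have "t0 * l \<le> real k" using kk(1)[of j] j by simp
      moreover have "real k \<le> (t0 + \<kappa>) * l"
      proof -
        have "(real j + 1) * (2 * g) \<le> real N * (2 * g)" using j g1 by (intro mult_right_mono) auto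
        also have "\<dots> = \<kappa> * l" using N by (simp add: g_def)
        finally have "real j * (2 * g) + 2 * g \<le> \<kappa> * l" by (simp add: ring_distribs)
        then show ?thesis using kk(2)[of j, unfolded grid] j g1 by (simp add: ring_distribs)
      qed
      ultimately show ?thesis using l by (simp add: pos_le_divide_eq pos_divide_le_eq)
    qed
    have K_coef: "k \<le> d n" "exp (l * (I s - 2 * e1)) \<le> cmod (pc k n) * exp (s * real k)" if "k \<in> K" for k
      using elim(1) K_range[OF that] by (auto simp: l_def)
    have g0: "g > 0" using g1 by linarith
    have "\<exists>s'\<ge>s. s' \<le> s + real ((card K)\<^sup>2) * (2 * ln B / g) \<and> (\<forall>i\<in>K. \<forall>j\<in>K. i \<noteq> j \<longrightarrow>
        ln B \<le> \<bar>(ln (cmod (pc i n)) + s' * real i) - (ln (cmod (pc j n)) + s' * real j)\<bar>)"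
      by (rule lacunary_perturbation[OF finK g0 lnB]) (rule sep; assumption)
    then obtain s' where s': "s \<le> s'" "s' \<le> s + real ((card K)\<^sup>2) * (2 * ln B / g)"
      and lac: "\<And>i j. i \<in> K \<Longrightarrow> j \<in> K \<Longrightarrow> i \<noteq> j \<Longrightarrow>
        ln B \<le> \<bar>(ln (cmod (pc i n)) + s' * real i) - (ln (cmod (pc j n)) + s' * real j)\<bar>"
      by metis
    have s'_e2: "s' - s \<le> e2"
    proof -
      have "real ((card K)\<^sup>2) * (2 * ln B / g) = C1 * e2 / l"
        using N t0 l e2 by (simp add: cardK g_def C1_def power2_eq_square power3_eq_cube field_simps)
      also have "\<dots> \<le> e2" using elim(4) l e2 by (simp add: l_def pos_divide_le_eq mult.commute)
      finally show ?thesis using s' by linarith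
    qed
    have pc_pos: "cmod (pc k n) > 0" if "k \<in> K" for k
      using K_coef(2)[OF that] exp_gt_zero[of "l * (I s - 2 * e1)"]
      by (metis less_le_trans mult_eq_0_iff norm_ge_zero order_less_irrefl less_eq_real_def)
    define \<eta> where "\<eta> = exp (l * (I s - 3 * e1))"
    have \<eta>: "\<eta> > 0" by (simp add: \<eta>_def)
    define z where "z j = of_real (exp s') * cis (2 * pi * real j / real Nr)" for j
    have cz: "cmod (pc k n * z j ^ k) = cmod (pc k n) * exp (s' * real k)" for k j
      by (simp add: z_def norm_mult norm_power exp_of_nat_mult[symmetric] mult.commute)
    have sb: "prob {\<omega>\<in>space M. cmod (poly (F n \<omega>) (z j)) \<le> \<eta>} \<le> q ^ N + real N * \<tau>" for j
      unfolding poly_F cardK[symmetric]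
    proof (rule small_ball_lacunary[OF indep _ _ conc tail \<tau>(2) \<eta> c])
      show "finite {..d n}" by simp
      show "K \<subseteq> {..d n}" using K_coef by auto
      show "2 * \<eta> \<le> c * cmod (pc k n * z j ^ k)" if "k \<in> K" for k
      proof -
        have "2 * \<eta> = 2 * exp (- (e1 * l)) * exp (l * (I s - 2 * e1))"
          by (simp add: \<eta>_def exp_add[symmetric] algebra_simps)
        also have "\<dots> \<le> c * exp (l * (I s - 2 * e1))"
          using elim(2) by (intro mult_right_mono) (auto simp: l_def)
        also have "\<dots> \<le> c * (cmod (pc k n) * exp (s * real k))"
          using K_coef(2)[OF that] c by (intro mult_left_mono) auto
        \<comment> \<open>The shift goes to the right, so the lower bounds at s persist at
          s'.\<close>
        also have "\<dots> \<le> c * (cmod (pc k n) * exp (s' * real k))"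
          using s' c by (intro mult_left_mono) (auto intro!: mult_right_mono)
        finally show ?thesis unfolding cz .
      qed
      show "B * cmod (pc i n * z j ^ i) \<le> cmod (pc k n * z j ^ k) \<or> B * cmod (pc k n * z j ^ k) \<le> cmod (pc i n * z j ^ i)"
        if "i \<in> K" "k \<in> K" "i \<noteq> k" for i k
      proof -
        have ex: "cmod (pc k n) * exp (s' * real k) = exp (ln (cmod (pc k n)) + s' * real k)" if "k \<in> K" for k
          using pc_pos[OF that] by (simp add: exp_add)
        have "B = exp (ln B)" using B by simp
        then have Bex: "B * exp u \<le> exp v \<longleftrightarrow> ln B + u \<le> v" for u v
          by (metis exp_add exp_le_cancel_iff)
        show ?thesis
          unfolding cz ex[OF that(1)] ex[OF that(2)] Bex using lac[OF that] by linarith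
      qed
      show "1 < B" "2 * R * real (card K) \<le> c * B" "0 \<le> R" using B R by (auto simp: cardK)
    qed
    have poly_meas[measurable]: "(\<lambda>\<omega>. poly (F n \<omega>) (z j)) \<in> borel_measurable M" for j
      unfolding poly_F by measurable
    define E where "E = (\<Union>j\<in>{..<Nr}. {\<omega>\<in>space M. cmod (poly (F n \<omega>) (z j)) \<le> \<eta>})"
    have E: "E \<in> events" unfolding E_def by measurable
    have "prob E \<le> (\<Sum>j\<in>{..<Nr}. prob {\<omega>\<in>space M. cmod (poly (F n \<omega>) (z j)) \<le> \<eta>})"
      unfolding E_def by (intro measure_UNION_le) auto
    also have "\<dots> \<le> (\<Sum>j\<in>{..<Nr}. \<theta> / (2 * real Nr) + \<theta> / (2 * real Nr))"
      using qN \<tau>N by (intro sum_mono order_trans[OF sb] add_mono)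
    also have "\<dots> = \<theta>" using Nr0 by simp
    finally have "prob E \<le> \<theta>" .
    moreover have "F n \<omega> \<noteq> 0 \<and> l * (I s - e) \<le> log_mahler (F n \<omega>) (exp s)" if \<omega>: "\<omega> \<in> space M - E" for \<omega>
    proof -
      have big: "cmod (poly (F n \<omega>) (z j)) > \<eta>" if "j < Nr" for j
        using \<omega> that by (auto simp: E_def not_le)
      have nz: "poly (F n \<omega>) (z j) \<noteq> 0" if "j < Nr" for j using big[OF that] \<eta> by auto
      then have F0: "F n \<omega> \<noteq> 0" using Nr_pos by force
      have deg: "real (degree (F n \<omega>)) \<le> 2 * T0 * l" unfolding l_def by (rule degree_F_le)
      have "l * (I s - 3 * e1) = (\<Sum>j<Nr. l * (I s - 3 * e1)) / real Nr" using Nr0 by simp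
      also have "\<dots> \<le> (\<Sum>j<Nr. ln (cmod (poly (F n \<omega>) (z j)))) / real Nr"
      proof (intro divide_right_mono sum_mono)
        fix j assume "j \<in> {..<Nr}"
        then have "ln \<eta> \<le> ln (cmod (poly (F n \<omega>) (z j)))" using big[of j] \<eta> by (intro ln_mono) auto
        then show "l * (I s - 3 * e1) \<le> ln (cmod (poly (F n \<omega>) (z j)))" by (simp add: \<eta>_def)
      qed simp
      also have "\<dots> \<le> log_mahler (F n \<omega>) (exp s') + real (degree (F n \<omega>)) * ln 2 / real Nr"
        using log_mahler_ge_average[OF F0 exp_gt_zero Nr_pos, of s'] nz by (simp add: z_def)
      also have "real (degree (F n \<omega>)) * ln 2 / real Nr \<le> l * e1"
      proof -
        have "real (degree (F n \<omega>)) * ln 2 / real Nr \<le> (2 * T0 * l) * ln 2 / real Nr"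
          using deg Nr0 by (intro divide_right_mono mult_right_mono) auto
        also have "\<dots> = l * (2 * T0 * ln 2 / real Nr)" by simp
        also have "\<dots> \<le> l * e1" using Nr l by (intro mult_left_mono) auto
        finally show ?thesis .
      qed
      also have "log_mahler (F n \<omega>) (exp s') \<le> log_mahler (F n \<omega>) (exp s) + l * e1"
      proof -
        have "log_mahler (F n \<omega>) (exp s') - log_mahler (F n \<omega>) (exp s) \<le> real (degree (F n \<omega>)) * (s' - s)"
          using log_mahler_lipschitz[of "exp s'" "exp s" "F n \<omega>"] s' by simp
        also have "\<dots> \<le> (2 * T0 * l) * e2" using deg s'_e2 s' T0 l by (intro mult_mono) auto
        also have "\<dots> = l * e1" using T0 by (simp add: e2_def)
        finally show ?thesis by simp
      qed
      finally have "l * (I s - 3 * e1) - 2 * (l * e1) \<le> log_mahler (F n \<omega>) (exp s)"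
        by (simp add: mult.commute)
      then show ?thesis using F0 by (simp add: e1_def algebra_simps)
    qed
    ultimately show ?case using E unfolding l_def fst_conv snd_conv by blast
  qed
qed

lemma log_mahler_tendsto:
  "((\<lambda>x. log_mahler (F (fst x) (snd x)) (exp s) / real (L (fst x))) \<longlongrightarrow> I s) (whp M)"
proof (rule tendstoI)
  fix e :: real assume "e > 0"
  then have e2: "e / 2 > 0" by simp
  from log_mahler_lower[OF e2, of s] F_upper[OF e2, of s]
  show "\<forall>\<^sub>F x in whp M. dist (log_mahler (F (fst x) (snd x)) (exp s) / real (L (fst x))) (I s) < e"
  proof eventually_elim
    case (elim x)
    define l where "l = real (L (fst x))"
    have l: "l > 0" using L_real_pos by (simp add: l_def)
    have "log_mahler (F (fst x) (snd x)) (exp s) \<le> ln (exp (l * (I s + e / 2)))"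
      using elim by (intro log_mahler_le) (auto simp: l_def)
    then have "log_mahler (F (fst x) (snd x)) (exp s) / l \<le> I s + e / 2"
      using l by (simp add: pos_divide_le_eq mult.commute)
    moreover have "I s - e / 2 \<le> log_mahler (F (fst x) (snd x)) (exp s) / l"
      using elim l by (simp add: pos_le_divide_eq mult.commute l_def)
    ultimately show ?case using \<open>e > 0\<close> by (simp add: dist_real_def l_def abs_less_iff)
  qed
qed

lemma moment_tendsto:
  assumes m: "m > 0"
  shows "((\<lambda>x. zero_measure_integral (F (fst x) (snd x))
      (\<lambda>w. Re (c * (of_real (exp s) * reflect (exp s) w) ^ m)) / real (L (fst x))) \<longlongrightarrow> 0) (whp M)"
proof (rule tendstoI)
  fix e :: real assume e: "e > 0"
  \<comment> \<open>The gap between maximum and mean will be at most 2 e1 L; the summand 1 keeps C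
    positive when c = 0.\<close>
  define C where "C = cmod c * (2 * real m) + 1"
  have C: "C > 0" by (simp add: C_def add_nonneg_pos)
  define e1 where "e1 = e / (4 * C)"
  have e1: "e1 > 0" using e C by (simp add: e1_def)
  from log_mahler_lower[OF e1, of s] F_upper[OF e1, of s]
  show "\<forall>\<^sub>F x in whp M. dist (zero_measure_integral (F (fst x) (snd x))
      (\<lambda>w. Re (c * (of_real (exp s) * reflect (exp s) w) ^ m)) / real (L (fst x))) 0 < e"
  proof eventually_elim
    case (elim x)
    define l where "l = real (L (fst x))"
    have l: "l > 0" using L_real_pos by (simp add: l_def)
    let ?Z = "zero_measure_integral (F (fst x) (snd x)) (\<lambda>w. Re (c * (of_real (exp s) * reflect (exp s) w) ^ m))"
    have "\<bar>?Z\<bar> \<le> cmod c * (2 * real m * (ln (exp (l * (I s + e1))) - log_mahler (F (fst x) (snd x)) (exp s)))"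
      using elim m by (intro reflect_moment_bound) (auto simp: l_def)
    also have "\<dots> \<le> cmod c * (2 * real m * (2 * e1 * l))"
      using elim by (intro mult_left_mono) (auto simp: l_def algebra_simps)
    also have "\<dots> \<le> C * (2 * e1 * l)"
      using e1 l by (simp add: C_def ring_distribs mult.assoc)
    also have "\<dots> = e / 2 * l" using C by (simp add: e1_def)
    finally have "\<bar>?Z\<bar> / l \<le> e / 2" using l by (simp add: pos_divide_le_eq)
    moreover have "dist (a / l) 0 = \<bar>a\<bar> / l" for a using l by (simp add: abs_divide)
    ultimately have "dist (?Z / l) 0 < e" using e by (simp only:)
    then show ?case by (simp only: l_def)
  qed
qed

text \<open>Continuity and boundedness are included so that the limit integral exists and uniform
  approximation transfers convergence.\<close>

definition converges :: "(complex \<Rightarrow> real) \<Rightarrow> bool" where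
  "converges \<phi> \<longleftrightarrow> continuous_on UNIV \<phi> \<and> bounded (range \<phi>) \<and>
    ((\<lambda>x. zero_measure_integral (F (fst x) (snd x)) \<phi> / real (L (fst x))) \<longlongrightarrow> integral\<^sup>L zero_limit \<phi>) (whp M)"

lemma integrable_zero_limit:
  assumes "continuous_on UNIV \<phi>" "bounded (range \<phi>)"
  shows "integrable zero_limit (\<phi> :: complex \<Rightarrow> real)"
proof -
  interpret Z: finite_measure zero_limit by (rule finite_zero_limit)
  obtain K where "\<And>w. norm (\<phi> w) \<le> K" using assms(2) by (auto simp: bounded_iff)
  then show ?thesis
    using borel_measurable_continuous_onI[OF assms(1)]
    by (intro Z.integrable_const_bound[where B = K]) (auto cong: measurable_cong_sets)
qed

lemma converges_add:
  assumes "converges f" "converges g"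
  shows "converges (\<lambda>w. f w + g w)"
  unfolding converges_def
proof (intro conjI)
  show "continuous_on UNIV (\<lambda>w. f w + g w)" using assms by (auto simp: converges_def intro: continuous_intros)
  show "bounded (range (\<lambda>w. f w + g w))"
    using bounded_plus_comp[of f UNIV g] assms by (auto simp: converges_def)
  have "integral\<^sup>L zero_limit (\<lambda>w. f w + g w) = integral\<^sup>L zero_limit f + integral\<^sup>L zero_limit g"
    using assms by (intro Bochner_Integration.integral_add integrable_zero_limit) (auto simp: converges_def)
  then show "((\<lambda>x. zero_measure_integral (F (fst x) (snd x)) (\<lambda>w. f w + g w) / real (L (fst x))) \<longlongrightarrow>
      integral\<^sup>L zero_limit (\<lambda>w. f w + g w)) (whp M)"
    using assms by (auto simp: converges_def zero_measure_integral_add add_divide_distrib intro: tendsto_add)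
qed

lemma converges_scale:
  assumes "converges f"
  shows "converges (\<lambda>w. c * f w)"
  unfolding converges_def
proof (intro conjI)
  show "continuous_on UNIV (\<lambda>w. c * f w)" using assms by (auto simp: converges_def intro: continuous_intros)
  have "bounded ((\<lambda>x. c *\<^sub>R x) ` range f)" using assms by (intro bounded_scaling) (auto simp: converges_def)
  then show "bounded (range (\<lambda>w. c * f w))" by (simp add: image_image)
  show "((\<lambda>x. zero_measure_integral (F (fst x) (snd x)) (\<lambda>w. c * f w) / real (L (fst x))) \<longlongrightarrow>
      integral\<^sup>L zero_limit (\<lambda>w. c * f w)) (whp M)"
    using assms by (auto simp: converges_def zero_measure_integral_cmult times_divide_eq_right[symmetric]
        simp del: times_divide_eq_right intro: tendsto_mult_left)
qed

lemma converges_closed: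
  assumes f: "continuous_on UNIV f" and app: "\<And>e. e > 0 \<Longrightarrow> \<exists>g. converges g \<and> (\<forall>w. \<bar>f w - g w\<bar> \<le> e)"
  shows "converges f"
  unfolding converges_def
proof (intro conjI f)
  show bf: "bounded (range f)"
  proof -
    obtain g where g: "converges g" "\<And>w. \<bar>f w - g w\<bar> \<le> 1" using app[of 1] by auto
    obtain K where "\<And>w. norm (g w) \<le> K" using g by (auto simp: converges_def bounded_iff)
    then have "norm (f w) \<le> K + 1" for w using g(2)[of w] by (smt (verit) real_norm_def)
    then show ?thesis by (auto simp: bounded_iff)
  qed
  interpret Z: finite_measure zero_limit by (rule finite_zero_limit)
  show "((\<lambda>x. zero_measure_integral (F (fst x) (snd x)) f / real (L (fst x))) \<longlongrightarrow> integral\<^sup>L zero_limit f) (whp M)"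
  proof (rule tendstoI)
    fix e :: real assume e: "e > 0"
    \<comment> \<open>Bounds the total mass of the normalized zero measure, at most 2 T0, plus that
      of the limit, so a uniform error e1 changes the two integrals by at most e / 2
      together.\<close>
    define C where "C = 2 * T0 + measure zero_limit (space zero_limit) + 1"
    have C: "C > 0" using T0 by (simp add: C_def add_nonneg_pos)
    define e1 where "e1 = e / (2 * C)"
    have e1: "e1 > 0" using e C by (simp add: e1_def)
    obtain g where g: "converges g" "\<And>w. \<bar>f w - g w\<bar> \<le> e1" using app[OF e1] by auto
    have fg: "continuous_on UNIV (\<lambda>w. f w - g w)"
      using f g by (auto simp: converges_def intro: continuous_intros)
    have fgb: "bounded (range (\<lambda>w. f w - g w))" using g(2) by (auto simp: bounded_iff)
    have "\<bar>integral\<^sup>L zero_limit (\<lambda>w. f w - g w)\<bar> \<le> measure zero_limit (space zero_limit) * e1"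
    proof -
      have "\<bar>integral\<^sup>L zero_limit (\<lambda>w. f w - g w)\<bar> \<le> integral\<^sup>L zero_limit (\<lambda>w. \<bar>f w - g w\<bar>)"
        using integral_norm_bound[of zero_limit "\<lambda>w. f w - g w"] by simp
      also have "\<dots> \<le> integral\<^sup>L zero_limit (\<lambda>w. e1)"
        by (intro integral_mono integrable_abs integrable_zero_limit fg fgb) (auto simp: g(2))
      finally show ?thesis by (simp add: mult.commute)
    qed
    moreover have "integral\<^sup>L zero_limit (\<lambda>w. f w - g w) = integral\<^sup>L zero_limit f - integral\<^sup>L zero_limit g"
      using f bf g by (intro Bochner_Integration.integral_diff integrable_zero_limit) (auto simp: converges_def)
    ultimately have int: "\<bar>integral\<^sup>L zero_limit f - integral\<^sup>L zero_limit g\<bar> \<le> measure zero_limit (space zero_limit) * e1"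
      by simp
    have "((\<lambda>x. zero_measure_integral (F (fst x) (snd x)) g / real (L (fst x))) \<longlongrightarrow> integral\<^sup>L zero_limit g) (whp M)"
      using g by (simp add: converges_def)
    from tendstoD[OF this, of "e / 2"] e
    have "\<forall>\<^sub>F x in whp M. dist (zero_measure_integral (F (fst x) (snd x)) g / real (L (fst x))) (integral\<^sup>L zero_limit g) < e / 2"
      by simp
    then show "\<forall>\<^sub>F x in whp M. dist (zero_measure_integral (F (fst x) (snd x)) f / real (L (fst x))) (integral\<^sup>L zero_limit f) < e"
    proof eventually_elim
      case (elim x)
      define l where "l = real (L (fst x))"
      have l: "l > 0" using L_real_pos by (simp add: l_def)
      let ?Z = "zero_measure_integral (F (fst x) (snd x))"
      have "\<bar>?Z f - ?Z g\<bar> \<le> real (degree (F (fst x) (snd x))) * e1"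
        unfolding zero_measure_integral_diff[symmetric] by (rule zero_measure_integral_bound[OF g(2)])
      also have "\<dots> \<le> (2 * T0 * l) * e1"
        unfolding l_def using e1 by (intro mult_right_mono degree_F_le) auto
      finally have "\<bar>?Z f / l - ?Z g / l\<bar> \<le> 2 * T0 * e1"
        using l by (simp add: diff_divide_distrib[symmetric] pos_divide_le_eq mult_ac)
      moreover have "2 * T0 * e1 + measure zero_limit (space zero_limit) * e1 \<le> C * e1"
        using e1 by (simp add: C_def ring_distribs)
      moreover have "C * e1 = e / 2" using C by (simp add: e1_def)
      ultimately show ?case using elim int unfolding l_def[symmetric] dist_real_def by linarith
    qed
  qed
qed

text \<open>The leading coefficient cancels in the difference of \<open>log_mahler\<close> at two
  radii, leaving the zero sum of this function.\<close>

lemma converges_log: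
  assumes "0 < r" "r < R"
  shows "converges (\<lambda>w. ln (max R (cmod w)) - ln (max r (cmod w)))"
  unfolding converges_def
proof (intro conjI)
  have pos: "0 < max r (cmod w)" "0 < max R (cmod w)" for w using assms by (auto simp: less_max_iff_disj)
  show "continuous_on UNIV (\<lambda>w. ln (max R (cmod w)) - ln (max r (cmod w)))"
    by (intro continuous_intros) (use pos in \<open>auto simp: less_imp_neq[symmetric] dest: less_imp_neq\<close>)
  show "bounded (range (\<lambda>w. ln (max R (cmod w)) - ln (max r (cmod w))))"
  proof -
    have "\<bar>ln (max R (cmod w)) - ln (max r (cmod w))\<bar> \<le> ln R - ln r" for w
    proof -
      consider "cmod w \<le> r" | "r < cmod w" "cmod w \<le> R" | "R < cmod w" by linarith
      then show ?thesis
      proof cases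
        case 2
        then have "ln r \<le> ln (cmod w)" "ln (cmod w) \<le> ln R" using assms by (auto intro!: ln_mono)
        then show ?thesis using 2 by (simp add: max_def)
      qed (use assms in \<open>auto simp: max_def\<close>)
    qed
    then show ?thesis by (auto simp: bounded_iff)
  qed
  have "((\<lambda>x. log_mahler (F (fst x) (snd x)) (exp (ln R)) / real (L (fst x)) -
      log_mahler (F (fst x) (snd x)) (exp (ln r)) / real (L (fst x))) \<longlongrightarrow> I (ln R) - I (ln r)) (whp M)"
    by (intro tendsto_diff log_mahler_tendsto)
  moreover have "log_mahler q (exp (ln R)) / l - log_mahler q (exp (ln r)) / l =
      zero_measure_integral q (\<lambda>w. ln (max R (cmod w)) - ln (max r (cmod w))) / l" for q l
    using assms by (simp add: log_mahler_def zero_measure_integral_diff diff_divide_distrib add_divide_distrib)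
  moreover have "integral\<^sup>L zero_limit (\<lambda>w. ln (max R (cmod w)) - ln (max r (cmod w))) = I (ln R) - I (ln r)"
    using integral_zero_limit_log[of "ln r" "ln R"] assms by simp
  ultimately show "((\<lambda>x. zero_measure_integral (F (fst x) (snd x)) (\<lambda>w. ln (max R (cmod w)) - ln (max r (cmod w))) /
      real (L (fst x))) \<longlongrightarrow> integral\<^sup>L zero_limit (\<lambda>w. ln (max R (cmod w)) - ln (max r (cmod w)))) (whp M)"
    by (simp only:)
qed

lemma converges_moment:
  assumes r: "0 < r" and m: "0 < m"
  shows "converges (\<lambda>w. Re (u * (if cmod w \<le> r then cnj w / of_real r else of_real r / w) ^ m))"
proof -
  define k where "k w = (if cmod w \<le> r then cnj w / of_real r else of_real r / w)" for w
  have k_reflect: "k w = of_real (exp (ln r)) * reflect (exp (ln r)) w" for w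
    using r by (simp add: k_def reflect_def power2_eq_square)
  have k_cont: "continuous_on UNIV k"
  proof -
    have "continuous_on ({w. cmod w \<le> r} \<union> {w. r \<le> cmod w}) k"
      unfolding k_def
    proof (rule continuous_on_cases)
      show "closed {w. cmod w \<le> r}" "closed {w. r \<le> cmod w}"
        by (intro closed_Collect_le continuous_intros)+
      show "continuous_on {w. cmod w \<le> r} (\<lambda>w. cnj w / of_real r)"
        using r by (intro continuous_intros) auto
      show "continuous_on {w. r \<le> cmod w} (\<lambda>w. of_real r / w)"
        using r by (intro continuous_intros) auto
      show "\<forall>w. w \<in> {w. cmod w \<le> r} \<and> \<not> cmod w \<le> r \<or> w \<in> {w. r \<le> cmod w} \<and> cmod w \<le> r \<longrightarrow>
          cnj w / of_real r = of_real r / w"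
      proof (intro allI impI)
        fix w assume "w \<in> {w. cmod w \<le> r} \<and> \<not> cmod w \<le> r \<or> w \<in> {w. r \<le> cmod w} \<and> cmod w \<le> r"
        then have w: "cmod w = r" by auto
        then have "w * cnj w = of_real r * of_real r"
          using complex_norm_square[of w] by (simp add: power2_eq_square)
        moreover have "w \<noteq> 0" using w r by auto
        ultimately show "cnj w / of_real r = of_real r / w" using r by (simp add: field_simps)
      qed
    qed
    moreover have "{w. cmod w \<le> r} \<union> {w. r \<le> cmod w} = UNIV" by auto
    ultimately show ?thesis by simp
  qed
  have k_le: "cmod (k w) \<le> 1" for w
  proof -
    have "cmod (k w) = r * cmod (reflect r w)" using k_reflect[of w] r by (simp add: norm_mult)
    also have "\<dots> \<le> r * (1 / r)" using r by (intro mult_left_mono cmod_reflect_le) auto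
    finally show ?thesis using r by simp
  qed
  define f where "f w = Re (u * k w ^ m)" for w
  have f_cont: "continuous_on UNIV f" unfolding f_def by (intro continuous_intros k_cont)
  have f_bdd: "bounded (range f)"
  proof -
    have "\<bar>f w\<bar> \<le> cmod u" for w
    proof -
      have "\<bar>f w\<bar> \<le> cmod (u * k w ^ m)" unfolding f_def by (rule abs_Re_le_cmod)
      also have "\<dots> \<le> cmod u * 1"
        unfolding norm_mult norm_power by (intro mult_left_mono power_le_one k_le) auto
      finally show ?thesis by simp
    qed
    then show ?thesis by (auto simp: bounded_iff)
  qed
  have int0: "integral\<^sup>L zero_limit f = 0"
  proof -
    \<comment> \<open>Rotation by pi / m multiplies the m-th power of k by -1 and preserves the
      limit measure, so the integral equals its negative.\<close>
    define \<theta> where "\<theta> = pi / real m"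
    have k_rot: "k (cis \<theta> * w) = cis (- \<theta>) * k w" for w
      by (simp add: k_def norm_mult cis_cnj cis_inverse[symmetric] divide_inverse inverse_mult_distrib mult_ac
          del: cis_inverse)
    have "real m * (- \<theta>) = - pi" using m by (simp add: \<theta>_def)
    then have "cis (- \<theta>) ^ m = cis (- pi)" by (simp only: Complex.DeMoivre)
    also have "\<dots> = -1" by (simp add: complex_eq_iff)
    finally have f_rot: "f (cis \<theta> * w) = - f w" for w
      unfolding f_def k_rot power_mult_distrib by simp
    have "integral\<^sup>L zero_limit f = integral\<^sup>L (distr zero_limit borel (\<lambda>w. cis \<theta> * w)) f"
      by (simp add: zero_limit_rotate)
    also have "\<dots> = integral\<^sup>L zero_limit (\<lambda>w. f (cis \<theta> * w))"
      using rotate_measurable borel_measurable_continuous_onI[OF f_cont]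
      by (intro integral_distr) (auto cong: measurable_cong_sets)
    also have "\<dots> = - integral\<^sup>L zero_limit f" unfolding f_rot by simp
    finally show ?thesis by simp
  qed
  have f_eq: "f = (\<lambda>w. Re (u * (of_real (exp (ln r)) * reflect (exp (ln r)) w) ^ m))"
    by (rule ext) (simp only: f_def k_reflect)
  have "((\<lambda>x. zero_measure_integral (F (fst x) (snd x)) f / real (L (fst x))) \<longlongrightarrow> 0) (whp M)"
    unfolding f_eq by (rule moment_tendsto[OF m])
  then have "converges f"
    unfolding converges_def int0 using f_cont f_bdd by blast
  then show ?thesis unfolding f_def k_def .
qed

sublocale test_class converges
proof
  show "converges (\<lambda>w. f w + g w)" if "converges f" "converges g" for f g
    using that by (rule converges_add)
  show "converges (\<lambda>w. c * f w)" if "converges f" for f c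
    using that by (rule converges_scale)
  show "converges f" if "continuous_on UNIV f" "\<And>e. e > 0 \<Longrightarrow> \<exists>g. converges g \<and> (\<forall>w. \<bar>f w - g w\<bar> \<le> e)" for f
    using that by (rule converges_closed)
  show "converges (\<lambda>w. ln (max R (cmod w)) - ln (max r (cmod w)))" if "0 < r" "r < R" for r R
    using that by (rule converges_log)
  show "converges (\<lambda>w. Re (u * (if cmod w \<le> r then cnj w / of_real r else of_real r / w) ^ m))"
    if "0 < r" "0 < m" for r m u
    using that by (rule converges_moment)
qed

lemma test_fun_tendsto:
  assumes "test_fun \<phi>"
  shows "((\<lambda>x. zero_measure_integral (F (fst x) (snd x)) \<phi> / real (L (fst x))) \<longlongrightarrow> integral\<^sup>L zero_limit \<phi>) (whp M)"
proof -
  have "smooth_fun \<phi>" "compact (closure {z. \<phi> z \<noteq> 0})" using assms by (auto simp: test_fun_def)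
  obtain \<phi>' where "\<And>x. (\<phi> has_derivative \<phi>' x) (at x)"
    using \<open>smooth_fun \<phi>\<close> by (rule smooth_fun.cases) blast
  then have cont: "continuous_on UNIV \<phi>"
    by (meson continuous_at_imp_continuous_on has_derivative_continuous)
  have "bounded {z. \<phi> z \<noteq> 0}"
    using \<open>compact (closure {z. \<phi> z \<noteq> 0})\<close> by (meson bounded_subset closure_subset compact_imp_bounded)
  then obtain \<rho> where \<rho>: "\<rho> > 0" "\<And>z. \<phi> z \<noteq> 0 \<Longrightarrow> cmod z \<le> \<rho>"
    by (auto simp: bounded_pos)
  have "converges \<phi>"
  proof (rule V_compact_support[OF cont])
    show "\<rho> + 1 > 0" using \<rho> by simp
    show "\<phi> w = 0" if "cmod w \<ge> \<rho> + 1" for w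
      using \<rho>(2)[of w] that by (cases "\<phi> w = 0") auto
  qed
  then show ?thesis by (simp add: converges_def)
qed

end

theorem theorem2:
  fixes M :: "'a measure"
    and \<xi> :: "nat \<Rightarrow> 'a \<Rightarrow> complex"
    and p :: "real \<Rightarrow> real"
    and T0 :: real
    and L :: "nat \<Rightarrow> nat"
    and \<delta> :: "nat \<Rightarrow> real"
    and pc :: "nat \<Rightarrow> nat \<Rightarrow> complex"
  assumes "prob_space M"
    and meas: "\<And>k. \<xi> k \<in> borel_measurable M"
    and indep: "prob_space.indep_vars M (\<lambda>_. borel) \<xi> UNIV"
    and ident: "\<And>k. distr M borel (\<xi> k) = distr M borel (\<xi> 0)"
    and nondeg: "\<not> (\<exists>c. AE \<omega> in M. \<xi> 0 \<omega> = c)"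
    and nozero: "measure M {\<omega> \<in> space M. \<xi> 0 \<omega> = 0} = 0"
    and logmom: "integrable M (\<lambda>\<omega>. ln (1 + cmod (\<xi> 0 \<omega>)))"
    and p_nonneg: "\<And>t. 0 \<le> t \<Longrightarrow> 0 \<le> p t"
    and T0: "0 < T0"
    and L_pos: "\<And>n. 0 < L n"
    and L_lim: "filterlim L at_top sequentially"
    and \<delta>_range: "\<And>n. - T0 < \<delta> n \<and> \<delta> n < T0"
    and \<delta>_lim: "\<delta> \<longlonglongrightarrow> 0"
    and deg_int: "\<And>n. (T0 - \<delta> n) * real (L n) \<in> \<int>"
    and p_pos: "\<And>t. 0 \<le> t \<Longrightarrow> t < T0 \<Longrightarrow> p t > 0"
    and p_zero: "\<And>t. t > T0 \<Longrightarrow> p t = 0"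
    and p_cont: "continuous_on {0..T0} p"
    and coef: "(\<lambda>n. Max ((\<lambda>k. \<bar>cmod (pc k n) powr (1 / real (L n))
                     - p (min (real k / real (L n)) T0)\<bar>)
                   ` {0..nat \<lfloor>(T0 - \<delta> n) * real (L n)\<rfloor>})) \<longlonglongrightarrow> 0"
  shows "\<exists>\<mu> :: complex measure.
           sets \<mu> = sets borel
         \<and> (\<forall>\<theta>::real. distr \<mu> borel (\<lambda>z. cis \<theta> * z) = \<mu>)
         \<and> (\<forall>r>0. emeasure \<mu> (ball 0 r) < \<infinity>
                 \<and> ((\<lambda>h. (legendre_I p (ln r + h) - legendre_I p (ln r)) / h)
                      \<longlongrightarrow> measure \<mu> (ball 0 r)) (at_left 0))
         \<and> (\<forall>\<phi>. test_fun \<phi> \<longrightarrow> (\<forall>\<epsilon>>0.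
              ((\<lambda>n. measure M {\<omega> \<in> space M.
                   \<bar>zero_measure_integral
                      (\<Sum>k\<le>nat \<lfloor>(T0 - \<delta> n) * real (L n)\<rfloor>. monom (\<xi> k \<omega> * pc k n) k) \<phi>
                      / real (L n) - integral\<^sup>L \<mu> \<phi>\<bar> > \<epsilon>}) \<longlongrightarrow> 0) sequentially))"
proof -
  interpret random_polynomials M p T0 \<xi> L \<delta> pc
    by (intro random_polynomials.intro legendre_setup.intro random_polynomials_axioms.intro) (fact assms)+
  show ?thesis
  proof (intro exI[of _ zero_limit] conjI allI impI)
    show "sets zero_limit = sets borel" by simp
    show "distr zero_limit borel (\<lambda>z. cis \<theta> * z) = zero_limit" for \<theta>
      by (rule zero_limit_rotate)
    fix r :: real assume r: "r > 0"
    show "emeasure zero_limit (ball 0 r) < \<infinity>"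
      by (simp add: emeasure_zero_limit_ball[OF r])
    show "((\<lambda>h. (I (ln r + h) - I (ln r)) / h) \<longlongrightarrow> measure zero_limit (ball 0 r)) (at_left 0)"
      unfolding measure_zero_limit_ball[OF r] by (rule left_slope_tendsto)
  next
    fix \<phi> and \<epsilon> :: real assume \<phi>: "test_fun \<phi>" and \<epsilon>: "\<epsilon> > 0"
    have "\<forall>\<^sub>F x in whp M. \<bar>zero_measure_integral (F (fst x) (snd x)) \<phi> / real (L (fst x)) -
        integral\<^sup>L zero_limit \<phi>\<bar> \<le> \<epsilon>"
      using tendstoD[OF test_fun_tendsto[OF \<phi>] \<epsilon>] by eventually_elim (simp add: dist_real_def)
    from eventually_whp_tendsto_prob[OF this]
    show "(\<lambda>n. prob {\<omega> \<in> space M. \<bar>zero_measure_integral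
        (\<Sum>k\<le>nat \<lfloor>(T0 - \<delta> n) * real (L n)\<rfloor>. monom (\<xi> k \<omega> * pc k n) k) \<phi> / real (L n) -
        integral\<^sup>L zero_limit \<phi>\<bar> > \<epsilon>}) \<longlonglongrightarrow> 0"
      by (simp add: F_def d_def not_le)
  qed
qed

end
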